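(* Assume that there are constants $C>0$, $r>1$, with $r<2N/(N-2)$ if $N\ge 3$, such that $|f(x,t)|\le C(|t|^{r-1}+1)$ for a.a. $x\in\Omega$ and all $t\in\mathbb{R}$. Assume moreover the following convexity condition, for each of the two signs $\pm$: for a.a. $x\in\Omega_\pm$ such that $u_\pm^-(x)\neq 0$, the function $f(x,\cdot)$ is convex on the interval $[u_0(\widetilde{x}),u_0(x)]$. If $u=0$ is a strict local minimizer of $\Psi_+$ and of $\Psi_-$, then $u_0$ is even in $x_1$, i.e. $u_0(\widetilde{x})=u_0(x)$ for all $x\in\Omega$. If in the convexity condition "convex" is replaced by "strictly convex", then it suffices to assume that $u=0$ is a local minimizer (not necessarily strict) of $\Psi_+$ and of $\Psi_-$.
   Context: Let $\Omega\subset\mathbb{R}^N$, $N\ge 2$, be a bounded domain that contains the origin and is symmetric with respect to the hyperplane $T=\{x\in\mathbb{R}^N: x_1=0\}$. For $x=(x_1,\dots,x_N)$ put $\widetilde{x}=(-x_1,x_2,\dots,x_N)$. Let $f:\Omega\times\mathbb{R}\to\mathbb{R}$ be a Carathéodory function that is even in $x_1$, i.e. $f(\widetilde{x},t)=f(x,t)$, and put $F(x,t)=\int_0^t f(x,s)\,ds$. Let $u_0\in C^2(\Omega)\cap C(\overline{\Omega})$ be a classical solution of $-\Delta u=f(x,u)$ in $\Omega$, $u=0$ on $\partial\Omega$. Under the growth condition, $u_0$ is a critical point of the $C^1$ functional $\Phi(u)=\int_\Omega \frac12|\nabla u|^2-F(x,u)$ on $H^1_0(\Omega)$. Define $$\Psi(u)=\Phi(u+u_0)-\Phi(u_0)=\int_\Omega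 \tfrac12|\nabla u|^2+f(x,u_0)\,u-F(x,u+u_0)+F(x,u_0),\quad u\in H^1_0(\Omega).$$ Let $\Omega_+=\{x\in\Omega:x_1>0\}$, $\Omega_-=\{x\in\Omega:x_1<0\}$, and let $\Psi_\pm$ be the restriction of $\Psi$ to $H^1_0(\Omega_\pm)$ (functions extended by zero to $\Omega$). Let $u_\pm(x)=u_0(\widetilde{x})-u_0(x)$ for $x\in\Omega_\pm$, and let $u_\pm^-=\max\{-u_\pm,0\}$ be its negative part. *)

theory Defs
  imports "HOL-Analysis.Analysis"
begin

section \<open>Classical differentiability\<close>

definition partial :: "'n::finite \<Rightarrow> (real^'n \<Rightarrow> real) \<Rightarrow> real^'n \<Rightarrow> real" where
  "partial i f x = frechet_derivative f (at x) (axis i 1)"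

text \<open>\<open>Ck_on m A f\<close> means \<open>f\<close> is of class \<open>C\<^sup>m\<close> on \<open>A\<close>; it is meant for open \<open>A\<close> only.\<close>

primrec Ck_on :: "nat \<Rightarrow> (real^'n::finite) set \<Rightarrow> (real^'n \<Rightarrow> real) \<Rightarrow> bool" where
  "Ck_on 0 A f \<longleftrightarrow> continuous_on A f"
| "Ck_on (Suc m) A f \<longleftrightarrow>
     (\<forall>x\<in>A. f differentiable (at x)) \<and> (\<forall>i. Ck_on m A (partial i f))"

definition laplacian :: "(real^'n::finite \<Rightarrow> real) \<Rightarrow> real^'n \<Rightarrow> real" where
  "laplacian f x = (\<Sum>i\<in>UNIV. partial i (partial i f) x)"

text \<open>\<open>C\<^sub>c\<^sup>\<infinity>(A)\<close>, as functions on the whole space.\<close>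

definition test_functions :: "(real^'n::finite) set \<Rightarrow> (real^'n \<Rightarrow> real) set" where
  "test_functions A = {\<phi>. (\<forall>m. Ck_on m UNIV \<phi>) \<and>
     compact (closure {x. \<phi> x \<noteq> 0}) \<and> closure {x. \<phi> x \<noteq> 0} \<subseteq> A}"

section \<open>Sobolev spaces\<close>

text \<open>
  Elements of the spaces are represented by total functions, of which only the values on
  \<open>A\<close> matter, and only up to null sets.
\<close>

definition locally_integrable_on ::
    "(real^'n::finite \<Rightarrow> 'b::euclidean_space) \<Rightarrow> (real^'n) set \<Rightarrow> bool" where
  "locally_integrable_on u A \<longleftrightarrow>
     (\<forall>K. compact K \<and> K \<subseteq> A \<longrightarrow> set_integrable lebesgue K u)"

definition square_integrable_on ::
    "(real^'n::finite \<Rightarrow> 'b::euclidean_space) \<Rightarrow> (real^'n) set \<Rightarrow> bool" where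
  "square_integrable_on u A \<longleftrightarrow>
     u \<in> borel_measurable (lebesgue_on A) \<and> set_integrable lebesgue A (\<lambda>x. (norm (u x))\<^sup>2)"

definition has_weak_gradient ::
    "(real^'n::finite) set \<Rightarrow> (real^'n \<Rightarrow> real) \<Rightarrow> (real^'n \<Rightarrow> real^'n) \<Rightarrow> bool" where
  "has_weak_gradient A u g \<longleftrightarrow>
     locally_integrable_on u A \<and> locally_integrable_on g A \<and>
     (\<forall>\<phi>\<in>test_functions A. \<forall>i.
        (LINT x:A|lebesgue. u x * partial i \<phi> x) = - (LINT x:A|lebesgue. g x $ i * \<phi> x))"

text \<open>For open \<open>A\<close> the weak gradient is unique up to a null subset of \<open>A\<close>, if it exists.\<close>

definition weak_gradient ::
    "(real^'n::finite) set \<Rightarrow> (real^'n \<Rightarrow> real) \<Rightarrow> real^'n \<Rightarrow> real^'n" where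
  "weak_gradient A u = (SOME g. has_weak_gradient A u g)"

definition H1 :: "(real^'n::finite) set \<Rightarrow> (real^'n \<Rightarrow> real) set" where
  "H1 A = {u. square_integrable_on u A \<and>
     (\<exists>g. has_weak_gradient A u g \<and> square_integrable_on g A)}"

definition H1_norm :: "(real^'n::finite) set \<Rightarrow> (real^'n \<Rightarrow> real) \<Rightarrow> real" where
  "H1_norm A u =
     sqrt (LINT x:A|lebesgue. (u x)\<^sup>2 + (norm (weak_gradient A u x))\<^sup>2)"

definition H10 :: "(real^'n::finite) set \<Rightarrow> (real^'n \<Rightarrow> real) set" where
  "H10 A = {u \<in> H1 A. \<exists>\<phi>::nat \<Rightarrow> real^'n \<Rightarrow> real. (\<forall>m. \<phi> m \<in> test_functions A) \<and>
     (\<lambda>m. H1_norm A (\<lambda>x. u x - \<phi> m x)) \<longlonglongrightarrow> 0}"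

definition zero_ext :: "(real^'n::finite) set \<Rightarrow> (real^'n \<Rightarrow> real) \<Rightarrow> real^'n \<Rightarrow> real" where
  "zero_ext A u x = (if x \<in> A then u x else 0)"

definition local_minimizer_H10 ::
    "(real^'n::finite) set \<Rightarrow> ((real^'n \<Rightarrow> real) \<Rightarrow> real) \<Rightarrow> (real^'n \<Rightarrow> real) \<Rightarrow> bool" where
  "local_minimizer_H10 A J u \<longleftrightarrow> u \<in> H10 A \<and>
     (\<exists>\<epsilon>>0. \<forall>v\<in>H10 A. H1_norm A (\<lambda>x. v x - u x) < \<epsilon> \<longrightarrow> J u \<le> J v)"

definition strict_local_minimizer_H10 ::
    "(real^'n::finite) set \<Rightarrow> ((real^'n \<Rightarrow> real) \<Rightarrow> real) \<Rightarrow> (real^'n \<Rightarrow> real) \<Rightarrow> bool" where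
  "strict_local_minimizer_H10 A J u \<longleftrightarrow> u \<in> H10 A \<and>
     (\<exists>\<epsilon>>0. \<forall>v\<in>H10 A. H1_norm A (\<lambda>x. v x - u x) < \<epsilon> \<and>
        \<not> (AE x in lebesgue_on A. v x = u x) \<longrightarrow> J u < J v)"

section \<open>The boundary value problem and its energy functionals\<close>

text \<open>
  An arbitrary fixed index \<open>k\<close> plays the role of the first coordinate: \<open>reflect k x\<close> is the
  point written \<open>x\<close> with a tilde.
\<close>

definition reflect :: "'n::finite \<Rightarrow> real^'n \<Rightarrow> real^'n" where
  "reflect k x = (\<chi> i. if i = k then - x $ i else x $ i)"

definition half_pos :: "'n::finite \<Rightarrow> (real^'n) set \<Rightarrow> (real^'n) set" where
  "half_pos k \<Omega> = {x \<in> \<Omega>. x $ k > 0}"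

definition half_neg :: "'n::finite \<Rightarrow> (real^'n) set \<Rightarrow> (real^'n) set" where
  "half_neg k \<Omega> = {x \<in> \<Omega>. x $ k < 0}"

definition caratheodory :: "(real^'n::finite) set \<Rightarrow> (real^'n \<Rightarrow> real \<Rightarrow> real) \<Rightarrow> bool" where
  "caratheodory \<Omega> f \<longleftrightarrow>
     (\<forall>t. (\<lambda>x. f x t) \<in> borel_measurable (lebesgue_on \<Omega>)) \<and>
     (AE x in lebesgue_on \<Omega>. continuous_on UNIV (f x))"

definition classical_solution ::
    "(real^'n::finite) set \<Rightarrow> (real^'n \<Rightarrow> real \<Rightarrow> real) \<Rightarrow> (real^'n \<Rightarrow> real) \<Rightarrow> bool" where
  "classical_solution \<Omega> f u \<longleftrightarrow>
     Ck_on 2 \<Omega> u \<and> continuous_on (closure \<Omega>) u \<and>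
     (\<forall>x\<in>\<Omega>. - laplacian u x = f x (u x)) \<and> (\<forall>x\<in>frontier \<Omega>. u x = 0)"

text \<open>The interval integral is oriented, so \<open>primitive f x t\<close> is also right for \<open>t < 0\<close>.\<close>

definition primitive :: "(real^'n::finite \<Rightarrow> real \<Rightarrow> real) \<Rightarrow> real^'n \<Rightarrow> real \<Rightarrow> real" where
  "primitive f x t = (LBINT s=0..t. f x s)"

definition Phi ::
    "(real^'n::finite) set \<Rightarrow> (real^'n \<Rightarrow> real \<Rightarrow> real) \<Rightarrow> (real^'n \<Rightarrow> real) \<Rightarrow> real" where
  "Phi \<Omega> f u =
     (LINT x:\<Omega>|lebesgue. (norm (weak_gradient \<Omega> u x))\<^sup>2 / 2 - primitive f x (u x))"

definition Psi ::
    "(real^'n::finite) set \<Rightarrow> (real^'n \<Rightarrow> real \<Rightarrow> real) \<Rightarrow> (real^'n \<Rightarrow> real) \<Rightarrow>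
     (real^'n \<Rightarrow> real) \<Rightarrow> real" where
  "Psi \<Omega> f u0 u = Phi \<Omega> f (\<lambda>x. u x + u0 x) - Phi \<Omega> f u0"

text \<open>The restriction of \<open>Psi\<close> to \<open>H10 A\<close> for a subdomain \<open>A\<close> of \<open>\<Omega>\<close>.\<close>

definition Psi_restr ::
    "(real^'n::finite) set \<Rightarrow> (real^'n \<Rightarrow> real \<Rightarrow> real) \<Rightarrow> (real^'n \<Rightarrow> real) \<Rightarrow>
     (real^'n) set \<Rightarrow> (real^'n \<Rightarrow> real) \<Rightarrow> real" where
  "Psi_restr \<Omega> f u0 A v = Psi \<Omega> f u0 (zero_ext A v)"

definition refl_diff :: "'n::finite \<Rightarrow> (real^'n \<Rightarrow> real) \<Rightarrow> real^'n \<Rightarrow> real" where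
  "refl_diff k u0 x = u0 (reflect k x) - u0 x"

definition neg_part :: "('a \<Rightarrow> real) \<Rightarrow> 'a \<Rightarrow> real" where
  "neg_part u x = max (- u x) 0"

definition strictly_convex_on :: "real set \<Rightarrow> (real \<Rightarrow> real) \<Rightarrow> bool" where
  "strictly_convex_on S g \<longleftrightarrow> convex S \<and>
     (\<forall>x\<in>S. \<forall>y\<in>S. \<forall>a>0. \<forall>b>0. x \<noteq> y \<and> a + b = 1 \<longrightarrow>
        g (a * x + b * y) < a * g x + b * g y)"

text \<open>The convexity condition on \<open>A\<close>, for a notion \<open>cvx\<close> of convexity.\<close>

definition convexity_condition ::
    "(real set \<Rightarrow> (real \<Rightarrow> real) \<Rightarrow> bool) \<Rightarrow> 'n::finite \<Rightarrow>
     (real^'n \<Rightarrow> real \<Rightarrow> real) \<Rightarrow> (real^'n \<Rightarrow> real) \<Rightarrow> (real^'n) set \<Rightarrow> bool" where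
  "convexity_condition cvx k f u0 A \<longleftrightarrow>
     (AE x in lebesgue_on A. neg_part (refl_diff k u0) x \<noteq> 0 \<longrightarrow>
        cvx {u0 (reflect k x)..u0 x} (f x))"

end

theory Submission
  imports Defs
begin

text \<open>
  Write \<open>w(x) = u0(x) - u0(\<rho> x)\<close>, where \<open>\<rho>\<close> is the reflection, and let \<open>v\<close> be the positive part of
  \<open>w\<close> on one of the two halves of the domain. (In the notation of the statement, \<open>v\<close> is the negative part of
  \<open>u\<^sub>+\<close> or \<open>u\<^sub>-\<close>.) The function \<open>w\<close> vanishes on the boundary of the half and satisfies
  \<open>- \<Delta>w = f(x, u0) - f(x, u0 - w)\<close>. Testing this equation and the one for \<open>u0\<close> with \<open>v\<close> eliminates the
  gradients from \<open>\<Psi>(- t v)\<close>: it is the integral of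
  \<open>F(x, u0) - F(x, u0 - t v) - t f(x, u0) v + t\<^sup>2/2 (f(x, u0) - f(x, u0 - v)) v\<close>
  (\<open>Psi_along_pos_part\<close>). Where \<open>v > 0\<close>, convexity bounds \<open>f(x, u0 - s v)\<close> by the chord
  \<open>(1 - s) f(x, u0) + s f(x, u0 - v)\<close>; integrating over \<open>0 \<le> s \<le> t\<close> shows that the integrand is nonpositive,
  and negative under strict convexity (\<open>primitive_convex_gap\<close>). So \<open>\<Psi>(- t v) \<le> 0\<close> for all small \<open>t > 0\<close>,
  strictly in the strictly convex case unless \<open>v = 0\<close>. As \<open>0\<close> is a minimizer, \<open>v = 0\<close>
  (\<open>pos_set_empty\<close>). Hence \<open>u0 \<le> u0 \<circ> \<rho>\<close> on both halves. As \<open>\<rho>\<close> exchanges them, equality holds.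

  To justify the testing, \<open>v\<close> is approximated by \<open>T(w)\<close>, where \<open>T\<close> is a \<open>C\<^sup>1\<close> truncation that vanishes near
  \<open>(-\<infinity>, 0]\<close> (\<open>trunc\<close>). Then \<open>T(w)\<close> has compact support in the half, and integrations by parts reduce to the fact
  that a partial derivative of a compactly supported \<open>C\<^sup>1\<close> function has integral \<open>0\<close>. Monotone and dominated
  convergence give the weak gradient of \<open>v\<close>, also of its extension by zero, and the two tested
  equations. Mollifying \<open>T(w)\<close> shows that \<open>v\<close> belongs to \<open>H\<^sup>1\<^sub>0\<close>. The same energy argument, applied to
  the positive parts of \<open>u0\<close> and \<open>- u0\<close>, shows that the gradient of \<open>u0\<close> is square integrable.

  As the functionals involve a choice of a weak gradient, uniqueness of the latter almost everywhere is
  needed throughout; it rests on the fundamental lemma of the calculus of variations, which again follows by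
  mollification. Finally, integrals of \<open>F(x, h(x))\<close> make sense because a Caratheodory function is jointly
  measurable up to a null set.
\<close>

section \<open>Partial derivatives and functions of class \<open>C\<^sup>m\<close>\<close>

lemma partial_eqI:
  assumes "(f has_derivative f') (at x)"
  shows "partial i f x = f' (axis i 1)"
  using frechet_derivative_at[OF assms] by (simp add: partial_def)

lemma frechet_derivative_worksI:
  "f differentiable (at x) \<Longrightarrow> (f has_derivative frechet_derivative f (at x)) (at x)"
  by (simp add: frechet_derivative_works)

lemma has_derivative_partials:
  assumes "f differentiable (at x)"
  shows "(f has_derivative (\<lambda>h. \<Sum>i\<in>UNIV. partial i f x * h $ i)) (at x)"
proof -
  let ?f' = "frechet_derivative f (at x)"
  have f': "(f has_derivative ?f') (at x)"
    using assms frechet_derivative_works by blast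
  then interpret bounded_linear ?f'
    by (rule has_derivative_bounded_linear)
  have "?f' h = (\<Sum>i\<in>UNIV. partial i f x * h $ i)" for h
  proof -
    have "?f' h = ?f' (\<Sum>i\<in>UNIV. h $ i *\<^sub>R axis i 1)"
      using basis_expansion[of h] by (simp add: scalar_mult_eq_scaleR)
    also have "\<dots> = (\<Sum>i\<in>UNIV. partial i f x * h $ i)"
      by (simp add: sum scaleR partial_def mult.commute)
    finally show ?thesis .
  qed
  then have "?f' = (\<lambda>h. \<Sum>i\<in>UNIV. partial i f x * h $ i)"
    by (rule ext)
  then show ?thesis using f' by simp
qed

lemma partial_cong_open:
  assumes "open A" "x \<in> A" "\<And>y. y \<in> A \<Longrightarrow> f y = g y"
  shows "partial i f x = partial i g x"
proof -
  have "(f has_derivative D) (at x) \<longleftrightarrow> (g has_derivative D) (at x)" for D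
    using assms by (metis has_derivative_transform_within_open)
  then show ?thesis by (simp add: partial_def frechet_derivative_def)
qed

lemma differentiable_cong_open:
  assumes "f differentiable (at x)" "open A" "x \<in> A" "\<And>y. y \<in> A \<Longrightarrow> f y = g y"
  shows "g differentiable (at x)"
  using assms unfolding differentiable_def by (metis has_derivative_transform_within_open)

lemma partial_mult:
  assumes "f differentiable (at x)" "g differentiable (at x)"
  shows "partial i (\<lambda>x. f x * g x) x = f x * partial i g x + partial i f x * g x"
  by (subst partial_eqI[OF has_derivative_mult[OF
      frechet_derivative_worksI[OF assms(1)] frechet_derivative_worksI[OF assms(2)]]])
    (simp add: partial_def)

lemma partial_chain:
  fixes f :: "real^'n::finite \<Rightarrow> real"
  assumes "f differentiable (at x)" "(g has_real_derivative g') (at (f x))"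
  shows "partial i (\<lambda>x. g (f x)) x = g' * partial i f x"
  by (subst partial_eqI[OF has_derivative_compose[OF frechet_derivative_worksI[OF assms(1)]
      assms(2)[unfolded has_field_derivative_def]]])
    (simp add: partial_def)

lemma partial_add:
  assumes "f differentiable (at x)" "g differentiable (at x)"
  shows "partial i (\<lambda>x. f x + g x) x = partial i f x + partial i g x"
  by (subst partial_eqI[OF has_derivative_add[OF
      frechet_derivative_worksI[OF assms(1)] frechet_derivative_worksI[OF assms(2)]]])
    (simp add: partial_def)

lemma partial_diff:
  assumes "f differentiable (at x)" "g differentiable (at x)"
  shows "partial i (\<lambda>x. f x - g x) x = partial i f x - partial i g x"
  by (subst partial_eqI[OF has_derivative_diff[OF
      frechet_derivative_worksI[OF assms(1)] frechet_derivative_worksI[OF assms(2)]]])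
    (simp add: partial_def)

lemma partial_const: "partial i (\<lambda>x. c) x = 0"
  by (simp add: partial_eqI[OF has_derivative_const])

lemma partial_coordinate: "partial i (\<lambda>x. x $ j) x = (if i = j then 1 else 0)"
  by (subst partial_eqI[OF bounded_linear_imp_has_derivative[OF bounded_linear_vec_nth]])
     (auto simp: axis_def)

lemma partial_eq_0_outside:
  assumes "closed K" "\<And>x. x \<notin> K \<Longrightarrow> f x = 0" "x \<notin> K"
  shows "partial i f x = 0"
proof -
  have "partial i f x = partial i (\<lambda>x. 0) x"
    using assms by (intro partial_cong_open[of "- K"]) auto
  then show ?thesis by (simp add: partial_const)
qed

lemma Ck_on_SucD: "Ck_on (Suc m) A f \<Longrightarrow> Ck_on m A f"
proof (induction m arbitrary: f)
  case 0
  then have "isCont f x" if "x \<in> A" for x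
    using that differentiable_imp_continuous_within by auto
  then show ?case
    by (simp add: continuous_at_imp_continuous_on)
next
  case (Suc m)
  then show ?case by (metis Ck_on.simps(2))
qed

lemma Ck_on_continuous: "Ck_on m A f \<Longrightarrow> continuous_on A f"
  by (induction m) (simp, metis Ck_on_SucD)

lemma Ck_on_Suc_continuous_partial: "Ck_on (Suc m) A f \<Longrightarrow> continuous_on A (partial i f)"
  using Ck_on_continuous[of m A "partial i f"] by auto

text \<open>
  The definition of \<open>Ck_on\<close> refers to the values of the iterated derivatives as total functions.
  This lemma allows rewriting them on \<open>A\<close> only; openness makes derivatives local.
\<close>

lemma Ck_on_cong_open:
  assumes "open A" "Ck_on m A f" "\<And>x. x \<in> A \<Longrightarrow> f x = g x"
  shows "Ck_on m A g"
  using assms(2,3)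
proof (induction m arbitrary: f g)
  case 0
  then show ?case by (simp cong: continuous_on_cong)
next
  case (Suc m)
  have "Ck_on m A (partial i g)" for i
  proof (rule Suc.IH)
    show "Ck_on m A (partial i f)" using Suc.prems by simp
    show "partial i f x = partial i g x" if "x \<in> A" for x
      using partial_cong_open[OF assms(1) that, of f g] Suc.prems(2) by blast
  qed
  moreover have "g differentiable (at x)" if "x \<in> A" for x
    by (rule differentiable_cong_open[OF _ assms(1) that, of f]) (use Suc.prems that in auto)
  ultimately show ?case by simp
qed

lemma Ck_on_subset: "Ck_on m A f \<Longrightarrow> B \<subseteq> A \<Longrightarrow> Ck_on m B f"
  by (induction m arbitrary: f) (auto intro: continuous_on_subset)

lemma Ck_on_const: "Ck_on m A (\<lambda>x. c)"
  by (induction m arbitrary: c) (auto simp: partial_const[abs_def])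

lemma Ck_on_add:
  assumes "open A"
  shows "Ck_on m A f \<Longrightarrow> Ck_on m A g \<Longrightarrow> Ck_on m A (\<lambda>x. f x + g x)"
proof (induction m arbitrary: f g)
  case (Suc m)
  have "Ck_on m A (partial i (\<lambda>x. f x + g x))" for i
  proof (rule Ck_on_cong_open[OF assms])
    show "Ck_on m A (\<lambda>x. partial i f x + partial i g x)"
      using Suc by simp
  qed (use Suc.prems in \<open>auto simp: partial_add\<close>)
  then show ?case using Suc.prems by auto
qed (auto intro!: continuous_intros)

lemma Ck_on_mult:
  assumes "open A"
  shows "Ck_on m A f \<Longrightarrow> Ck_on m A g \<Longrightarrow> Ck_on m A (\<lambda>x. f x * g x)"
proof (induction m arbitrary: f g)
  case (Suc m)
  then have fg: "Ck_on m A f" "Ck_on m A g"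
    by (blast intro: Ck_on_SucD)+
  have "Ck_on m A (partial i (\<lambda>x. f x * g x))" for i
  proof (rule Ck_on_cong_open[OF assms])
    show "Ck_on m A (\<lambda>x. f x * partial i g x + partial i f x * g x)"
      using Suc.IH Suc.prems fg by (intro Ck_on_add[OF assms]) auto
  qed (use Suc.prems in \<open>auto simp: partial_mult\<close>)
  then show ?case using Suc.prems by auto
qed (auto intro!: continuous_intros)

lemma Ck_on_diff:
  assumes "open A" "Ck_on m A f" "Ck_on m A g"
  shows "Ck_on m A (\<lambda>x. f x - g x)"
  using Ck_on_add[OF assms(1,2) Ck_on_mult[OF assms(1) Ck_on_const assms(3)], of "-1"] by simp

lemma Ck_on_coordinate: "Ck_on m UNIV (\<lambda>x. x $ j)"
  by (cases m) (auto simp: partial_coordinate[abs_def] Ck_on_const intro!: continuous_intros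
     bounded_linear_imp_differentiable bounded_linear_vec_nth)

lemma Ck_on_1_iff:
  "Ck_on 1 A f \<longleftrightarrow> (\<forall>x\<in>A. f differentiable (at x)) \<and> (\<forall>i. continuous_on A (partial i f))"
  by simp

lemma Ck_on_1_chain:
  assumes "Ck_on 1 A f" "\<And>s. (g has_real_derivative g' s) (at s)" "continuous_on UNIV g'"
  shows "Ck_on 1 A (\<lambda>x. g (f x))"
  unfolding Ck_on_1_iff
proof (intro conjI ballI allI)
  fix i
  have "continuous_on A (\<lambda>x. g' (f x) * partial i f x)"
    using assms Ck_on_continuous[OF assms(1)]
    by (auto intro!: continuous_intros continuous_on_compose2[OF assms(3)])
  then show "continuous_on A (partial i (\<lambda>x. g (f x)))"
    using assms(1,2) by (subst continuous_on_cong[OF refl partial_chain]) (auto simp: Ck_on_1_iff)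
next
  fix x assume "x \<in> A"
  then have "f differentiable (at x)" using assms(1) by (simp add: Ck_on_1_iff)
  then show "(\<lambda>x. g (f x)) differentiable (at x)"
    using differentiable_chain_at[of f x g] assms(2)
    by (auto simp: o_def has_field_derivative_def differentiable_def)
qed

definition grad :: "(real^'n::finite \<Rightarrow> real) \<Rightarrow> real^'n \<Rightarrow> real^'n" where
  "grad f x = (\<chi> i. partial i f x)"

lemma grad_continuous:
  assumes "Ck_on 1 A w"
  shows "continuous_on A (grad w)"
  unfolding grad_def[abs_def] using assms by (auto simp: Ck_on_1_iff intro!: continuous_intros)

lemma Ck_on_2_imp_1: "Ck_on 2 A w \<Longrightarrow> Ck_on 1 A w"
  using Ck_on_SucD[of 1 A w] by (simp add: numeral_2_eq_2 del: Ck_on.simps)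

lemma laplacian_continuous:
  assumes "Ck_on 2 A p"
  shows "continuous_on A (laplacian p)"
proof -
  have "Ck_on 1 A (partial i p)" for i
    using assms by (simp add: numeral_2_eq_2)
  then show ?thesis
    unfolding laplacian_def[abs_def] by (auto simp: Ck_on_1_iff intro!: continuous_intros)
qed

lemma laplacian_diff:
  assumes A: "open A" "x \<in> A" and f: "Ck_on 2 A f" and g: "Ck_on 2 A g"
  shows "laplacian (\<lambda>x. f x - g x) x = laplacian f x - laplacian g x"
proof -
  have "partial i (partial i (\<lambda>x. f x - g x)) x = partial i (partial i f) x - partial i (partial i g) x" for i
  proof -
    have "partial i (partial i (\<lambda>x. f x - g x)) x = partial i (\<lambda>x. partial i f x - partial i g x) x"
      using f g by (intro partial_cong_open[OF A] partial_diff) (auto simp: numeral_2_eq_2)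
    also have "\<dots> = partial i (partial i f) x - partial i (partial i g) x"
      using f g A(2) by (intro partial_diff) (auto simp: numeral_2_eq_2)
    finally show ?thesis .
  qed
  then show ?thesis by (simp add: laplacian_def sum_subtractf)
qed

section \<open>Smooth bump functions\<close>

text \<open>
  The family \<open>exp(- 1/t) / t\<^sup>n\<close>, extended by \<open>0\<close>, spans a space that is closed under
  differentiation. Smoothness of \<open>exp(- 1/t)\<close> therefore follows by a single induction for all \<open>n\<close> at once.
\<close>

definition flat_exp :: "nat \<Rightarrow> real \<Rightarrow> real" where
  "flat_exp n t = (if t > 0 then exp (- 1 / t) / t ^ n else 0)"

text \<open>
  A quadratic bound is what differentiability at \<open>0\<close> needs. It comes from the term of order
  \<open>n + 2\<close> of the exponential series at \<open>1/t\<close>.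
\<close>

lemma flat_exp_le: "\<bar>flat_exp n t\<bar> \<le> fact (n + 2) * t\<^sup>2"
proof (cases "t > 0")
  case True
  define c :: real where "c = fact (n + 2)"
  have "c > 0" by (simp add: c_def)
  have "(1 / t) ^ (n + 2) / fact (n + 2) \<le> exp (1 / t)"
  proof -
    have "(1/t) ^ (n + 2) /\<^sub>R fact (n + 2) \<le> (\<Sum>i. (1/t) ^ i /\<^sub>R fact i)"
      using sum_le_suminf[OF summable_exp_generic[of "1/t"], of "{n+2}"] True by auto
    then show ?thesis by (simp add: exp_def divide_inverse mult.commute)
  qed
  then have "(1 / t) ^ (n + 2) / c \<le> exp (1 / t)"
    by (simp add: c_def)
  then have "inverse (exp (1/t)) \<le> inverse ((1 / t) ^ (n + 2) / c)"
    using True \<open>c > 0\<close> by (intro le_imp_inverse_le) auto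
  then have "exp (- 1 / t) \<le> c * t ^ (n + 2)"
    using \<open>c > 0\<close> True by (simp add: exp_minus field_simps)
  then have "exp (- 1 / t) / t ^ n \<le> fact (n + 2) * t\<^sup>2"
    using True unfolding c_def[symmetric] by (simp add: field_simps power_add power2_eq_square)
  then show ?thesis using True by (simp add: flat_exp_def)
qed (simp add: flat_exp_def)

lemma has_derivative_flat_exp:
  "(flat_exp n has_real_derivative (flat_exp (n + 2) t - real n * flat_exp (n + 1) t)) (at t)"
proof (cases "t = 0")
  case True
  have "((\<lambda>h. (flat_exp n (0 + h) - flat_exp n 0) / h) \<longlongrightarrow> 0) (at 0)"
  proof (rule Lim_null_comparison)
    show "\<forall>\<^sub>F h in at 0. norm ((flat_exp n (0 + h) - flat_exp n 0) / h) \<le> fact (n + 2) * \<bar>h\<bar>"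
    proof (rule always_eventually, rule allI)
      fix h
      show "norm ((flat_exp n (0 + h) - flat_exp n 0) / h) \<le> fact (n + 2) * \<bar>h\<bar>"
        using flat_exp_le[of n h]
        by (cases "h = 0") (auto simp: flat_exp_def[of n 0] field_simps power2_eq_square
           abs_mult_self_eq simp del: fact_Suc)
    qed
    show "((\<lambda>h. fact (n + 2) * \<bar>h\<bar>) \<longlongrightarrow> 0) (at (0::real))"
      by (auto intro!: tendsto_eq_intros)
  qed
  then show ?thesis using True by (simp add: DERIV_def flat_exp_def)
next
  case False
  show ?thesis
  proof (cases "t > 0")
    case True
    have "((\<lambda>t. exp (- 1 / t) / t ^ n) has_real_derivative
        (flat_exp (n + 2) t - real n * flat_exp (n + 1) t)) (at t)"
      using True
      by (auto intro!: derivative_eq_intros simp: flat_exp_def field_simps power2_eq_square)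
         (cases n; simp add: field_simps)
    then show ?thesis
      by (rule has_field_derivative_transform_within_open[where S="{0<..}"])
         (use True in \<open>auto simp: flat_exp_def\<close>)
  next
    case False
    have "((\<lambda>t. 0) has_real_derivative
        (flat_exp (n + 2) t - real n * flat_exp (n + 1) t)) (at t)"
      using False by (auto simp: flat_exp_def)
    then show ?thesis
      by (rule has_field_derivative_transform_within_open[where S="{..<0}"])
         (use False \<open>t \<noteq> 0\<close> in \<open>auto simp: flat_exp_def\<close>)
  qed
qed

text \<open>
  With \<open>d = \<delta>\<^sup>2\<close> this is a smooth function supported in the ball of radius \<open>\<delta>\<close>. The chain rule
  turns a partial derivative into products of functions of the same kind with a coordinate.
\<close>

lemma Ck_on_radial_bump: "Ck_on m UNIV (\<lambda>x::real^'n::finite. flat_exp n (d - x \<bullet> x))"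
proof (induction m arbitrary: n)
  case 0
  have "isCont (flat_exp n) t" for t
    using has_derivative_flat_exp by (rule DERIV_isCont)
  then have "continuous_on UNIV (flat_exp n)"
    by (simp add: continuous_on_eq_continuous_at)
  then show ?case
    by (auto intro!: continuous_on_compose2[of UNIV "flat_exp n"] continuous_intros)
next
  case (Suc m)
  have d: "((\<lambda>x::real^'n. flat_exp n (d - x \<bullet> x)) has_derivative
      (\<lambda>h. (flat_exp (n + 2) (d - x \<bullet> x) - real n * flat_exp (n + 1) (d - x \<bullet> x)) * (- 2 * (x \<bullet> h)))) (at x)" for x
    by (rule has_derivative_compose[OF _ has_derivative_flat_exp[unfolded has_field_derivative_def], THEN has_derivative_eq_rhs])
       (auto intro!: derivative_eq_intros simp: inner_commute fun_eq_iff)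
  have p: "partial i (\<lambda>x::real^'n. flat_exp n (d - x \<bullet> x)) =
      (\<lambda>x. (flat_exp (n + 2) (d - x \<bullet> x) + (- real n) * flat_exp (n + 1) (d - x \<bullet> x)) * (- 2 * x $ i))" for i
    by (auto simp: partial_eqI[OF d] inner_axis)
  have "Ck_on m UNIV (partial i (\<lambda>x::real^'n. flat_exp n (d - x \<bullet> x)))" for i
    unfolding p by (intro open_UNIV Ck_on_mult Ck_on_add Ck_on_const Ck_on_coordinate Suc)
  moreover have "(\<lambda>x::real^'n. flat_exp n (d - x \<bullet> x)) differentiable (at x)" for x
    using d unfolding differentiable_def by blast
  ultimately show ?case by simp
qed

lemma compact_subset_cbox:
  fixes K :: "'a::euclidean_space set"
  assumes "compact K"
  obtains a where "K \<subseteq> cbox (-a) a"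
  using bounded_subset_cbox_symmetric[OF compact_imp_bounded[OF assms]] that by metis

lemma compact_support_integrable:
  fixes h :: "'a::euclidean_space \<Rightarrow> real"
  assumes "continuous_on UNIV h" "compact K" "\<And>x. x \<notin> K \<Longrightarrow> h x = 0"
  shows "h integrable_on UNIV"
proof -
  obtain a where "K \<subseteq> cbox (-a) a"
    by (rule compact_subset_cbox[OF assms(2)])
  then have "h x = 0" if "x \<notin> cbox (-a) a" for x
    using that assms(3) by blast
  moreover have "h integrable_on cbox (-a) a"
    by (intro integrable_continuous continuous_on_subset[OF assms(1)]) auto
  ultimately show ?thesis
    by (intro integrable_on_superset[of h "cbox (-a) a" UNIV]) simp_all
qed

lemma integral_UNIV_eq_cbox:
  fixes h :: "'a::euclidean_space \<Rightarrow> real"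
  assumes "\<And>x. x \<notin> cbox a b \<Longrightarrow> h x = 0"
  shows "integral UNIV h = integral (cbox a b) h"
proof -
  have "(\<lambda>x. if x \<in> cbox a b then h x else 0) = h"
    using assms by auto
  then show ?thesis using integral_restrict_UNIV[of "cbox a b" h] by simp
qed

text \<open>
  The affine substitution rule \<open>has_integral_affinity\<close> is for boxes; the compact support transfers it
  to the whole space.
\<close>

lemma integral_UNIV_reflect_shift:
  fixes h :: "'a::euclidean_space \<Rightarrow> real"
  assumes "continuous_on UNIV h" "compact K" "\<And>x. x \<notin> K \<Longrightarrow> h x = 0"
  shows "integral UNIV (\<lambda>y. h (c - y)) = integral UNIV h"
proof -
  obtain a where a: "K \<subseteq> cbox (-a) a"
    by (rule compact_subset_cbox[OF assms(2)])
  let ?i = "integral (cbox (-a) a) h"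
  have "(h has_integral ?i) (cbox (-a) a)"
    by (intro integrable_integral integrable_continuous continuous_on_subset[OF assms(1)]) auto
  from has_integral_affinity[OF this, of "-1" c]
  have "((\<lambda>y. h (c - y)) has_integral ?i) ((\<lambda>x. c - x) ` cbox (-a) a)"
    by simp
  moreover have "h (c - y) = 0" if "y \<notin> (\<lambda>x. c - x) ` cbox (-a) a" for y
  proof -
    have "c - y \<notin> cbox (-a) a"
    proof
      assume "c - y \<in> cbox (- a) a"
      then have "c - (c - y) \<in> (\<lambda>x. c - x) ` cbox (-a) a" by (rule imageI)
      then show False using that by simp
    qed
    then show ?thesis using a assms(3) by blast
  qed
  ultimately have "((\<lambda>y. h (c - y)) has_integral ?i) UNIV"
    by (rule has_integral_on_superset) auto
  moreover have "integral UNIV h = ?i"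
    using a assms(3) by (intro integral_UNIV_eq_cbox) blast
  ultimately show ?thesis
    by (simp add: integral_unique)
qed

lemma smooth_bump_exists:
  assumes "\<delta> > 0"
  obtains \<eta> :: "real^'n::finite \<Rightarrow> real" where
    "\<And>m. Ck_on m UNIV \<eta>" "\<And>x. \<eta> x \<ge> 0" "\<And>x. norm x \<ge> \<delta> \<Longrightarrow> \<eta> x = 0"
    "(\<eta> has_integral 1) UNIV"
proof -
  define \<eta> where "\<eta> x = flat_exp 0 (\<delta>\<^sup>2 - x \<bullet> x)" for x :: "real^'n"
  have smooth: "Ck_on m UNIV \<eta>" for m
    unfolding \<eta>_def[abs_def] by (rule Ck_on_radial_bump)
  have nonneg: "\<eta> x \<ge> 0" for x
    by (simp add: \<eta>_def flat_exp_def)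
  have zero: "\<eta> x = 0" if "norm x \<ge> \<delta>" for x
  proof -
    have "\<delta>\<^sup>2 \<le> x \<bullet> x"
      unfolding dot_square_norm using that assms by (intro power_mono) auto
    then show ?thesis by (simp add: \<eta>_def flat_exp_def)
  qed
  have cont: "continuous_on UNIV \<eta>"
    using smooth[of 0] by simp
  \<comment> \<open>The cube of side \<open>2 \<delta>\<close>, which contains the ball of radius \<open>\<delta>\<close>.\<close>
  let ?a = "(\<Sum>b\<in>Basis. \<delta> *\<^sub>R b) :: real^'n"
  have out: "\<eta> x = 0" if nb: "x \<notin> cbox (- ?a) ?a" for x
  proof -
    obtain b :: "real^'n" where b: "b \<in> Basis" "\<not> (- ?a \<bullet> b \<le> x \<bullet> b \<and> x \<bullet> b \<le> ?a \<bullet> b)"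
      using nb unfolding mem_box by blast
    then have "\<bar>x \<bullet> b\<bar> > \<delta>" by auto
    then have "norm x \<ge> \<delta>"
      using Basis_le_norm[OF b(1), of x] by linarith
    then show ?thesis by (rule zero)
  qed
  define c where "c = integral (cbox (- ?a) ?a) \<eta>"
  have "box (- ?a) ?a \<noteq> {}"
    using assms by (auto simp: box_ne_empty inner_sum_left inner_Basis if_distrib[of "\<lambda>x. _ * x"] cong: if_cong)
  moreover have "\<eta> 0 \<noteq> 0" "0 \<in> cbox (- ?a) ?a"
    using assms by (auto simp: \<eta>_def flat_exp_def mem_box inner_sum_left inner_Basis if_distrib[of "\<lambda>x. _ * x"] cong: if_cong)
  ultimately have "c \<noteq> 0"
    unfolding c_def using nonneg continuous_on_subset[OF cont]
    by (subst integral_cbox_eq_0_iff) auto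
  have "(\<eta> has_integral c) (cbox (- ?a) ?a)"
    unfolding c_def
    by (intro integrable_integral integrable_continuous continuous_on_subset[OF cont]) auto
  then have "(\<eta> has_integral c) UNIV"
    using out by (rule has_integral_on_superset) auto
  then have int: "((\<lambda>x. (1/c) * \<eta> x) has_integral 1) UNIV"
    using has_integral_mult_right[of \<eta> c UNIV "1/c"] \<open>c \<noteq> 0\<close> by simp
  have "c \<ge> 0"
    unfolding c_def using nonneg
    by (intro integral_nonneg integrable_continuous continuous_on_subset[OF cont]) auto
  show thesis
  proof (rule that[of "\<lambda>x. (1/c) * \<eta> x"])
    show "Ck_on m UNIV (\<lambda>x. (1/c) * \<eta> x)" for m
      using smooth by (intro Ck_on_mult Ck_on_const open_UNIV)
  qed (use int zero nonneg \<open>c \<ge> 0\<close> in auto)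
qed

section \<open>Mollification\<close>

text \<open>
  The integral over a box is differentiated under the integral sign by \<open>leibniz_rule\<close>. The
  derivative is assembled from the continuous partial derivatives as a combination of the coordinate
  functionals \<open>B i\<close>, so that its continuity as a bounded linear map is immediate. The lemma serves three
  purposes: smoothness of mollified functions (\<open>g\<close> the mollifier), convergence of their gradients
  (\<open>a\<close> the mollifier), and vanishing of the integral of a partial derivative (\<open>a = 1\<close>).
\<close>

lemma convolution_differentiable:
  fixes g a :: "real^'n::finite \<Rightarrow> real"
  assumes a: "continuous_on (cbox p q) a"
    and g: "\<And>x. g differentiable (at x)" "\<And>i. continuous_on UNIV (partial i g)"
  defines "h \<equiv> \<lambda>x. integral (cbox p q) (\<lambda>y. a y * g (x - y))"
  shows "h differentiable (at x)"
    and "partial i h x = integral (cbox p q) (\<lambda>y. a y * partial i g (x - y))"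
proof -
  define B where "B = (\<lambda>i. Blinfun (\<lambda>v::real^'n. v $ i))"
  have B: "blinfun_apply (B i) v = v $ i" for i v
    unfolding B_def by (simp add: bounded_linear_Blinfun_apply bounded_linear_vec_nth)
  define G where "G x t = (\<Sum>i\<in>UNIV. (a t * partial i g (x - t)) *\<^sub>R B i)" for x t
  have G: "blinfun_apply (G x t) v = a t * (\<Sum>i\<in>UNIV. partial i g (x - t) * v $ i)" for x t v
    by (simp add: G_def blinfun.sum_left blinfun.scaleR_left B sum_distrib_left mult.assoc)
  have contg: "continuous_on UNIV g"
    using g(1) by (simp add: continuous_at_imp_continuous_on differentiable_imp_continuous_within)
  have comp: "continuous_on S (\<lambda>y. b (u y - v y))"
    if "continuous_on UNIV b" "continuous_on S u" "continuous_on S v"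
    for S :: "'b::topological_space set" and u v :: "'b \<Rightarrow> real^'n" and b :: "real^'n \<Rightarrow> real"
    using that by (auto intro: continuous_on_compose2[of UNIV b] continuous_intros)
  have contG: "continuous_on (UNIV \<times> cbox p q) (\<lambda>(x, t). G x t)"
    unfolding G_def case_prod_unfold
    using g(2) by (intro continuous_intros comp continuous_on_compose2[OF a]) auto
  have d: "(h has_derivative integral (cbox p q) (G x)) (at x)" for x
    unfolding h_def
  proof (rule leibniz_rule[where U=UNIV])
    show "((\<lambda>x. a t * g (x - t)) has_derivative blinfun_apply (G x t)) (at x)" for x t
    proof -
      have "((\<lambda>x. x - t) has_derivative (\<lambda>h. h)) (at x)"
        by (auto intro!: derivative_eq_intros)
      from has_derivative_compose[OF this has_derivative_partials[OF g(1)]]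
      show ?thesis
        by (intro has_derivative_eq_rhs[OF has_derivative_mult_right]) (auto simp: G)
    qed
    show "(\<lambda>y. a y * g (x - y)) integrable_on cbox p q" for x
      using contg by (intro integrable_continuous continuous_intros a comp)
  qed (use contG in auto)
  show "h differentiable (at x)"
    using d unfolding differentiable_def by blast
  have intG: "G x integrable_on cbox p q"
    using g(2) unfolding G_def[abs_def] by (intro integrable_continuous continuous_intros comp a) auto
  have "partial i h x = blinfun_apply (integral (cbox p q) (G x)) (axis i 1)"
    by (rule partial_eqI[OF d])
  also have "\<dots> = integral (cbox p q) (\<lambda>t. blinfun_apply (G x t) (axis i 1))"
    using integral_linear[OF intG blinfun.bounded_linear_left[of "axis i 1"]] by (simp add: o_def)
  also have "\<dots> = integral (cbox p q) (\<lambda>y. a y * partial i g (x - y))"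
    by (simp add: G axis_def if_distrib[of "\<lambda>x. _ * x"] cong: if_cong)
  finally show "partial i h x = integral (cbox p q) (\<lambda>y. a y * partial i g (x - y))" .
qed

lemma Ck_on_convolution:
  fixes g a :: "real^'n::finite \<Rightarrow> real"
  assumes a: "continuous_on (cbox p q) a" and "Ck_on m UNIV g"
  shows "Ck_on m UNIV (\<lambda>x. integral (cbox p q) (\<lambda>y. a y * g (x - y)))"
  using assms(2)
proof (induction m arbitrary: g)
  case 0
  have "continuous_on (UNIV \<times> cbox p q) (\<lambda>(x, y). a y * g (x - y))"
    unfolding case_prod_unfold
    using 0 by (auto intro!: continuous_intros continuous_on_compose2[OF a] continuous_on_compose2[of UNIV g])
  then show ?case
    by (auto intro: integral_continuous_on_param)
next
  case (Suc m)
  then have d: "\<And>x. g differentiable (at x)" and c: "\<And>i. continuous_on UNIV (partial i g)"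
    by (auto intro: Ck_on_Suc_continuous_partial simp del: Ck_on.simps) simp
  note * = convolution_differentiable[OF a d c]
  have "partial i (\<lambda>x. integral (cbox p q) (\<lambda>y. a y * g (x - y))) =
      (\<lambda>x. integral (cbox p q) (\<lambda>y. a y * partial i g (x - y)))" for i
    using *(2) by (rule ext)
  then show ?case using Suc * by simp
qed

lemma uniformly_continuous_compact_support:
  fixes g :: "'a::euclidean_space \<Rightarrow> real"
  assumes "continuous_on UNIV g" "compact K" "\<And>x. x \<notin> K \<Longrightarrow> g x = 0" "e > 0"
  obtains d where "d > 0" "\<And>x y. norm y < d \<Longrightarrow> \<bar>g (x - y) - g x\<bar> < e"
proof -
  define K1 where "K1 = {x + y | x y. x \<in> K \<and> y \<in> cball 0 1}"
  have "compact K1"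
    unfolding K1_def using assms(2) by (intro compact_sums) auto
  have K1: "x + y \<in> K1" if "x \<in> K" "norm y \<le> 1" for x y
    using that by (auto simp: K1_def)
  then have "uniformly_continuous_on K1 g"
    using assms(1) \<open>compact K1\<close>
    by (intro compact_uniformly_continuous) (auto intro: continuous_on_subset)
  then obtain d where d: "d > 0" "\<And>x x'. x \<in> K1 \<Longrightarrow> x' \<in> K1 \<Longrightarrow> dist x' x < d \<Longrightarrow> dist (g x') (g x) < e"
    using \<open>e > 0\<close> unfolding uniformly_continuous_on_def by meson
  show thesis
  proof (rule that[of "min d 1"])
    fix x y :: 'a
    assume y: "norm y < min d 1"
    show "\<bar>g (x - y) - g x\<bar> < e"
    proof (cases "x \<in> K \<or> x - y \<in> K")
      case True
      have "x \<in> K1 \<and> x - y \<in> K1"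
        using True
      proof
        assume "x \<in> K"
        then show ?thesis using K1[of x 0] K1[of x "-y"] y by simp
      next
        assume "x - y \<in> K"
        then show ?thesis using K1[of "x - y" y] K1[of "x - y" 0] y by simp
      qed
      then show ?thesis using d(2)[of x "x - y"] y by (simp add: dist_norm)
    next
      case False
      then show ?thesis using assms(3,4) by simp
    qed
  qed (use \<open>d > 0\<close> in auto)
qed

definition convolve :: "(real^'n::finite \<Rightarrow> real) \<Rightarrow> (real^'n \<Rightarrow> real) \<Rightarrow> real^'n \<Rightarrow> real" where
  "convolve \<eta> g x = integral UNIV (\<lambda>y. \<eta> (x - y) * g y)"

lemma convolve_commute:
  assumes "continuous_on UNIV \<eta>" "continuous_on UNIV g" "compact K" "\<And>x. x \<notin> K \<Longrightarrow> g x = 0"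
  shows "convolve \<eta> g x = convolve g \<eta> x"
proof -
  let ?h = "\<lambda>y. \<eta> (x - y) * g y"
  have "integral UNIV (\<lambda>y. ?h (x - y)) = integral UNIV ?h"
    using assms
    by (intro integral_UNIV_reflect_shift[where K=K])
       (auto intro!: continuous_intros continuous_on_compose2[of UNIV \<eta>])
  then show ?thesis by (simp add: convolve_def mult.commute)
qed

lemma convolve_approximates:
  assumes "continuous_on UNIV \<eta>" "\<And>x. \<eta> x \<ge> 0" "\<And>x. norm x \<ge> d \<Longrightarrow> \<eta> x = 0"
    "(\<eta> has_integral 1) UNIV"
    and g: "continuous_on UNIV g" "compact K" "\<And>x. x \<notin> K \<Longrightarrow> g x = 0"
    and d: "\<And>x y. norm y < d \<Longrightarrow> \<bar>g (x - y) - g x\<bar> \<le> e"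
  shows "\<bar>convolve \<eta> g x - g x\<bar> \<le> e"
proof -
  have supp: "\<eta> x = 0" if "x \<notin> cball 0 d" for x
    using that assms(3)[of x] by auto
  have int1: "(\<lambda>y. \<eta> y * g (x - y)) integrable_on UNIV"
    using supp assms(1) g(1) 
    by (intro compact_support_integrable[where K="cball 0 d"])
      (auto intro!: continuous_intros continuous_on_compose2[of UNIV g])
  have int2: "((\<lambda>y. \<eta> y * c) has_integral c) UNIV" for c
    using has_integral_mult_left[OF assms(4), of c] by simp
  have "convolve \<eta> g x = integral UNIV (\<lambda>y. \<eta> y * g (x - y))"
    using convolve_commute[OF assms(1) g] by (simp add: convolve_def mult.commute)
  then have "convolve \<eta> g x - g x = integral UNIV (\<lambda>y. \<eta> y * g (x - y) - \<eta> y * g x)"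
    using integral_diff[OF int1 has_integral_integrable[OF int2[of "g x"]]]
    by (simp add: integral_unique[OF assms(4)])
  also have "\<bar>\<dots>\<bar> \<le> integral UNIV (\<lambda>y. \<eta> y * e)"
  proof (rule integral_norm_bound_integral[where 'a=real, simplified])
    show "\<bar>\<eta> y * g (x - y) - \<eta> y * g x\<bar> \<le> \<eta> y * e" for y
    proof (cases "norm y < d")
      case True
      then show ?thesis
        using mult_left_mono[OF d[of y x] assms(2)[of y]] assms(2)[of y]
        by (simp add: right_diff_distrib[symmetric] abs_mult)
    next
      case False
      then show ?thesis using assms(3) by simp
    qed
  qed (use int1 int2[of "g x"] int2[of e] in \<open>auto intro!: integrable_diff simp: has_integral_integrable\<close>)
  also have "\<dots> = e"
    using int2[of e] by (rule integral_unique)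
  finally show ?thesis .
qed

lemma convolve_test_function:
  assumes \<eta>: "\<And>m. Ck_on m UNIV \<eta>" "\<And>x. norm x \<ge> d \<Longrightarrow> \<eta> x = 0"
    and g: "continuous_on UNIV g" "compact K" "\<And>x. x \<notin> K \<Longrightarrow> g x = 0"
    and A: "(\<Union>x\<in>K. cball x d) \<subseteq> A"
  shows "convolve \<eta> g \<in> test_functions A"
proof -
  obtain a where a: "K \<subseteq> cbox (-a) a"
    by (rule compact_subset_cbox[OF g(2)])
  have "convolve \<eta> g = (\<lambda>x. integral (cbox (-a) a) (\<lambda>y. g y * \<eta> (x - y)))"
  proof
    fix x
    show "convolve \<eta> g x = integral (cbox (-a) a) (\<lambda>y. g y * \<eta> (x - y))"
      unfolding convolve_def using a g(3)
      by (subst integral_UNIV_eq_cbox[of "-a" a]) (auto simp: mult.commute)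
  qed
  then have "Ck_on m UNIV (convolve \<eta> g)" for m
    using Ck_on_convolution[OF continuous_on_subset[OF g(1)] \<eta>(1)] by simp
  moreover
  let ?K = "(\<Union>x\<in>K. cball x d)"
  have K: "?K = {x + y | x y. x \<in> K \<and> y \<in> cball 0 d}"
  proof -
    have "z \<in> ?K" if xy: "x \<in> K" "z = x + y" "norm y \<le> d" for x y z
    proof (rule UN_I[OF xy(1)])
      show "z \<in> cball x d" using xy(2,3) by (simp add: dist_norm)
    qed
    moreover have "\<exists>x y. z = x + y \<and> x \<in> K \<and> y \<in> cball 0 d" if z: "z \<in> ?K" for z
    proof -
      obtain x where "x \<in> K" "dist x z \<le> d" using z by auto
      then show ?thesis
        by (intro exI[of _ x] exI[of _ "z - x"]) (simp add: dist_norm norm_minus_commute)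
    qed
    ultimately show ?thesis by (intro set_eqI iffI) (blast, fastforce)
  qed
  have "compact ?K"
    unfolding K using g(2) by (intro compact_sums) auto
  have "{x. convolve \<eta> g x \<noteq> 0} \<subseteq> ?K"
  proof
    fix x assume "x \<in> {x. convolve \<eta> g x \<noteq> 0}"
    then have "(\<lambda>y. \<eta> (x - y) * g y) \<noteq> (\<lambda>y. 0)"
      unfolding convolve_def by auto
    then obtain y where "\<eta> (x - y) * g y \<noteq> 0"
      by (auto simp: fun_eq_iff)
    then have "y \<in> K" "norm (x - y) < d"
      using g(3) \<eta>(2) by (auto simp: not_le[symmetric])
    then show "x \<in> ?K"
      by (intro UN_I[of y]) (simp_all add: dist_norm norm_minus_commute)
  qed
  then have cl: "closure {x. convolve \<eta> g x \<noteq> 0} \<subseteq> ?K"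
    using \<open>compact ?K\<close> by (intro closure_minimal compact_imp_closed)
  moreover have "compact (closure {x. convolve \<eta> g x \<noteq> 0})"
    using cl compact_imp_bounded[OF \<open>compact ?K\<close>] unfolding compact_eq_bounded_closed
    by (auto intro: bounded_subset)
  ultimately show ?thesis
    using order_trans[OF cl A] unfolding test_functions_def by blast
qed

text \<open>
  One mollifier serves a finite family of functions. Applied to a function together with its
  partial derivatives, this gives approximation in \<open>C\<^sup>1\<close>.
\<close>

lemma mollifier_exists:
  fixes S :: "(real^'n::finite \<Rightarrow> real) set"
  assumes "finite S" "compact K" "open A" "K \<subseteq> A" "e > 0"
    and S: "\<And>g. g \<in> S \<Longrightarrow> continuous_on UNIV g" "\<And>g x. g \<in> S \<Longrightarrow> x \<notin> K \<Longrightarrow> g x = 0"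
  obtains \<eta> d where "continuous_on UNIV \<eta>" "\<And>x. norm x \<ge> d \<Longrightarrow> \<eta> x = 0"
    "\<And>g. g \<in> S \<Longrightarrow> convolve \<eta> g \<in> test_functions A"
    "\<And>g x. g \<in> S \<Longrightarrow> \<bar>convolve \<eta> g x - g x\<bar> \<le> e"
proof -
  obtain d0 where d0: "d0 > 0" "(\<Union>x\<in>K. cball x d0) \<subseteq> A"
    using compact_subset_open_imp_cball_epsilon_subset[OF assms(2,3,4)] .
  have "\<exists>d>0. \<forall>x y. norm y < d \<longrightarrow> \<bar>g (x - y) - g x\<bar> < e" if "g \<in> S" for g
    using uniformly_continuous_compact_support[OF S(1)[OF that] assms(2) S(2)[OF that] \<open>e > 0\<close>] by metis
  then obtain D where D: "\<And>g. g \<in> S \<Longrightarrow> D g > 0"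
      "\<And>g x y. g \<in> S \<Longrightarrow> norm y < D g \<Longrightarrow> \<bar>g (x - y) - g x\<bar> < e"
    by metis
  \<comment> \<open>Small enough to keep the supports in \<open>A\<close> and for uniform continuity of all members of \<open>S\<close>.\<close>
  define d where "d = Min (insert d0 (D ` S))"
  have d: "d > 0" "d \<le> d0" "\<And>g. g \<in> S \<Longrightarrow> d \<le> D g"
    unfolding d_def using D(1) d0(1) \<open>finite S\<close> by auto
  obtain \<eta> :: "real^'n \<Rightarrow> real" where \<eta>: "\<And>m. Ck_on m UNIV \<eta>" "\<And>x. \<eta> x \<ge> 0"
      "\<And>x. norm x \<ge> d \<Longrightarrow> \<eta> x = 0" "(\<eta> has_integral 1) UNIV"
    by (rule smooth_bump_exists[OF d(1)]) (rule that)
  have c: "continuous_on UNIV \<eta>"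
    using \<eta>(1)[of 0] by simp
  show thesis
  proof (rule that[OF c \<eta>(3)])
    fix g assume g: "g \<in> S"
    have "(\<Union>x\<in>K. cball x d) \<subseteq> A"
      using d0(2) d(2) by fastforce
    then show "convolve \<eta> g \<in> test_functions A"
      using convolve_test_function[OF \<eta>(1,3) S(1)[OF g] assms(2) S(2)[OF g]] by blast
    show "\<bar>convolve \<eta> g x - g x\<bar> \<le> e" for x
      using convolve_approximates[OF c \<eta>(2,3,4) S(1)[OF g] assms(2) S(2)[OF g]]
        D(2)[OF g] d(3)[OF g] by (meson less_eq_real_def order_less_le_trans)
  qed
qed

lemma test_function_C0_approximation:
  fixes g :: "real^'n::finite \<Rightarrow> real"
  assumes "compact K" "open A" "K \<subseteq> A" "e > 0" "continuous_on UNIV g" "\<And>x. x \<notin> K \<Longrightarrow> g x = 0"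
  obtains \<phi> where "\<phi> \<in> test_functions A" "\<And>x. \<bar>\<phi> x - g x\<bar> \<le> e"
  using mollifier_exists[of "{g}" K A e] assms by (metis finite.intros(1) finite_insert singletonD singletonI)

text \<open>
  Partial derivatives commute with convolution, so mollifying \<open>g\<close> also mollifies its gradient.
\<close>

lemma test_function_C1_approximation:
  fixes g :: "real^'n::finite \<Rightarrow> real"
  assumes "compact K" "open A" "K \<subseteq> A" "e > 0" "Ck_on 1 UNIV g" "\<And>x. x \<notin> K \<Longrightarrow> g x = 0"
  obtains \<phi> where "\<phi> \<in> test_functions A" "\<And>x. \<bar>\<phi> x - g x\<bar> \<le> e"
    "\<And>i x. \<bar>partial i \<phi> x - partial i g x\<bar> \<le> e"
proof -
  have g: "continuous_on UNIV g" "\<And>i. continuous_on UNIV (partial i g)" "\<And>x. g differentiable (at x)"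
    using assms(5) Ck_on_continuous[OF assms(5)] by auto
  have p0: "partial i g x = 0" if "x \<notin> K" for i x
  proof -
    have "partial i g x = partial i (\<lambda>x. 0) x"
      using that assms(1,6) by (intro partial_cong_open[of "- K"]) (auto simp: compact_imp_closed open_Compl)
    then show ?thesis by (simp add: partial_const)
  qed
  let ?S = "insert g (range (\<lambda>i. partial i g))"
  obtain \<eta> d where \<eta>: "continuous_on UNIV \<eta>" "\<And>x. norm x \<ge> d \<Longrightarrow> \<eta> x = 0"
    "\<And>g. g \<in> ?S \<Longrightarrow> convolve \<eta> g \<in> test_functions A"
    "\<And>g x. g \<in> ?S \<Longrightarrow> \<bar>convolve \<eta> g x - g x\<bar> \<le> e"
  proof (rule mollifier_exists[of ?S K A e])
    show "continuous_on UNIV u" if "u \<in> ?S" for u using that g by auto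
    show "u x = 0" if "u \<in> ?S" "x \<notin> K" for u x using that assms(6) p0 by auto
  qed (use assms in auto)
  obtain a where a: "cball (0::real^'n) d \<subseteq> cbox (-a) a"
    by (rule compact_subset_cbox[OF compact_cball])
  have out: "\<eta> y = 0" if "y \<notin> cbox (-a) a" for y
    using \<eta>(2)[of y] that a by (meson linear mem_cball_0 subsetD)
  have conv: "convolve \<eta> u = (\<lambda>x. integral (cbox (-a) a) (\<lambda>y. \<eta> y * u (x - y)))"
    if "continuous_on UNIV u" "\<And>x. x \<notin> K \<Longrightarrow> u x = 0" for u
  proof
    fix x
    have "convolve \<eta> u x = integral UNIV (\<lambda>y. \<eta> y * u (x - y))"
      using convolve_commute[OF \<eta>(1) that(1) assms(1) that(2)] by (simp add: convolve_def mult.commute)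
    also have "\<dots> = integral (cbox (-a) a) (\<lambda>y. \<eta> y * u (x - y))"
      using out by (intro integral_UNIV_eq_cbox) auto
    finally show "convolve \<eta> u x = integral (cbox (-a) a) (\<lambda>y. \<eta> y * u (x - y))" .
  qed
  have "partial i (convolve \<eta> g) x = convolve \<eta> (partial i g) x" for i x
    using convolution_differentiable(2)[OF continuous_on_subset[OF \<eta>(1)] g(3) g(2)]
    by (simp add: conv g assms(6) p0)
  then show thesis
    using \<eta>(3,4) by (intro that[of "convolve \<eta> g"]) auto
qed

section \<open>Integration by parts for compactly supported functions\<close>

text \<open>
  The two open sets \<open>A\<close> and \<open>- K\<close> cover the space, and the extension is of class \<open>C\<^sup>1\<close> on each.
\<close>

lemma zero_ext_C1:
  fixes P :: "real^'n::finite \<Rightarrow> real"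
  assumes A: "open A" and K: "compact K" "K \<subseteq> A" and P: "Ck_on 1 A P"
    and 0: "\<And>x. x \<in> A \<Longrightarrow> x \<notin> K \<Longrightarrow> P x = 0"
  shows "Ck_on 1 UNIV (zero_ext A P)" "partial i (zero_ext A P) = zero_ext A (partial i P)"
proof -
  let ?Q = "zero_ext A P"
  have "closed K" using K(1) by (rule compact_imp_closed)
  have cover: "x \<in> A \<or> x \<in> - K" for x using K(2) by blast
  have Q0: "?Q x = 0" if "x \<notin> K" for x
    using 0 that by (auto simp: zero_ext_def)
  have diff: "?Q differentiable (at x)" for x
  proof (cases "x \<in> A")
    case True
    then show ?thesis
      using P A by - (rule differentiable_cong_open[where f=P and A=A]; simp add: zero_ext_def)
  next
    case False
    then show ?thesis
      using cover[of x] Q0 \<open>closed K\<close>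
      by - (rule differentiable_cong_open[where f="\<lambda>x. 0" and A="- K"]; auto)
  qed
  have partial: "partial i ?Q = zero_ext A (partial i P)" for i
  proof
    fix x
    show "partial i ?Q x = zero_ext A (partial i P) x"
    proof (cases "x \<in> A")
      case True
      then show ?thesis
        using A partial_cong_open[of A x ?Q P i] by (auto simp: zero_ext_def)
    next
      case False
      then have "partial i ?Q x = 0"
        using cover[of x] by (intro partial_eq_0_outside[OF \<open>closed K\<close> Q0]) auto
      then show ?thesis
        using False by (simp add: zero_ext_def)
    qed
  qed
  then show "partial i ?Q = zero_ext A (partial i P)" .
  have "continuous_on UNIV (partial i ?Q)" for i
  proof -
    have "continuous_on A (partial i ?Q)"
      using P by (subst continuous_on_cong[OF refl, of A _ "partial i P"]) (auto simp: partial zero_ext_def)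
    moreover have "continuous_on (- K) (partial i ?Q)"
      by (subst continuous_on_cong[OF refl, of "- K" _ "\<lambda>x. 0"])
        (auto intro: partial_eq_0_outside[OF \<open>closed K\<close>] Q0)
    ultimately have "continuous_on (A \<union> - K) (partial i ?Q)"
      using A \<open>closed K\<close> by (intro continuous_on_open_Un) auto
    moreover have "A \<union> - K = UNIV" using cover by blast
    ultimately show ?thesis by simp
  qed
  then show "Ck_on 1 UNIV ?Q"
    unfolding Ck_on_1_iff using diff by blast
qed

lemma compact_support_lebesgue_integral:
  fixes h :: "real^'n::finite \<Rightarrow> real"
  assumes "continuous_on UNIV h" "compact K" "\<And>x. x \<notin> K \<Longrightarrow> h x = 0"
  shows "integrable lebesgue h" "integral\<^sup>L lebesgue h = integral UNIV h"
proof -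
  have "integrable lborel (\<lambda>x. indicator K x *\<^sub>R h x)"
    using assms by (intro borel_integrable_compact) (auto intro: continuous_on_subset)
  moreover have "(\<lambda>x. indicator K x *\<^sub>R h x) = h"
    using assms(3) by (auto simp: fun_eq_iff split: split_indicator)
  ultimately have *: "integrable lborel h" by simp
  then show "integrable lebesgue h"
    using integrable_completion[of h lborel] borel_measurable_integrable by blast
  show "integral\<^sup>L lebesgue h = integral UNIV h"
    using * integral_completion[of h lborel] integral_lborel[OF *] borel_measurable_integrable by metis
qed

text \<open>
  The integral of a translate of \<open>P\<close> does not depend on the translation; differentiating at the
  identity gives the claim. The translates are integrated over one box
  large enough for all translations of length less than \<open>1\<close>, as \<open>convolution_differentiable\<close> requires.
\<close>

lemma integral_partial_compact_support:
  fixes P :: "real^'n::finite \<Rightarrow> real"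
  assumes P: "Ck_on 1 UNIV P" and K: "compact K" "\<And>x. x \<notin> K \<Longrightarrow> P x = 0"
  shows "integral UNIV (partial i P) = 0"
proof -
  have d: "P differentiable (at x)" and c: "continuous_on UNIV (partial i P)" for x i
    using P by auto
  have cP: "continuous_on UNIV P"
    using P by (rule Ck_on_continuous)
  obtain R where R: "\<And>x. x \<in> K \<Longrightarrow> norm x \<le> R"
    using compact_imp_bounded[OF K(1)] by (auto simp: bounded_iff)
  obtain a :: "real^'n" where a: "cball 0 (R + 1) \<subseteq> cbox (-a) a"
    by (rule compact_subset_cbox[OF compact_cball])
  have out: "x - y \<notin> K" if "y \<notin> cbox (-a) a" "norm x < 1" for x y
  proof
    assume "x - y \<in> K"
    then have "norm (x - y) \<le> R" using R by auto
    then have "norm y \<le> R + 1"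
      using norm_triangle_ineq2[of y x] that(2) by (simp add: norm_minus_commute)
    then show False using that(1) a by auto
  qed
  define H where "H x = integral (cbox (-a) a) (\<lambda>y. 1 * P (x - y))" for x
  have H: "H x = integral UNIV P" if "norm x < 1" for x
  proof -
    have "H x = integral UNIV (\<lambda>y. P (x - y))"
      unfolding H_def using K(2) out that by (subst integral_UNIV_eq_cbox[of "-a" a]) auto
    also have "\<dots> = integral UNIV P"
      using cP K by (rule integral_UNIV_reflect_shift)
    finally show ?thesis .
  qed
  have "partial i H 0 = partial i (\<lambda>x. integral UNIV P) 0"
    using H by (intro partial_cong_open[of "ball 0 1"]) auto
  then have "0 = partial i H 0" by (simp add: partial_const)
  also have "\<dots> = integral (cbox (-a) a) (\<lambda>y. 1 * partial i P (0 - y))"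
    unfolding H_def[abs_def] using d c by (intro convolution_differentiable) auto
  also have "\<dots> = integral UNIV (\<lambda>y. partial i P (0 - y))"
    using partial_eq_0_outside[OF compact_imp_closed[OF K(1)] K(2)] out[of _ 0]
    by (subst integral_UNIV_eq_cbox[of "-a" a]) auto
  also have "\<dots> = integral UNIV (partial i P)"
    using c K(1) partial_eq_0_outside[OF compact_imp_closed[OF K(1)] K(2)]
    by (rule integral_UNIV_reflect_shift)
  finally show ?thesis by simp
qed

lemma set_integral_partial_compact_support:
  fixes P :: "real^'n::finite \<Rightarrow> real"
  assumes "open A" "compact K" "K \<subseteq> A" "Ck_on 1 A P" "\<And>x. x \<in> A \<Longrightarrow> x \<notin> K \<Longrightarrow> P x = 0"
  shows "set_integrable lebesgue A (partial i P)" "(LINT x:A|lebesgue. partial i P x) = 0"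
proof -
  let ?Q = "zero_ext A P"
  have Q: "Ck_on 1 UNIV ?Q" "partial i ?Q = zero_ext A (partial i P)"
    using zero_ext_C1[OF assms] by auto
  have Q0: "?Q x = 0" if "x \<notin> K" for x
    using assms that by (auto simp: zero_ext_def)
  have eq: "(\<lambda>x. indicator A x *\<^sub>R partial i P x) = partial i ?Q"
    unfolding Q by (auto simp: zero_ext_def fun_eq_iff split: split_indicator)
  have c: "continuous_on UNIV (partial i ?Q)" using Q(1) by simp
  note * = compact_support_lebesgue_integral[OF c assms(2)
      partial_eq_0_outside[OF compact_imp_closed[OF assms(2)] Q0]]
  show "set_integrable lebesgue A (partial i P)"
    unfolding set_integrable_def eq by (rule *(1))
  show "(LINT x:A|lebesgue. partial i P x) = 0"
    unfolding set_lebesgue_integral_def eq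
    using *(2) integral_partial_compact_support[OF Q(1) assms(2) Q0] by simp
qed

lemma test_functionE:
  assumes "\<phi> \<in> test_functions A"
  obtains K where "compact K" "K \<subseteq> A" "\<And>x. x \<notin> K \<Longrightarrow> \<phi> x = 0"
    "\<And>i x. x \<notin> K \<Longrightarrow> partial i \<phi> x = 0"
    "Ck_on 1 UNIV \<phi>" "continuous_on UNIV \<phi>" "\<And>i. continuous_on UNIV (partial i \<phi>)"
    "\<And>x. \<phi> differentiable (at x)"
proof (rule that)
  let ?K = "closure {x. \<phi> x \<noteq> 0}"
  show "compact ?K" "?K \<subseteq> A" and C1: "Ck_on 1 UNIV \<phi>"
    using assms by (auto simp: test_functions_def simp del: Ck_on.simps)
  show 0: "\<phi> x = 0" if "x \<notin> ?K" for x
    using that closure_subset[of "{x. \<phi> x \<noteq> 0}"] by auto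
  show "partial i \<phi> x = 0" if "x \<notin> ?K" for i x
    by (rule partial_eq_0_outside[OF closed_closure _ that]) (rule 0)
  show "continuous_on UNIV \<phi>" using C1 by (rule Ck_on_continuous)
  show "continuous_on UNIV (partial i \<phi>)" "\<phi> differentiable (at x)" for i x
    using C1 by auto
qed

lemma test_functions_mono: "A \<subseteq> B \<Longrightarrow> test_functions A \<subseteq> test_functions B"
  by (auto simp: test_functions_def)

lemma set_integrable_compact_support:
  fixes h :: "real^'n::finite \<Rightarrow> 'b::euclidean_space"
  assumes "continuous_on A h" "compact K" "K \<subseteq> A" "\<And>x. x \<in> A \<Longrightarrow> x \<notin> K \<Longrightarrow> h x = 0"
  shows "set_integrable lebesgue A h"
proof -
  have "integrable lborel (\<lambda>x. indicator K x *\<^sub>R h x)"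
    using assms by (intro borel_integrable_compact) (auto intro: continuous_on_subset)
  moreover have "(\<lambda>x. indicator K x *\<^sub>R h x) = (\<lambda>x. indicator A x *\<^sub>R h x)"
    using assms(3,4) by (auto simp: fun_eq_iff split: split_indicator)
  ultimately have *: "integrable lborel (\<lambda>x. indicator A x *\<^sub>R h x)" by simp
  then show ?thesis
    unfolding set_integrable_def
    by (subst integrable_completion) (auto dest: borel_measurable_integrable)
qed

lemma locally_integrable_continuous:
  fixes g :: "real^'n::finite \<Rightarrow> 'b::euclidean_space"
  assumes "continuous_on A g"
  shows "locally_integrable_on g A"
  unfolding locally_integrable_on_def
proof (intro allI impI, elim conjE)
  fix K assume K: "compact K" "K \<subseteq> A"
  show "set_integrable lebesgue K g"
    by (rule set_integrable_compact_support[of K g K]) (use K assms in \<open>auto intro: continuous_on_subset\<close>)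
qed

lemma locally_integrable_mult_compact_support:
  fixes u \<psi> :: "real^'n::finite \<Rightarrow> real"
  assumes u: "locally_integrable_on u A"
    and \<psi>: "continuous_on UNIV \<psi>" "compact K" "K \<subseteq> A" "\<And>x. x \<notin> K \<Longrightarrow> \<psi> x = 0"
  shows "set_integrable lebesgue A (\<lambda>x. u x * \<psi> x)"
proof -
  have uK: "integrable lebesgue (\<lambda>x. indicator K x *\<^sub>R u x)"
    using u \<psi> by (auto simp: locally_integrable_on_def set_integrable_def)
  have m\<psi>: "\<psi> \<in> borel_measurable lebesgue"
    by (intro measurable_completion) (simp add: borel_measurable_continuous_onI[OF \<psi>(1)])
  have "bounded (\<psi> ` K)"
    using \<psi>(1,2) by (intro compact_imp_bounded compact_continuous_image) (auto intro: continuous_on_subset)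
  then obtain B where B: "\<And>x. x \<in> K \<Longrightarrow> \<bar>\<psi> x\<bar> \<le> B"
    by (auto simp: bounded_iff)
  have "integrable lebesgue (\<lambda>x. (indicator K x *\<^sub>R u x) * \<psi> x)"
  proof (rule Bochner_Integration.integrable_bound)
    show "integrable lebesgue (\<lambda>x. B * norm (indicator K x *\<^sub>R u x))"
      using uK by (intro integrable_mult_right integrable_norm)
    show "(\<lambda>x. (indicator K x *\<^sub>R u x) * \<psi> x) \<in> borel_measurable lebesgue"
      using m\<psi> borel_measurable_integrable[OF uK] by (rule borel_measurable_times[rotated])
    have "norm (indicator K x *\<^sub>R u x * \<psi> x) \<le> norm (B * norm (indicator K x *\<^sub>R u x))" for x
    proof (cases "x \<in> K")
      case True
      then have "\<bar>u x\<bar> * \<bar>\<psi> x\<bar> \<le> \<bar>u x\<bar> * \<bar>B\<bar>"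
        using B[of x] by (intro mult_left_mono) auto
      then show ?thesis using True by (simp add: abs_mult mult.commute)
    qed simp
    then show "AE x in lebesgue. norm (indicator K x *\<^sub>R u x * \<psi> x) \<le> norm (B * norm (indicator K x *\<^sub>R u x))"
      by simp
  qed
  moreover have "(\<lambda>x. (indicator K x *\<^sub>R u x) * \<psi> x) = (\<lambda>x. indicator A x *\<^sub>R (u x * \<psi> x))"
    using \<psi>(3,4) by (auto simp: fun_eq_iff split: split_indicator)
  ultimately show ?thesis by (simp add: set_integrable_def)
qed

section \<open>Uniqueness of the weak gradient\<close>

text \<open>
  The indicator of \<open>K\<close> is a limit of continuous cut-off functions \<open>g m\<close>, which are
  within \<open>1 / (m + 1)\<close> of test functions \<open>\<phi> m\<close>. All \<open>\<phi> m\<close> are bounded by \<open>2\<close> and supported in the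
  compact neighbourhood of radius \<open>e\<close> of \<open>K\<close>, where \<open>h\<close> is integrable; dominated convergence applies.
\<close>

lemma integral_compact_eq_0:
  fixes h :: "real^'n::finite \<Rightarrow> real"
  assumes A: "open A" and h: "locally_integrable_on h A"
    and test: "\<And>\<phi>. \<phi> \<in> test_functions A \<Longrightarrow> (LINT x:A|lebesgue. h x * \<phi> x) = 0"
    and K: "compact K" "K \<subseteq> A"
  shows "(LINT x:K|lebesgue. h x) = 0"
proof (cases "K = {}")
  case False
  obtain e where e: "e > 0" "{x. infdist x K \<le> e} \<subseteq> A"
    using compact_in_open_separated[OF False K(1) A K(2)] .
  let ?K2 = "{x. infdist x K \<le> e / 2}"
  let ?K' = "{x. infdist x K \<le> e}"
  let ?V = "{x. infdist x K < e}"
  have K': "compact ?K'" "compact ?K2"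
    using e(1) by (auto intro: compact_infdist_le[OF False K(1)] simp del: le_divide_eq_numeral1)
  have "open ?V"
    by (intro open_Collect_less continuous_intros)
  have "?K2 \<subseteq> ?V" using e(1) by auto
  define g where "g m x = max 0 (1 - real (m + 1) * (infdist x K * (2 / e)))" for m x
  have g0: "g m x = 0" if "x \<notin> ?K2" for m x
  proof -
    have "1 \<le> infdist x K * (2 / e)" using that e(1) by (simp add: field_simps)
    also have "\<dots> \<le> real (m + 1) * (infdist x K * (2 / e))"
      using e(1) mult_right_mono[of 1 "real (m+1)" "infdist x K * (2 / e)"] by (simp add: infdist_nonneg)
    finally show ?thesis by (simp add: g_def)
  qed
  have "\<exists>\<phi>. \<phi> \<in> test_functions ?V \<and> (\<forall>x. \<bar>\<phi> x - g m x\<bar> \<le> 1 / real (m + 1))" for m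
  proof -
    have cont: "continuous_on UNIV (g m)"
      unfolding g_def[abs_def] by (intro continuous_intros)
    have e': "1 / real (m + 1) > 0" by simp
    obtain \<phi> where "\<phi> \<in> test_functions ?V" "\<And>x. \<bar>\<phi> x - g m x\<bar> \<le> 1 / real (m + 1)"
      by (rule test_function_C0_approximation[OF K'(2) \<open>open ?V\<close> \<open>?K2 \<subseteq> ?V\<close> e' cont g0[of _ m]])
        (auto intro: that)
    then show ?thesis by auto
  qed
  then obtain \<phi> where \<phi>: "\<And>m. \<phi> m \<in> test_functions ?V"
    and \<phi>g: "\<And>m x. \<bar>\<phi> m x - g m x\<bar> \<le> 1 / real (m + 1)"
    by metis
  have "?V \<subseteq> A" using e(2) by auto
  have \<phi>A: "\<phi> m \<in> test_functions A" for m
    using \<phi> test_functions_mono[OF \<open>?V \<subseteq> A\<close>] by blast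
  have \<phi>0: "\<phi> m x = 0" if "x \<notin> ?V" for m x
    using test_functionE[OF \<phi>[of m]] that by (metis subsetD)
  have \<phi>2: "\<bar>\<phi> m x\<bar> \<le> 2" for m x
  proof -
    have "0 \<le> g m x" "g m x \<le> 1"
      using e(1) by (auto simp: g_def infdist_nonneg)
    moreover have "1 / real (m + 1) \<le> 1" by simp
    ultimately show ?thesis using \<phi>g[of m x] by linarith
  qed
  have lim_inv: "(\<lambda>m. 1 / real (m + 1)) \<longlonglongrightarrow> 0"
    using LIMSEQ_inverse_real_of_nat by (simp add: inverse_eq_divide)
  have g_lim: "(\<lambda>m. g m x) \<longlonglongrightarrow> indicator K x" for x
  proof (cases "x \<in> K")
    case True
    then show ?thesis by (simp add: g_def)
  next
    case False
    let ?c = "infdist x K * (2 / e)"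
    have "infdist x K > 0"
      using False \<open>K \<noteq> {}\<close> K(1) compact_imp_closed infdist_pos_not_in_closed by blast
    then have "?c > 0" using e(1) by simp
    then obtain M :: nat where M: "1 < real M * ?c"
      using reals_Archimedean3 by blast
    have "g m x = 0" if "m \<ge> M" for m
    proof -
      have "real M * ?c \<le> real (m + 1) * ?c"
        using that \<open>?c > 0\<close> by (intro mult_right_mono) auto
      then show ?thesis using M unfolding g_def by linarith
    qed
    then have "eventually (\<lambda>m. g m x = 0) sequentially"
      by (auto simp: eventually_sequentially)
    then show ?thesis using False by (simp add: tendsto_eventually)
  qed
  have \<phi>_lim: "(\<lambda>m. \<phi> m x) \<longlonglongrightarrow> indicator K x" for x
  proof -
    have "(\<lambda>m. \<phi> m x - g m x) \<longlonglongrightarrow> 0"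
      using \<phi>g by (intro Lim_null_comparison[OF _ lim_inv]) auto
    from tendsto_add[OF this g_lim[of x]] show ?thesis by simp
  qed
  have hK': "integrable lebesgue (\<lambda>x. indicator ?K' x *\<^sub>R h x)"
    using h K'(1) e(2) by (auto simp: locally_integrable_on_def set_integrable_def)
  have lim: "(\<lambda>m. LINT x|lebesgue. indicator A x *\<^sub>R (h x * \<phi> m x)) \<longlonglongrightarrow>
      (LINT x|lebesgue. indicator K x *\<^sub>R h x)"
  proof (rule integral_dominated_convergence)
    show "integrable lebesgue (\<lambda>x. 2 * norm (indicator ?K' x *\<^sub>R h x))"
      using hK' by (intro integrable_mult_right integrable_norm)
    have "set_integrable lebesgue K h"
      using h K by (auto simp: locally_integrable_on_def)
    then show "(\<lambda>x. indicator K x *\<^sub>R h x) \<in> borel_measurable lebesgue"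
      by (simp add: set_integrable_def borel_measurable_integrable del: real_scaleR_def)
    show "(\<lambda>x. indicator A x *\<^sub>R (h x * \<phi> m x)) \<in> borel_measurable lebesgue" for m
    proof -
      obtain L where "compact L" "L \<subseteq> A" "\<And>x. x \<notin> L \<Longrightarrow> \<phi> m x = 0" "continuous_on UNIV (\<phi> m)"
        using test_functionE[OF \<phi>A] by metis
      then have "set_integrable lebesgue A (\<lambda>x. h x * \<phi> m x)"
        using locally_integrable_mult_compact_support[OF h] by blast
      then show ?thesis
        by (simp add: set_integrable_def borel_measurable_integrable del: real_scaleR_def)
    qed
    have "(\<lambda>m. indicator A x *\<^sub>R (h x * \<phi> m x)) \<longlonglongrightarrow> indicator K x *\<^sub>R h x" for x
    proof -
      have "indicator A x *\<^sub>R (h x * indicator K x) = indicator K x *\<^sub>R h x"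
        using K(2) by (auto split: split_indicator)
      moreover have "(\<lambda>m. indicator A x *\<^sub>R (h x * \<phi> m x)) \<longlonglongrightarrow> indicator A x *\<^sub>R (h x * indicator K x)"
        by (intro tendsto_intros \<phi>_lim)
      ultimately show ?thesis by (simp only:)
    qed
    then show "AE x in lebesgue. (\<lambda>m. indicator A x *\<^sub>R (h x * \<phi> m x)) \<longlonglongrightarrow> indicator K x *\<^sub>R h x"
      by (rule AE_I2)
    have "norm (indicator A x *\<^sub>R (h x * \<phi> m x)) \<le> 2 * norm (indicator ?K' x *\<^sub>R h x)" for m x
    proof (cases "x \<in> ?V")
      case True
      have "\<bar>h x\<bar> * \<bar>\<phi> m x\<bar> \<le> \<bar>h x\<bar> * 2"
        using \<phi>2 by (intro mult_left_mono) auto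
      then show ?thesis using True by (auto simp: abs_mult split: split_indicator)
    next
      case False
      then show ?thesis using \<phi>0 by simp
    qed
    then show "AE x in lebesgue. norm (indicator A x *\<^sub>R (h x * \<phi> m x)) \<le> 2 * norm (indicator ?K' x *\<^sub>R h x)" for m
      by (intro AE_I2)
  qed
  moreover have "(LINT x|lebesgue. indicator A x *\<^sub>R (h x * \<phi> m x)) = 0" for m
    using test[OF \<phi>A, of m] unfolding set_lebesgue_integral_def .
  ultimately have "(LINT x|lebesgue. indicator K x *\<^sub>R h x) = 0"
    by (simp only: LIMSEQ_const_iff)
  then show ?thesis unfolding set_lebesgue_integral_def .
qed (simp add: set_lebesgue_integral_def)

text \<open>
  Up to a null set, the set where \<open>h\<close> is positive is a countable union of compact sets. The
  integral over each of them vanishes although the integrand is positive there, so each is a null set.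
\<close>

lemma AE_nonpos_on_compact:
  fixes h :: "real^'n::finite \<Rightarrow> real"
  assumes h: "set_integrable lebesgue K0 h"
    and 0: "\<And>K. compact K \<Longrightarrow> K \<subseteq> K0 \<Longrightarrow> set_integrable lebesgue K h \<and> (LINT x:K|lebesgue. h x) = 0"
  shows "AE x in lebesgue. x \<in> K0 \<longrightarrow> h x \<le> 0"
proof -
  let ?P = "{x. indicator K0 x *\<^sub>R h x > 0}"
  have "(\<lambda>x. indicator K0 x *\<^sub>R h x) \<in> borel_measurable lebesgue"
    using h unfolding set_integrable_def by (rule borel_measurable_integrable)
  then have "?P \<in> sets lebesgue"
    using borel_measurable_less[of "\<lambda>x. 0" lebesgue] by simp
  then obtain C N where CN: "fsigma C" "N \<in> null_sets lebesgue" "C \<union> N = ?P"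
    by (rule lebesgue_set_almost_fsigma) (rule that)
  obtain F :: "nat \<Rightarrow> (real^'n) set" where F: "range F \<subseteq> Collect compact" "C = \<Union> (F ` UNIV)"
    using CN(1) unfolding fsigma_Union_compact by blast
  have FP: "x \<in> K0 \<and> h x > 0" if "x \<in> F n" for x n
  proof -
    have "x \<in> ?P" using that F(2) CN(3) by blast
    then show ?thesis by (auto split: split_indicator_asm)
  qed
  have "AE x in lebesgue. x \<notin> F n" for n
  proof -
    have "compact (F n)" "F n \<subseteq> K0" using F(1) FP by auto
    then have i: "integrable lebesgue (\<lambda>x. indicator (F n) x *\<^sub>R h x)"
      and z: "(LINT x|lebesgue. indicator (F n) x *\<^sub>R h x) = 0"
      using 0[of "F n"] unfolding set_integrable_def set_lebesgue_integral_def by blast+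
    have "AE x in lebesgue. 0 \<le> indicator (F n) x *\<^sub>R h x"
      using FP by (auto simp: less_imp_le split: split_indicator)
    then have "AE x in lebesgue. indicator (F n) x *\<^sub>R h x = 0"
      using integral_nonneg_eq_0_iff_AE[OF i] z by blast
    then show ?thesis
      by eventually_elim (use FP in \<open>fastforce split: split_indicator_asm\<close>)
  qed
  then have "AE x in lebesgue. \<forall>n. x \<notin> F n"
    by (simp add: AE_all_countable)
  moreover have "AE x in lebesgue. x \<notin> N"
    using CN(2) by (rule AE_not_in)
  ultimately show ?thesis
  proof eventually_elim
    case (elim x)
    then have "x \<notin> ?P" using F(2) CN(3) by blast
    then show ?case by auto
  qed
qed

lemma fundamental_lemma_calculus_of_variations:
  fixes h :: "real^'n::finite \<Rightarrow> real"
  assumes A: "open A" and h: "locally_integrable_on h A"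
    and test: "\<And>\<phi>. \<phi> \<in> test_functions A \<Longrightarrow> (LINT x:A|lebesgue. h x * \<phi> x) = 0"
  shows "AE x in lebesgue. x \<in> A \<longrightarrow> h x = 0"
proof -
  have z: "set_integrable lebesgue K h \<and> (LINT x:K|lebesgue. h x) = 0" if "compact K" "K \<subseteq> A" for K
    using integral_compact_eq_0[OF A h test that] h that by (auto simp: locally_integrable_on_def)
  have on_compact: "AE x in lebesgue. x \<in> K \<longrightarrow> h x = 0" if K: "compact K" "K \<subseteq> A" for K
  proof -
    have "AE x in lebesgue. x \<in> K \<longrightarrow> h x \<le> 0"
      using z K by (intro AE_nonpos_on_compact) (auto dest: order_trans)
    moreover have "AE x in lebesgue. x \<in> K \<longrightarrow> - h x \<le> 0"
      using z K by (intro AE_nonpos_on_compact) (auto dest: order_trans simp: set_lebesgue_integral_def set_integrable_def)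
    ultimately show ?thesis by eventually_elim auto
  qed
  obtain D where D: "\<And>n::nat. compact (D n)" "\<And>n. D n \<subseteq> A" "\<Union>(range D) = A"
    by (rule open_Union_compact_subsets[OF A]) (rule that)
  have "AE x in lebesgue. \<forall>n. x \<in> D n \<longrightarrow> h x = 0"
    unfolding AE_all_countable using on_compact[OF D(1,2)] by (rule allI)
  then show ?thesis
    by eventually_elim (use D(3) in blast)
qed

lemma locally_integrable_vec_nth:
  "locally_integrable_on g A \<Longrightarrow> locally_integrable_on (\<lambda>x. g x $ i :: real) A"
  unfolding locally_integrable_on_def set_integrable_def
  using integrable_bounded_linear[OF bounded_linear_vec_nth[of i]] by fastforce

lemma has_weak_gradient_unique:
  fixes u :: "real^'n::finite \<Rightarrow> real"
  assumes A: "open A" and g: "has_weak_gradient A u g" "has_weak_gradient A u g'"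
  shows "AE x in lebesgue. x \<in> A \<longrightarrow> g x = g' x"
proof -
  have "AE x in lebesgue. x \<in> A \<longrightarrow> g x $ i - g' x $ i = 0" for i
  proof (rule fundamental_lemma_calculus_of_variations[OF A])
    have li: "locally_integrable_on (\<lambda>x. g x $ i) A" "locally_integrable_on (\<lambda>x. g' x $ i) A"
      using g by (auto simp: has_weak_gradient_def intro: locally_integrable_vec_nth)
    then show "locally_integrable_on (\<lambda>x. g x $ i - g' x $ i) A"
      unfolding locally_integrable_on_def by (auto intro: set_integral_diff(1))
    fix \<phi> assume \<phi>: "\<phi> \<in> test_functions A"
    then obtain K where "compact K" "K \<subseteq> A" "\<And>x. x \<notin> K \<Longrightarrow> \<phi> x = 0" "continuous_on UNIV \<phi>"
      using test_functionE by metis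
    then have "set_integrable lebesgue A (\<lambda>x. g x $ i * \<phi> x)" "set_integrable lebesgue A (\<lambda>x. g' x $ i * \<phi> x)"
      using li by (auto intro: locally_integrable_mult_compact_support)
    then have "(LINT x:A|lebesgue. g x $ i * \<phi> x - g' x $ i * \<phi> x) =
        (LINT x:A|lebesgue. g x $ i * \<phi> x) - (LINT x:A|lebesgue. g' x $ i * \<phi> x)"
      by (rule set_integral_diff(2))
    also have "(LINT x:A|lebesgue. g x $ i * \<phi> x) = - (LINT x:A|lebesgue. u x * partial i \<phi> x)"
      using g(1) \<phi> by (simp add: has_weak_gradient_def)
    also have "(LINT x:A|lebesgue. g' x $ i * \<phi> x) = - (LINT x:A|lebesgue. u x * partial i \<phi> x)"
      using g(2) \<phi> by (simp add: has_weak_gradient_def)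
    finally show "(LINT x:A|lebesgue. (g x $ i - g' x $ i) * \<phi> x) = 0"
      by (simp add: left_diff_distrib)
  qed
  then have "AE x in lebesgue. \<forall>i\<in>UNIV. x \<in> A \<longrightarrow> g x $ i - g' x $ i = 0"
    by (intro AE_finite_allI) auto
  then show ?thesis
    by eventually_elim (auto simp: vec_eq_iff)
qed

text \<open>
  Completeness of the Lebesgue measure. It is needed because \<open>weak_gradient\<close> is an unspecified
  choice, known only almost everywhere.
\<close>

lemma borel_measurable_lebesgue_cong_AE:
  assumes f: "f \<in> borel_measurable lebesgue" and ae: "AE x in lebesgue. f x = g x"
  shows "g \<in> borel_measurable lebesgue"
proof -
  obtain N where N: "{x. f x \<noteq> g x} \<subseteq> N" "N \<in> null_sets lebesgue"
    using ae by (auto simp: eventually_ae_filter)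
  show ?thesis
  proof (rule measurableI)
    fix B :: "'b set" assume B: "B \<in> sets borel"
    have "f -` B \<in> sets lebesgue"
      using measurable_sets[OF f B] by simp
    moreover have "g -` B \<inter> N \<in> null_sets lebesgue"
      using N(2) by (rule null_sets_completion_subset[rotated]) auto
    moreover have "g -` B \<inter> space lebesgue = (f -` B - N) \<union> (g -` B \<inter> N)"
    proof -
      have "f x = g x" if "x \<notin> N" for x using N(1) that by blast
      then show ?thesis by auto
    qed
    ultimately show "g -` B \<inter> space lebesgue \<in> sets lebesgue"
      using null_setsD2[OF N(2)] by (simp only:) (intro sets.Un sets.Diff; blast dest: null_setsD2)
  qed simp
qed

lemma set_integral_lebesgue_cong_AE:
  fixes f g :: "'a::euclidean_space \<Rightarrow> real"
  assumes "set_integrable lebesgue A f" "AE x in lebesgue. x \<in> A \<longrightarrow> f x = g x"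
  shows "(LINT x:A|lebesgue. g x) = (LINT x:A|lebesgue. f x)" "set_integrable lebesgue A g"
proof -
  have m: "(\<lambda>x. indicator A x *\<^sub>R f x) \<in> borel_measurable lebesgue"
    using assms(1) unfolding set_integrable_def by (rule borel_measurable_integrable)
  have ae: "AE x in lebesgue. indicator A x *\<^sub>R f x = indicator A x *\<^sub>R g x"
    using assms(2) by eventually_elim (auto split: split_indicator)
  have m': "(\<lambda>x. indicator A x *\<^sub>R g x) \<in> borel_measurable lebesgue"
    using borel_measurable_lebesgue_cong_AE[OF m ae] .
  show "(LINT x:A|lebesgue. g x) = (LINT x:A|lebesgue. f x)"
    unfolding set_lebesgue_integral_def using integral_cong_AE[OF m m' ae] by simp
  show "set_integrable lebesgue A g"
    using assms(1) integrable_cong_AE[OF m m' ae] unfolding set_integrable_def by simp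
qed

lemma weak_gradient_AE_eq:
  fixes u :: "real^'n::finite \<Rightarrow> real"
  assumes "open A" "has_weak_gradient A u g"
  shows "AE x in lebesgue. x \<in> A \<longrightarrow> weak_gradient A u x = g x"
proof -
  have "has_weak_gradient A u (weak_gradient A u)"
    unfolding weak_gradient_def by (rule someI[of "has_weak_gradient A u", OF assms(2)])
  then show ?thesis using has_weak_gradient_unique assms by blast
qed

lemma has_weak_gradient_C1:
  fixes u :: "real^'n::finite \<Rightarrow> real"
  assumes A: "open A" and u: "Ck_on 1 A u"
  shows "has_weak_gradient A u (grad u)"
  unfolding has_weak_gradient_def
proof (intro conjI ballI allI)
  show li: "locally_integrable_on u A" "locally_integrable_on (grad u) A"
    using Ck_on_continuous[OF u] grad_continuous[OF u] by (auto intro: locally_integrable_continuous)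
  fix \<phi> i assume \<phi>: "\<phi> \<in> test_functions A"
  obtain L where L: "compact L" "L \<subseteq> A" "\<And>x. x \<notin> L \<Longrightarrow> \<phi> x = 0" "\<And>i x. x \<notin> L \<Longrightarrow> partial i \<phi> x = 0"
    "Ck_on 1 UNIV \<phi>" "continuous_on UNIV \<phi>" "\<And>i. continuous_on UNIV (partial i \<phi>)"
    "\<And>x. \<phi> differentiable (at x)"
    by (rule test_functionE[OF \<phi>]) (rule that)
  have \<phi>A: "Ck_on 1 A \<phi>"
    by (rule Ck_on_subset[OF L(5) subset_UNIV])
  have i1: "set_integrable lebesgue A (\<lambda>x. u x * partial i \<phi> x)"
    using locally_integrable_mult_compact_support[OF li(1) L(7) L(1,2,4)] .
  have i2: "set_integrable lebesgue A (\<lambda>x. grad u x $ i * \<phi> x)"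
    using locally_integrable_mult_compact_support[OF locally_integrable_vec_nth[OF li(2)] L(6) L(1,2,3)] .
  have "0 = (LINT x:A|lebesgue. partial i (\<lambda>x. u x * \<phi> x) x)"
    using set_integral_partial_compact_support(2)[OF A L(1,2) Ck_on_mult[OF A u \<phi>A]] L(3) by simp
  also have "\<dots> = (LINT x:A|lebesgue. u x * partial i \<phi> x + grad u x $ i * \<phi> x)"
    unfolding set_lebesgue_integral_def using u L(8)
    by (intro Bochner_Integration.integral_cong)
      (auto simp: partial_mult Ck_on_1_iff grad_def split: split_indicator)
  also have "\<dots> = (LINT x:A|lebesgue. u x * partial i \<phi> x) + (LINT x:A|lebesgue. grad u x $ i * \<phi> x)"
    by (rule set_integral_add(2)[OF i1 i2])
  finally show "(LINT x:A|lebesgue. u x * partial i \<phi> x) = - (LINT x:A|lebesgue. grad u x $ i * \<phi> x)"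
    by simp
qed

lemma locally_integrable_lincomb:
  fixes u v :: "real^'n::finite \<Rightarrow> 'b::euclidean_space"
  assumes "locally_integrable_on u A" "locally_integrable_on v A"
  shows "locally_integrable_on (\<lambda>x. a *\<^sub>R u x + b *\<^sub>R v x) A"
  unfolding locally_integrable_on_def
proof (intro allI impI)
  fix K assume "compact K \<and> K \<subseteq> A"
  then show "set_integrable lebesgue K (\<lambda>x. a *\<^sub>R u x + b *\<^sub>R v x)"
    using assms unfolding locally_integrable_on_def
    by (intro set_integral_add(1) set_integrable_scaleR_right) auto
qed

lemma has_weak_gradient_lincomb:
  fixes u v :: "real^'n::finite \<Rightarrow> real"
  assumes u: "has_weak_gradient A u g" and v: "has_weak_gradient A v h"
  shows "has_weak_gradient A (\<lambda>x. a * u x + b * v x) (\<lambda>x. a *\<^sub>R g x + b *\<^sub>R h x)"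
  unfolding has_weak_gradient_def
proof (intro conjI ballI allI)
  have li: "locally_integrable_on u A" "locally_integrable_on v A"
    "locally_integrable_on g A" "locally_integrable_on h A"
    using u v by (auto simp: has_weak_gradient_def)
  show "locally_integrable_on (\<lambda>x. a * u x + b * v x) A"
    using locally_integrable_lincomb[OF li(1,2), of a b] by simp
  show "locally_integrable_on (\<lambda>x. a *\<^sub>R g x + b *\<^sub>R h x) A"
    using locally_integrable_lincomb[OF li(3,4)] .
  fix \<phi> i assume \<phi>: "\<phi> \<in> test_functions A"
  obtain L where L: "compact L" "L \<subseteq> A" "\<And>x. x \<notin> L \<Longrightarrow> \<phi> x = 0" "\<And>i x. x \<notin> L \<Longrightarrow> partial i \<phi> x = 0"
    "Ck_on 1 UNIV \<phi>" "continuous_on UNIV \<phi>" "\<And>i. continuous_on UNIV (partial i \<phi>)"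
    "\<And>x. \<phi> differentiable (at x)"
    by (rule test_functionE[OF \<phi>]) (rule that)
  have 1: "(LINT x:A|lebesgue. (a * f x + b * f' x) * \<psi> x) =
      a * (LINT x:A|lebesgue. f x * \<psi> x) + b * (LINT x:A|lebesgue. f' x * \<psi> x)"
    if "locally_integrable_on f A" "locally_integrable_on f' A"
      "continuous_on UNIV \<psi>" "\<And>x. x \<notin> L \<Longrightarrow> \<psi> x = 0" for f f' \<psi> :: "real^'n \<Rightarrow> real"
  proof -
    have i: "set_integrable lebesgue A (\<lambda>x. f x * \<psi> x)" "set_integrable lebesgue A (\<lambda>x. f' x * \<psi> x)"
      using that L(1,2) by (auto intro: locally_integrable_mult_compact_support)
    have "(LINT x:A|lebesgue. (a * f x + b * f' x) * \<psi> x) =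
        (LINT x:A|lebesgue. a * (f x * \<psi> x) + b * (f' x * \<psi> x))"
      by (simp add: algebra_simps)
    also have "\<dots> = (LINT x:A|lebesgue. a * (f x * \<psi> x)) + (LINT x:A|lebesgue. b * (f' x * \<psi> x))"
      using i by (intro set_integral_add(2) set_integrable_mult_right) auto
    finally show ?thesis by simp
  qed
  have "(LINT x:A|lebesgue. (a * u x + b * v x) * partial i \<phi> x) =
     a * (LINT x:A|lebesgue. u x * partial i \<phi> x) + b * (LINT x:A|lebesgue. v x * partial i \<phi> x)"
    by (rule 1[OF li(1,2) L(7,4)])
  also have "\<dots> = - (a * (LINT x:A|lebesgue. g x $ i * \<phi> x) + b * (LINT x:A|lebesgue. h x $ i * \<phi> x))"
    using u v \<phi> by (simp add: has_weak_gradient_def)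
  also have "\<dots> = - (LINT x:A|lebesgue. (a * g x $ i + b * h x $ i) * \<phi> x)"
    using 1[OF locally_integrable_vec_nth[OF li(3)] locally_integrable_vec_nth[OF li(4)] L(6,3)] by simp
  finally show "(LINT x:A|lebesgue. (a * u x + b * v x) * partial i \<phi> x) =
     - (LINT x:A|lebesgue. (a *\<^sub>R g x + b *\<^sub>R h x) $ i * \<phi> x)"
    by simp
qed

lemma H1_norm_eq:
  assumes "open A" "has_weak_gradient A u g"
    and "set_integrable lebesgue A (\<lambda>x. (u x)\<^sup>2 + (norm (g x))\<^sup>2)"
  shows "H1_norm A u = sqrt (LINT x:A|lebesgue. (u x)\<^sup>2 + (norm (g x))\<^sup>2)"
proof -
  have "AE x in lebesgue. x \<in> A \<longrightarrow> (u x)\<^sup>2 + (norm (g x))\<^sup>2 = (u x)\<^sup>2 + (norm (weak_gradient A u x))\<^sup>2"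
    using weak_gradient_AE_eq[OF assms(1,2)] by eventually_elim auto
  from set_integral_lebesgue_cong_AE(1)[OF assms(3) this]
  show ?thesis by (simp add: H1_norm_def)
qed

section \<open>Continuously differentiable truncations of the positive part\<close>

text \<open>
  For \<open>s > e > 0\<close> this is \<open>(s - e)\<^sup>2 / s = s - 2 e + e\<^sup>2 / s\<close>, and \<open>0\<close> otherwise. It is of class \<open>C\<^sup>1\<close>, vanishes
  for \<open>s \<le> e\<close>, and increases to the positive part of \<open>s\<close> as \<open>e\<close> decreases to \<open>0\<close>. Its derivative
  increases as well, to the indicator of \<open>s > 0\<close>, so that monotone convergence applies to energies.
\<close>

definition trunc :: "real \<Rightarrow> real \<Rightarrow> real" where
  "trunc e s = (max e s - e)\<^sup>2 / max e s"

definition trunc_deriv :: "real \<Rightarrow> real \<Rightarrow> real" where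
  "trunc_deriv e s = 1 - (e / max e s)\<^sup>2"

lemma trunc_eq_0: "s \<le> e \<Longrightarrow> trunc e s = 0"
  by (simp add: trunc_def max_def)

lemma trunc_has_derivative:
  assumes "e > 0"
  shows "(trunc e has_real_derivative trunc_deriv e s) (at s)"
proof (cases s e rule: linorder_cases)
  case less
  have "((\<lambda>s. 0) has_real_derivative trunc_deriv e s) (at s)"
    using less assms by (simp add: trunc_deriv_def)
  then show ?thesis
    by (rule has_field_derivative_transform_within_open[where S="{..<e}"])
       (use less in \<open>auto simp: trunc_def\<close>)
next
  case equal
  have "((\<lambda>h. (trunc e (e + h) - trunc e e) / h) \<longlongrightarrow> 0) (at 0)"
  proof (rule Lim_null_comparison)
    show "\<forall>\<^sub>F h in at 0. norm ((trunc e (e + h) - trunc e e) / h) \<le> \<bar>h\<bar> / e"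
    proof (rule always_eventually, rule allI)
      fix h
      show "norm ((trunc e (e + h) - trunc e e) / h) \<le> \<bar>h\<bar> / e"
      proof (cases "h > 0")
        case True
        have "h\<^sup>2 / (e + h) \<le> h\<^sup>2 / e"
          using True assms by (intro divide_left_mono) auto
        then have "h\<^sup>2 / (e + h) / h \<le> h\<^sup>2 / e / h"
          using True by (intro divide_right_mono) auto
        then show ?thesis
          using True assms by (simp add: trunc_def max_def power2_eq_square)
      next
        case False
        then have "trunc e (e + h) = 0" "trunc e e = 0" by (auto intro: trunc_eq_0)
        then show ?thesis using assms by (simp del: divide_le_0_iff)
      qed
    qed
    show "((\<lambda>h. \<bar>h\<bar> / e) \<longlongrightarrow> 0) (at 0)"
      using assms by (auto intro!: tendsto_eq_intros)
  qed
  then show ?thesis using equal assms by (simp add: DERIV_def trunc_deriv_def)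
next
  case greater
  have "((\<lambda>s. (s - e)\<^sup>2 / s) has_real_derivative trunc_deriv e s) (at s)"
    using greater assms
    by (auto intro!: derivative_eq_intros simp: trunc_deriv_def max_def field_simps power2_eq_square)
  then show ?thesis
    by (rule has_field_derivative_transform_within_open[where S="{e<..}"])
       (use greater in \<open>auto simp: trunc_def max_def\<close>)
qed

lemma trunc_deriv_eq_0: "e > 0 \<Longrightarrow> s \<le> e \<Longrightarrow> trunc_deriv e s = 0"
  by (simp add: trunc_deriv_def max_def)

lemma trunc_bounds:
  assumes "e > 0"
  shows "0 \<le> trunc e s" "trunc e s \<le> max 0 s"
proof -
  show "0 \<le> trunc e s" using assms by (simp add: trunc_def max_def)
  show "trunc e s \<le> max 0 s"
  proof (cases "s \<le> e")
    case False
    then have "(s - e)\<^sup>2 \<le> s * s"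
      using assms mult_mono[of "s - e" s "s - e" s] by (simp add: power2_eq_square)
    then have "(s - e)\<^sup>2 / s \<le> s"
      using False assms by (simp add: divide_le_eq)
    then show ?thesis using False assms by (simp add: trunc_def max_def)
  qed (simp add: trunc_eq_0)
qed

lemma trunc_deriv_bounds:
  assumes "e > 0"
  shows "0 \<le> trunc_deriv e s" "trunc_deriv e s \<le> 1"
  using assms power_mono[of "e / max e s" 1 2] by (auto simp: trunc_deriv_def)

lemma trunc_deriv_antimono:
  assumes "0 < d" "d \<le> e"
  shows "trunc_deriv e s \<le> trunc_deriv d s"
proof -
  have "d * max e s \<le> e * max d s"
    using assms mult_mono[of d e s s] by (cases "0 \<le> s") (auto simp: max_def mult.commute intro: mult_mono)
  then have "d / max d s \<le> e / max e s"
    using assms by (simp add: field_simps max_def split: if_splits)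
  then have "(d / max d s)\<^sup>2 \<le> (e / max e s)\<^sup>2"
    using assms by (intro power_mono) auto
  then show ?thesis by (simp add: trunc_deriv_def)
qed

lemma continuous_trunc_deriv: "e > 0 \<Longrightarrow> continuous_on UNIV (trunc_deriv e)"
  unfolding trunc_deriv_def[abs_def] by (auto intro!: continuous_intros)

lemma continuous_trunc: "e > 0 \<Longrightarrow> continuous_on UNIV (trunc e)"
  unfolding trunc_def[abs_def] by (auto intro!: continuous_intros)

definition eps :: "nat \<Rightarrow> real" where "eps n = 1 / real (n + 1)"

lemma eps_pos: "eps n > 0" and eps_antimono: "m \<le> n \<Longrightarrow> eps n \<le> eps m"
  and eps_lim: "eps \<longlonglongrightarrow> 0"
  using LIMSEQ_inverse_real_of_nat by (auto simp: eps_def[abs_def] inverse_eq_divide field_simps)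

lemma trunc_lim: "(\<lambda>n. trunc (eps n) s) \<longlonglongrightarrow> max 0 s"
proof (cases "s > 0")
  case True
  have "(\<lambda>n. (max (eps n) s - eps n)\<^sup>2 / max (eps n) s) \<longlonglongrightarrow> (max 0 s - 0)\<^sup>2 / max 0 s"
    using True by (intro tendsto_intros eps_lim) auto
  then show ?thesis using True by (simp add: trunc_def power2_eq_square)
next
  case False
  then have "trunc (eps n) s = 0" for n
    using eps_pos[of n] by (intro trunc_eq_0) simp
  then show ?thesis using False by (simp add: max_def)
qed

lemma trunc_deriv_lim: "(\<lambda>n. trunc_deriv (eps n) s) \<longlonglongrightarrow> (if s > 0 then 1 else 0)"
proof (cases "s > 0")
  case True
  have "(\<lambda>n. 1 - (eps n / max (eps n) s)\<^sup>2) \<longlonglongrightarrow> 1 - (0 / max 0 s)\<^sup>2"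
    using True by (intro tendsto_intros eps_lim) auto
  then show ?thesis using True by (simp add: trunc_deriv_def)
next
  case False
  then have "trunc_deriv (eps n) s = 0" for n
    using eps_pos[of n] by (intro trunc_deriv_eq_0) simp_all
  then show ?thesis using False by simp
qed

text \<open>
  The function \<open>trunc e \<circ> w\<close> lives on the set where \<open>w \<ge> e\<close>. As this set is closed in \<open>U\<close>, its
  intersection with the support of \<open>\<phi>\<close> is a compact subset of \<open>A\<close>, and there is no boundary term even if
  the support of \<open>\<phi>\<close> leaves \<open>A\<close>. Both \<open>U = A\<close> and a larger \<open>U\<close> are of interest.
\<close>

lemma trunc_ibp_test:
  fixes w :: "real^'n::finite \<Rightarrow> real"
  assumes A: "open A" "A \<subseteq> U" and w: "Ck_on 1 A w" and e: "e > 0"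
    and cl: "closedin (top_of_set U) {x \<in> A. w x \<ge> e}"
    and \<phi>: "\<phi> \<in> test_functions U"
  shows "(LINT x:A|lebesgue. trunc e (w x) * partial i \<phi> x) =
    - (LINT x:A|lebesgue. trunc_deriv e (w x) * partial i w x * \<phi> x)"
    "set_integrable lebesgue A (\<lambda>x. trunc e (w x) * partial i \<phi> x)"
    "set_integrable lebesgue A (\<lambda>x. trunc_deriv e (w x) * partial i w x * \<phi> x)"
proof -
  obtain L where L: "compact L" "L \<subseteq> U" "\<And>x. x \<notin> L \<Longrightarrow> \<phi> x = 0" "\<And>i x. x \<notin> L \<Longrightarrow> partial i \<phi> x = 0"
    "Ck_on 1 UNIV \<phi>" "continuous_on UNIV \<phi>" "\<And>i. continuous_on UNIV (partial i \<phi>)"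
    "\<And>x. \<phi> differentiable (at x)"
    by (rule test_functionE[OF \<phi>]) (rule that)
  obtain T where T: "closed T" "{x \<in> A. w x \<ge> e} = U \<inter> T"
    using cl unfolding closedin_closed by blast
  define K where "K = L \<inter> {x \<in> A. w x \<ge> e}"
  have "K = L \<inter> T" using T(2) L(2) by (auto simp: K_def)
  then have K: "compact K" "K \<subseteq> A"
    using L(1) T(1) by (auto simp: K_def compact_Int_closed)
  have small: "\<phi> x = 0 \<and> partial i \<phi> x = 0 \<or> w x \<le> e" if "x \<in> A" "x \<notin> K" for x i
    using that L(3,4) by (auto simp: K_def)
  have tr: "Ck_on 1 A (\<lambda>x. trunc e (w x))"
    using Ck_on_1_chain[OF w trunc_has_derivative[OF e] continuous_trunc_deriv[OF e]] .
  have \<phi>A: "Ck_on 1 A \<phi>"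
    by (rule Ck_on_subset[OF L(5) subset_UNIV])
  have p: "partial i (\<lambda>x. trunc e (w x) * \<phi> x) x =
      trunc e (w x) * partial i \<phi> x + trunc_deriv e (w x) * partial i w x * \<phi> x" if "x \<in> A" for x
  proof -
    have "w differentiable (at x)" using w that by (simp add: Ck_on_1_iff)
    then show ?thesis
      using tr L(8) that partial_chain[OF _ trunc_has_derivative[OF e], of w x i]
      by (subst partial_mult) (auto simp: Ck_on_1_iff)
  qed
  have cont: "continuous_on A (\<lambda>x. trunc e (w x))" "continuous_on A (\<lambda>x. trunc_deriv e (w x))"
    "continuous_on A (partial i w)" "continuous_on A \<phi>" "continuous_on A (partial i \<phi>)"
    using Ck_on_continuous[OF w] w continuous_on_subset[OF L(6)] continuous_on_subset[OF L(7)]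
    by (auto intro: continuous_on_compose2[OF continuous_trunc_deriv[OF e]]
          continuous_on_compose2[OF continuous_trunc[OF e]])
  show i1: "set_integrable lebesgue A (\<lambda>x. trunc e (w x) * partial i \<phi> x)"
    by (rule set_integrable_compact_support[OF _ K])
      (use small cont in \<open>auto intro!: continuous_intros simp: trunc_eq_0 dest!: small[of _ i]\<close>)
  show i2: "set_integrable lebesgue A (\<lambda>x. trunc_deriv e (w x) * partial i w x * \<phi> x)"
    by (rule set_integrable_compact_support[OF _ K])
      (use small cont e in \<open>auto intro!: continuous_intros simp: trunc_deriv_eq_0 dest!: small[of _ i]\<close>)
  have "(LINT x:A|lebesgue. partial i (\<lambda>x. trunc e (w x) * \<phi> x) x) = 0"
  proof (rule set_integral_partial_compact_support(2)[OF A(1) K Ck_on_mult[OF A(1) tr \<phi>A]])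
    show "trunc e (w x) * \<phi> x = 0" if "x \<in> A" "x \<notin> K" for x
      using small[OF that, of i] by (auto simp: trunc_eq_0)
  qed
  also have "(LINT x:A|lebesgue. partial i (\<lambda>x. trunc e (w x) * \<phi> x) x) =
    (LINT x:A|lebesgue. trunc e (w x) * partial i \<phi> x + trunc_deriv e (w x) * partial i w x * \<phi> x)"
    unfolding set_lebesgue_integral_def
    by (intro Bochner_Integration.integral_cong) (auto simp: p split: split_indicator)
  also have "\<dots> = (LINT x:A|lebesgue. trunc e (w x) * partial i \<phi> x) +
      (LINT x:A|lebesgue. trunc_deriv e (w x) * partial i w x * \<phi> x)"
    by (rule set_integral_add(2)[OF i1 i2])
  finally show "(LINT x:A|lebesgue. trunc e (w x) * partial i \<phi> x) =
    - (LINT x:A|lebesgue. trunc_deriv e (w x) * partial i w x * \<phi> x)" by simp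
qed

text \<open>
  This is the equation for \<open>p\<close> tested with \<open>trunc e \<circ> w\<close>: the divergence of
  \<open>(trunc e \<circ> w) grad p\<close> integrates to \<open>0\<close>.
\<close>

lemma trunc_energy:
  fixes w p :: "real^'n::finite \<Rightarrow> real"
  assumes A: "open A" and w: "Ck_on 1 A w" and p: "Ck_on 2 A p" and e: "e > 0"
    and K: "compact {x \<in> A. w x \<ge> e}"
  shows "(LINT x:A|lebesgue. trunc_deriv e (w x) * (grad w x \<bullet> grad p x)) =
    - (LINT x:A|lebesgue. trunc e (w x) * laplacian p x)"
    "set_integrable lebesgue A (\<lambda>x. trunc_deriv e (w x) * (grad w x \<bullet> grad p x))"
    "set_integrable lebesgue A (\<lambda>x. trunc e (w x) * laplacian p x)"
proof -
  let ?K = "{x \<in> A. w x \<ge> e}"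
  have sub: "?K \<subseteq> A" by blast
  have small: "trunc e (w x) = 0" "trunc_deriv e (w x) = 0" if "x \<in> A" "x \<notin> ?K" for x
    using that e by (auto intro: trunc_eq_0 trunc_deriv_eq_0)
  have tr: "Ck_on 1 A (\<lambda>x. trunc e (w x))"
    using Ck_on_1_chain[OF w trunc_has_derivative[OF e] continuous_trunc_deriv[OF e]] .
  have p1: "Ck_on 1 A (partial i p)" for i
    using p by (simp add: numeral_2_eq_2)
  have p': "continuous_on A (partial i p)" "continuous_on A (partial i (partial i p))" for i
    using Ck_on_continuous[OF p1] p1[of i] by (auto simp: Ck_on_1_iff)
  have cont: "continuous_on A (\<lambda>x. trunc e (w x))" "continuous_on A (\<lambda>x. trunc_deriv e (w x))"
    "continuous_on A (partial i w)" for i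
    using Ck_on_continuous[OF w] w
    by (auto intro: continuous_on_compose2[OF continuous_trunc_deriv[OF e]]
          continuous_on_compose2[OF continuous_trunc[OF e]])
  have cl: "continuous_on A (laplacian p)"
    unfolding laplacian_def[abs_def] by (intro continuous_intros p')
  have cg: "continuous_on A (\<lambda>x. grad w x \<bullet> grad p x)"
    unfolding grad_def inner_vec_def using cont p' by (auto intro!: continuous_intros)
  show i1: "set_integrable lebesgue A (\<lambda>x. trunc_deriv e (w x) * (grad w x \<bullet> grad p x))"
    by (rule set_integrable_compact_support[OF _ K sub])
      (auto intro!: continuous_intros cont cg simp: small)
  show i2: "set_integrable lebesgue A (\<lambda>x. trunc e (w x) * laplacian p x)"
    by (rule set_integrable_compact_support[OF _ K sub])
      (auto intro!: continuous_intros cont cl simp: small)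
  let ?P = "\<lambda>i x. trunc e (w x) * partial i p x"
  have P0: "?P i x = 0" if "x \<in> A" "x \<notin> ?K" for i x
    using small[OF that] by simp
  note P = set_integral_partial_compact_support[OF A K sub Ck_on_mult[OF A tr p1] P0]
  have pp: "partial i (?P i) x = trunc e (w x) * partial i (partial i p) x +
      trunc_deriv e (w x) * (partial i w x * partial i p x)" if "x \<in> A" for i x
  proof -
    have "w differentiable (at x)" using w that by (simp add: Ck_on_1_iff)
    then show ?thesis
      using tr p1[of i] that partial_chain[OF _ trunc_has_derivative[OF e], of w x i]
      by (subst partial_mult) (auto simp: Ck_on_1_iff)
  qed
  have "0 = (\<Sum>i\<in>UNIV. LINT x|lebesgue. indicator A x *\<^sub>R partial i (?P i) x)"
    using P(2) by (simp add: set_lebesgue_integral_def)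
  also have "\<dots> = (LINT x|lebesgue. (\<Sum>i\<in>UNIV. indicator A x *\<^sub>R partial i (?P i) x))"
    using P(1) by (subst Bochner_Integration.integral_sum) (auto simp: set_integrable_def)
  also have "\<dots> = (LINT x:A|lebesgue. trunc_deriv e (w x) * (grad w x \<bullet> grad p x) + trunc e (w x) * laplacian p x)"
    unfolding set_lebesgue_integral_def
  proof (intro Bochner_Integration.integral_cong refl)
    fix x
    show "(\<Sum>i\<in>UNIV. indicator A x *\<^sub>R partial i (?P i) x) =
      indicator A x *\<^sub>R (trunc_deriv e (w x) * (grad w x \<bullet> grad p x) + trunc e (w x) * laplacian p x)"
    proof (cases "x \<in> A")
      case True
      then show ?thesis
        by (simp add: pp sum.distrib sum_distrib_left grad_def inner_vec_def laplacian_def)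
    qed simp
  qed
  also have "\<dots> = (LINT x:A|lebesgue. trunc_deriv e (w x) * (grad w x \<bullet> grad p x)) +
      (LINT x:A|lebesgue. trunc e (w x) * laplacian p x)"
    by (rule set_integral_add(2)[OF i1 i2])
  finally show "(LINT x:A|lebesgue. trunc_deriv e (w x) * (grad w x \<bullet> grad p x)) =
    - (LINT x:A|lebesgue. trunc e (w x) * laplacian p x)" by simp
qed

section \<open>The weak gradient of a positive part\<close>

lemma measurable_continuous_indicator:
  fixes h :: "'a::euclidean_space \<Rightarrow> 'b::euclidean_space"
  assumes "open A" "continuous_on A h"
  shows "(\<lambda>x. indicator A x *\<^sub>R h x) \<in> borel_measurable lebesgue"
proof -
  have "(\<lambda>x. indicator A x *\<^sub>R h x) \<in> borel_measurable borel"
    using assms by (intro borel_measurable_continuous_on_indicator) auto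
  then show ?thesis by (intro measurable_completion) simp
qed

lemma integrable_indicator_bounded_open:
  fixes c :: real
  assumes "open A" "bounded A"
  shows "integrable lebesgue (\<lambda>x::'a::euclidean_space. indicator A x * c)"
proof -
  have "A \<in> lmeasurable"
    using assms by (simp add: lmeasurable_open)
  then show ?thesis
    by (intro integrable_mult_left integrable_real_indicator) (auto simp: fmeasurable_def)
qed

definition pos_set :: "'a set \<Rightarrow> ('a \<Rightarrow> real) \<Rightarrow> 'a set" where
  "pos_set A w = {x \<in> A. w x > 0}"

lemma pos_set_open:
  fixes w :: "'a::topological_space \<Rightarrow> real"
  assumes "open A" "continuous_on A w"
  shows "open (pos_set A w)"
proof -
  have "pos_set A w = A \<inter> w -` {0<..}" by (auto simp: pos_set_def)
  then show ?thesis
    using assms by (simp add: continuous_on_open_vimage Int_commute open_Int)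
qed

definition pos_part :: "'a set \<Rightarrow> ('a \<Rightarrow> real) \<Rightarrow> 'a \<Rightarrow> real" where
  "pos_part A w x = indicator (pos_set A w) x * w x"

definition pos_grad :: "(real^'n::finite) set \<Rightarrow> (real^'n \<Rightarrow> real) \<Rightarrow> real^'n \<Rightarrow> real^'n" where
  "pos_grad A w x = indicator (pos_set A w) x *\<^sub>R grad w x"

lemma pos_part_eq_max: "x \<in> A \<Longrightarrow> pos_part A w x = max 0 (w x)"
  by (auto simp: pos_part_def pos_set_def split: split_indicator)

lemma pos_part_outside: "x \<notin> A \<Longrightarrow> pos_part A w x = 0"
  by (auto simp: pos_part_def pos_set_def split: split_indicator)

lemma trunc_pos_lim:
  "(\<lambda>n. indicator A x * trunc (eps n) (w x)) \<longlonglongrightarrow> pos_part A w x"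
  using tendsto_mult_left[OF trunc_lim[of "w x"], of "indicator A x"]
  by (cases "x \<in> A") (auto simp: pos_part_eq_max pos_part_outside)

lemma trunc_deriv_pos_lim:
  "(\<lambda>n. indicator A x * trunc_deriv (eps n) (w x)) \<longlonglongrightarrow> indicator (pos_set A w) x"
  using tendsto_mult_left[OF trunc_deriv_lim[of "w x"], of "indicator A x"]
  by (cases "x \<in> A") (auto simp: pos_set_def split: split_indicator)

lemma trunc_deriv_le_pos_indicator:
  assumes "e > 0" "x \<in> A"
  shows "trunc_deriv e (w x) \<le> indicator (pos_set A w) x"
  using assms trunc_deriv_bounds[OF assms(1), of "w x"] trunc_deriv_eq_0[OF assms(1), of "w x"]
  by (cases "w x > 0") (auto simp: pos_set_def split: split_indicator)

lemma set_integral_eq_if_zero_outside: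
  fixes h :: "'a::euclidean_space \<Rightarrow> real"
  assumes "\<And>x. x \<notin> U \<Longrightarrow> h x = 0"
  shows "set_integrable lebesgue U h \<longleftrightarrow> integrable lebesgue h"
    and "(LINT x:U|lebesgue. h x) = (LINT x|lebesgue. h x)"
proof -
  have "(\<lambda>x. indicator U x *\<^sub>R h x) = h"
    using assms by (auto simp: fun_eq_iff split: split_indicator)
  then show "set_integrable lebesgue U h \<longleftrightarrow> integrable lebesgue h"
    and "(LINT x:U|lebesgue. h x) = (LINT x|lebesgue. h x)"
    by (simp_all only: set_integrable_def set_lebesgue_integral_def)
qed

text \<open>
  Dominated convergence for weights \<open>a n\<close> that stay below their limit \<open>b\<close>. The weights in question are
  \<open>trunc (eps n) \<circ> w\<close> and \<open>trunc_deriv (eps n) \<circ> w\<close>. Their limits vanish outside \<open>A\<close>, as \<open>lim\<close> implies.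
\<close>

lemma weighted_set_integral_tendsto:
  fixes h :: "'a::euclidean_space \<Rightarrow> real"
  assumes int: "integrable lebesgue (\<lambda>x. b x * h x)"
    and int_n: "\<And>n. set_integrable lebesgue A (\<lambda>x. a n x * h x)"
    and le: "\<And>n x. x \<in> A \<Longrightarrow> 0 \<le> a n x" "\<And>n x. x \<in> A \<Longrightarrow> a n x \<le> b x"
    and lim: "\<And>x. (\<lambda>n. indicator A x * a n x) \<longlonglongrightarrow> b x"
  shows "(\<lambda>n. LINT x:A|lebesgue. a n x * h x) \<longlonglongrightarrow> (LINT x|lebesgue. b x * h x)"
  unfolding set_lebesgue_integral_def
proof (rule integral_dominated_convergence[OF _ _ integrable_norm[OF int]])
  show "(\<lambda>x. b x * h x) \<in> borel_measurable lebesgue"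
    using int by (rule borel_measurable_integrable)
  show "(\<lambda>x. indicator A x *\<^sub>R (a n x * h x)) \<in> borel_measurable lebesgue" for n
    using int_n[of n] unfolding set_integrable_def by (rule borel_measurable_integrable)
  show "AE x in lebesgue. (\<lambda>n. indicator A x *\<^sub>R (a n x * h x)) \<longlonglongrightarrow> b x * h x"
  proof (rule AE_I2)
    show "(\<lambda>n. indicator A x *\<^sub>R (a n x * h x)) \<longlonglongrightarrow> b x * h x" for x
      using tendsto_mult_right[OF lim[of x], of "h x"] by (simp add: mult.assoc)
  qed
  show "AE x in lebesgue. norm (indicator A x *\<^sub>R (a n x * h x)) \<le> norm (b x * h x)" for n
  proof (rule AE_I2)
    fix x
    show "norm (indicator A x *\<^sub>R (a n x * h x)) \<le> norm (b x * h x)"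
    proof (cases "x \<in> A")
      case True
      then have "\<bar>a n x\<bar> \<le> \<bar>b x\<bar>" using le[of x n] by linarith
      then show ?thesis using True by (simp add: abs_mult mult_right_mono)
    qed simp
  qed
qed

text \<open>
  Pass to the limit in \<open>trunc_ibp_test\<close> by dominated convergence. For \<open>U\<close> larger than \<open>A\<close> the lemma
  says that the extension of the positive part by zero across the boundary of \<open>A\<close> creates no singular part
  of the gradient.
\<close>

lemma has_weak_gradient_pos_part:
  fixes w :: "real^'n::finite \<Rightarrow> real"
  assumes A: "open A" "A \<subseteq> U" and w: "Ck_on 1 A w"
    and cl: "\<And>e. e > 0 \<Longrightarrow> closedin (top_of_set U) {x \<in> A. w x \<ge> e}"
    and li: "locally_integrable_on (pos_part A w) U" "locally_integrable_on (pos_grad A w) U"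
  shows "has_weak_gradient U (pos_part A w) (pos_grad A w)"
  unfolding has_weak_gradient_def
proof (intro conjI ballI allI li)
  fix \<phi> i assume \<phi>: "\<phi> \<in> test_functions U"
  obtain L where L: "compact L" "L \<subseteq> U" "\<And>x. x \<notin> L \<Longrightarrow> \<phi> x = 0" "\<And>i x. x \<notin> L \<Longrightarrow> partial i \<phi> x = 0"
    "Ck_on 1 UNIV \<phi>" "continuous_on UNIV \<phi>" "\<And>i. continuous_on UNIV (partial i \<phi>)"
    "\<And>x. \<phi> differentiable (at x)"
    by (rule test_functionE[OF \<phi>]) (rule that)
  have i1: "set_integrable lebesgue U (\<lambda>x. pos_part A w x * partial i \<phi> x)"
    using locally_integrable_mult_compact_support[OF li(1) L(7) L(1,2,4)] .
  have i2: "set_integrable lebesgue U (\<lambda>x. pos_grad A w x $ i * \<phi> x)"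
    using locally_integrable_mult_compact_support[OF locally_integrable_vec_nth[OF li(2)] L(6) L(1,2,3)] .
  note ibp = trunc_ibp_test[OF A w eps_pos cl[OF eps_pos] \<phi>]
  have U0: "pos_part A w x = 0" "pos_grad A w x = 0" if "x \<notin> U" for x
    using that A(2) by (auto simp: pos_part_def pos_grad_def pos_set_def split: split_indicator)
  have grad_eq: "pos_grad A w x $ i * \<phi> x = indicator (pos_set A w) x * (partial i w x * \<phi> x)" for x
    by (simp add: pos_grad_def grad_def)
  have on_U: "(LINT x:U|lebesgue. pos_part A w x * partial i \<phi> x) = (LINT x|lebesgue. pos_part A w x * partial i \<phi> x)"
    "(LINT x:U|lebesgue. pos_grad A w x $ i * \<phi> x) =
      (LINT x|lebesgue. indicator (pos_set A w) x * (partial i w x * \<phi> x))"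
    "integrable lebesgue (\<lambda>x. pos_part A w x * partial i \<phi> x)"
    "integrable lebesgue (\<lambda>x. indicator (pos_set A w) x * (partial i w x * \<phi> x))"
    unfolding grad_eq[symmetric] using i1 i2
    by (auto simp: U0 set_integral_eq_if_zero_outside[of U])
  have lim1: "(\<lambda>n. LINT x:A|lebesgue. trunc (eps n) (w x) * partial i \<phi> x) \<longlonglongrightarrow>
      (LINT x:U|lebesgue. pos_part A w x * partial i \<phi> x)"
    unfolding on_U using on_U(3) ibp(2)
    by (rule weighted_set_integral_tendsto)
      (use trunc_bounds[OF eps_pos] in \<open>auto simp: pos_part_eq_max trunc_pos_lim\<close>)
  have lim2: "(\<lambda>n. LINT x:A|lebesgue. trunc_deriv (eps n) (w x) * (partial i w x * \<phi> x)) \<longlonglongrightarrow>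
      (LINT x:U|lebesgue. pos_grad A w x $ i * \<phi> x)"
    unfolding on_U using on_U(4) ibp(3)[unfolded mult.assoc]
    by (rule weighted_set_integral_tendsto)
      (use trunc_deriv_bounds[OF eps_pos] in \<open>auto intro: trunc_deriv_le_pos_indicator eps_pos trunc_deriv_pos_lim\<close>)
  show "(LINT x:U|lebesgue. pos_part A w x * partial i \<phi> x) = - (LINT x:U|lebesgue. pos_grad A w x $ i * \<phi> x)"
    using LIMSEQ_unique[OF lim1] tendsto_minus[OF lim2] by (simp add: ibp(1) mult.assoc)
qed

section \<open>Positive parts that vanish on the boundary\<close>

lemma locally_integrable_if_square_integrable:
  fixes G :: "real^'n::finite \<Rightarrow> 'b::euclidean_space"
  assumes "G \<in> borel_measurable lebesgue" "integrable lebesgue (\<lambda>x. (norm (G x))\<^sup>2)"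
  shows "locally_integrable_on G U"
  unfolding locally_integrable_on_def set_integrable_def
proof (intro allI impI)
  fix K :: "(real^'n) set" assume "compact K \<and> K \<subseteq> U"
  then have K: "K \<in> lmeasurable"
    using lmeasurable_compact by blast
  show "integrable lebesgue (\<lambda>x. indicator K x *\<^sub>R G x)"
  proof (rule Bochner_Integration.integrable_bound)
    show "integrable lebesgue (\<lambda>x. indicator K x + (norm (G x))\<^sup>2)"
      using K assms(2) by (intro Bochner_Integration.integrable_add integrable_real_indicator) (auto simp: fmeasurable_def)
    show "(\<lambda>x. indicator K x *\<^sub>R G x) \<in> borel_measurable lebesgue"
      using K assms(1) by (intro borel_measurable_scaleR borel_measurable_indicator) auto
    have "norm (indicator K x *\<^sub>R G x) \<le> norm (indicator K x + (norm (G x))\<^sup>2)" for x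
    proof (cases "x \<in> K")
      case True
      have "0 \<le> (norm (G x) - 1)\<^sup>2" by simp
      then have "2 * norm (G x) \<le> 1 + (norm (G x))\<^sup>2"
        by (simp add: power2_eq_square algebra_simps)
      then have "norm (G x) \<le> 1 + (norm (G x))\<^sup>2"
        using norm_ge_zero[of "G x"] by linarith
      then show ?thesis using True by simp
    qed simp
    then show "AE x in lebesgue. norm (indicator K x *\<^sub>R G x) \<le> norm (indicator K x + (norm (G x))\<^sup>2)"
      by (rule AE_I2)
  qed
qed

lemma square_integrable_onI:
  fixes G :: "real^'n::finite \<Rightarrow> 'b::euclidean_space"
  assumes "G \<in> borel_measurable lebesgue" "integrable lebesgue (\<lambda>x. (norm (G x))\<^sup>2)" "A \<in> sets lebesgue"
  shows "square_integrable_on G A"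
  unfolding square_integrable_on_def set_integrable_def
  by (intro conjI measurable_restrict_space1 integrable_mult_indicator assms)

text \<open>
  Compactness of the superlevel sets expresses that the positive part of \<open>w\<close> vanishes on the
  boundary of \<open>A\<close>, in the form in which it is used: \<open>trunc e \<circ> w\<close> has compact support in \<open>A\<close>.
\<close>

locale vanishing_C2 =
  fixes A :: "(real^'n::finite) set" and w :: "real^'n \<Rightarrow> real" and M :: real
  assumes open_A: "open A" and bounded_A: "bounded A" and C2: "Ck_on 2 A w"
    and compact_superlevel: "\<And>e. e > 0 \<Longrightarrow> compact {x \<in> A. w x \<ge> e}"
    and laplacian_bound: "AE x in lebesgue. x \<in> A \<longrightarrow> \<bar>laplacian w x\<bar> \<le> M"
begin

lemma C1: "Ck_on 1 A w"
  using C2 by (rule Ck_on_2_imp_1)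

lemma cont: "continuous_on A w"
  using C1 by (rule Ck_on_continuous)

lemma bounded_above:
  obtains B where "B \<ge> 0" "\<And>x. 0 \<le> pos_part A w x" "\<And>x. pos_part A w x \<le> B"
proof -
  have "bounded (w ` {x \<in> A. w x \<ge> 1})"
    using compact_superlevel[of 1]
    by (intro compact_imp_bounded compact_continuous_image continuous_on_subset[OF cont]) auto
  then obtain B where B: "\<And>x. x \<in> A \<Longrightarrow> w x \<ge> 1 \<Longrightarrow> \<bar>w x\<bar> \<le> B"
    by (auto simp: bounded_iff)
  \<comment> \<open>On the set where \<open>w < 1\<close> the positive part is at most \<open>1\<close>.\<close>
  show thesis
  proof (rule that[of "max B 1"])
    fix x
    show "0 \<le> pos_part A w x"
      by (cases "x \<in> A") (auto simp: pos_part_eq_max pos_part_outside)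
    show "pos_part A w x \<le> max B 1"
      using B[of x] by (cases "x \<in> A"; cases "w x \<ge> 1") (auto simp: pos_part_eq_max pos_part_outside)
  qed auto
qed

lemma pos_part_measurable: "pos_part A w \<in> borel_measurable lebesgue"
proof -
  have "continuous_on (pos_set A w) w"
    by (rule continuous_on_subset[OF cont]) (auto simp: pos_set_def)
  from measurable_continuous_indicator[OF pos_set_open[OF open_A cont] this]
  show ?thesis unfolding pos_part_def[abs_def] by simp
qed

lemma pos_grad_measurable: "pos_grad A w \<in> borel_measurable lebesgue"
proof -
  have "continuous_on (pos_set A w) (grad w)"
    by (rule continuous_on_subset[OF grad_continuous[OF C1]]) (auto simp: pos_set_def)
  from measurable_continuous_indicator[OF pos_set_open[OF open_A cont] this]
  show ?thesis unfolding pos_grad_def[abs_def] .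
qed

lemma A_lebesgue: "A \<in> sets lebesgue"
  using borel_open[OF open_A] by (intro sets_completionI_sets) simp

text \<open>
  The right-hand sides in \<open>trunc_energy\<close> converge, with \<open>h\<close> a Laplacian.
\<close>

lemma pos_part_mult_integrable:
  assumes h: "continuous_on A h" and N: "AE x in lebesgue. x \<in> A \<longrightarrow> \<bar>h x\<bar> \<le> N"
  shows "integrable lebesgue (\<lambda>x. pos_part A w x * h x)"
    and "(\<lambda>n. LINT x:A|lebesgue. trunc (eps n) (w x) * h x) \<longlonglongrightarrow> (LINT x|lebesgue. pos_part A w x * h x)"
proof -
  obtain B where B: "B \<ge> 0" "\<And>x. 0 \<le> pos_part A w x" "\<And>x. pos_part A w x \<le> B"
    by (rule bounded_above) (rule that)
  have mh: "(\<lambda>x. indicator A x *\<^sub>R h x) \<in> borel_measurable lebesgue"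
    using measurable_continuous_indicator[OF open_A h] .
  have "(\<lambda>x. pos_part A w x * (indicator A x *\<^sub>R h x)) \<in> borel_measurable lebesgue"
    by (rule borel_measurable_times[OF pos_part_measurable mh])
  moreover have "pos_part A w x * (indicator A x *\<^sub>R h x) = pos_part A w x * h x" for x
    by (cases "x \<in> A") (auto simp: pos_part_outside)
  ultimately have m: "(\<lambda>x. pos_part A w x * h x) \<in> borel_measurable lebesgue" by (simp only:)
  have ib: "integrable lebesgue (\<lambda>x. indicator A x * (B * N))"
    by (rule integrable_indicator_bounded_open[OF open_A bounded_A])
  have bound: "AE x in lebesgue. pos_part A w x * \<bar>h x\<bar> \<le> indicator A x * (B * N)"
    using N
  proof eventually_elim
    case (elim x)
    show ?case
    proof (cases "x \<in> A")
      case True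
      then show ?thesis using elim B by (auto intro!: mult_mono)
    qed (simp add: pos_part_outside)
  qed
  show "integrable lebesgue (\<lambda>x. pos_part A w x * h x)"
  proof (rule Bochner_Integration.integrable_bound[OF ib m])
    show "AE x in lebesgue. norm (pos_part A w x * h x) \<le> norm (indicator A x * (B * N))"
      using bound
    proof eventually_elim
      case (elim x)
      have "norm (pos_part A w x * h x) = pos_part A w x * \<bar>h x\<bar>"
        using B(2)[of x] by (simp add: abs_mult)
      also have "\<dots> \<le> norm (indicator A x * (B * N))"
        using elim unfolding real_norm_def by (rule order_trans[OF _ abs_ge_self])
      finally show ?case .
    qed
  qed
  then show "(\<lambda>n. LINT x:A|lebesgue. trunc (eps n) (w x) * h x) \<longlonglongrightarrow> (LINT x|lebesgue. pos_part A w x * h x)"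
  proof (rule weighted_set_integral_tendsto)
    show "set_integrable lebesgue A (\<lambda>x. trunc (eps n) (w x) * h x)" for n
    proof (rule set_integrable_compact_support[OF _ compact_superlevel[OF eps_pos[of n]]])
      show "continuous_on A (\<lambda>x. trunc (eps n) (w x) * h x)"
        by (intro continuous_on_mult h continuous_on_compose2[OF continuous_trunc[OF eps_pos] cont]) auto
    qed (auto simp: trunc_eq_0)
  qed (use trunc_bounds[OF eps_pos] in \<open>auto simp: pos_part_eq_max trunc_pos_lim\<close>)
qed

text \<open>
  Monotone convergence in \<open>trunc_energy\<close> with \<open>p = w\<close> yields at once the integrability of
  the squared gradient and the energy identity.
\<close>

lemma pos_grad_energy:
  shows "integrable lebesgue (\<lambda>x. (norm (pos_grad A w x))\<^sup>2)"
    and "(LINT x|lebesgue. (norm (pos_grad A w x))\<^sup>2) = - (LINT x|lebesgue. pos_part A w x * laplacian w x)"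
proof -
  let ?f = "\<lambda>n x. indicator A x *\<^sub>R (trunc_deriv (eps n) (w x) * (grad w x \<bullet> grad w x))"
  note en = trunc_energy[OF open_A C1 C2 eps_pos compact_superlevel[OF eps_pos]]
  have i: "integrable lebesgue (?f n)" for n
    using en(2)[of n] unfolding set_integrable_def .
  have mono: "AE x in lebesgue. mono (\<lambda>n. ?f n x)"
    by (rule AE_I2) (auto simp: mono_def intro!: mult_left_mono mult_right_mono trunc_deriv_antimono
        eps_pos eps_antimono)
  have lim: "AE x in lebesgue. (\<lambda>n. ?f n x) \<longlonglongrightarrow> (norm (pos_grad A w x))\<^sup>2"
  proof (rule AE_I2)
    fix x
    have eq: "(norm (pos_grad A w x))\<^sup>2 = indicator (pos_set A w) x * (grad w x \<bullet> grad w x)"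
      by (simp add: pos_grad_def power2_norm_eq_inner split: split_indicator)
    show "(\<lambda>n. ?f n x) \<longlonglongrightarrow> (norm (pos_grad A w x))\<^sup>2"
      unfolding eq using tendsto_mult_right[OF trunc_deriv_pos_lim[of A x w], of "grad w x \<bullet> grad w x"]
      by (simp add: mult.assoc)
  qed
  have "(\<lambda>n. - (LINT x:A|lebesgue. trunc (eps n) (w x) * laplacian w x)) \<longlonglongrightarrow>
      - (LINT x|lebesgue. pos_part A w x * laplacian w x)"
    by (rule tendsto_minus[OF pos_part_mult_integrable(2)[OF laplacian_continuous[OF C2] laplacian_bound]])
  then have ilim: "(\<lambda>n. integral\<^sup>L lebesgue (?f n)) \<longlonglongrightarrow> - (LINT x|lebesgue. pos_part A w x * laplacian w x)"
    unfolding en(1)[symmetric] unfolding set_lebesgue_integral_def .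
  have m: "(\<lambda>x. (norm (pos_grad A w x))\<^sup>2) \<in> borel_measurable lebesgue"
    using pos_grad_measurable by measurable
  show "integrable lebesgue (\<lambda>x. (norm (pos_grad A w x))\<^sup>2)"
    by (rule integrable_monotone_convergence[OF i mono lim ilim m])
  show "(LINT x|lebesgue. (norm (pos_grad A w x))\<^sup>2) = - (LINT x|lebesgue. pos_part A w x * laplacian w x)"
    by (rule integral_monotone_convergence[OF i mono lim ilim m])
qed

text \<open>
  The weak form of the equation for \<open>p\<close>, tested with the positive part of \<open>w\<close>.
\<close>

lemma pos_grad_inner_grad:
  assumes p: "Ck_on 2 A p" and N: "AE x in lebesgue. x \<in> A \<longrightarrow> \<bar>laplacian p x\<bar> \<le> N"
    and int: "integrable lebesgue (\<lambda>x. pos_grad A w x \<bullet> grad p x)"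
  shows "(LINT x|lebesgue. pos_grad A w x \<bullet> grad p x) = - (LINT x|lebesgue. pos_part A w x * laplacian p x)"
proof -
  let ?f = "\<lambda>n x. indicator A x *\<^sub>R (trunc_deriv (eps n) (w x) * (grad w x \<bullet> grad p x))"
  note en = trunc_energy[OF open_A C1 p eps_pos compact_superlevel[OF eps_pos]]
  have eq: "pos_grad A w x \<bullet> grad p x = indicator (pos_set A w) x * (grad w x \<bullet> grad p x)" for x
    by (simp add: pos_grad_def)
  have "(\<lambda>n. integral\<^sup>L lebesgue (?f n)) \<longlonglongrightarrow> (LINT x|lebesgue. pos_grad A w x \<bullet> grad p x)"
    unfolding eq set_lebesgue_integral_def[symmetric] using int[unfolded eq] en(2)
    by (rule weighted_set_integral_tendsto)
      (use trunc_deriv_bounds[OF eps_pos] in \<open>auto intro: trunc_deriv_le_pos_indicator eps_pos trunc_deriv_pos_lim\<close>)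
  moreover have "(\<lambda>n. - (LINT x:A|lebesgue. trunc (eps n) (w x) * laplacian p x)) \<longlonglongrightarrow>
      - (LINT x|lebesgue. pos_part A w x * laplacian p x)"
    by (rule tendsto_minus[OF pos_part_mult_integrable(2)[OF laplacian_continuous[OF p] N]])
  then have "(\<lambda>n. integral\<^sup>L lebesgue (?f n)) \<longlonglongrightarrow> - (LINT x|lebesgue. pos_part A w x * laplacian p x)"
    unfolding en(1)[symmetric] unfolding set_lebesgue_integral_def .
  ultimately show ?thesis by (rule LIMSEQ_unique)
qed

lemma pos_part_square_integrable: "integrable lebesgue (\<lambda>x. (norm (pos_part A w x))\<^sup>2)"
proof -
  obtain B where B: "B \<ge> 0" "\<And>x. 0 \<le> pos_part A w x" "\<And>x. pos_part A w x \<le> B"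
    by (rule bounded_above) (rule that)
  show ?thesis
  proof (rule Bochner_Integration.integrable_bound[OF integrable_indicator_bounded_open[OF open_A bounded_A, of "B\<^sup>2"]])
    show "(\<lambda>x. (norm (pos_part A w x))\<^sup>2) \<in> borel_measurable lebesgue"
      using pos_part_measurable by measurable
    have "norm ((norm (pos_part A w x))\<^sup>2) \<le> norm (indicator A x * B\<^sup>2)" for x
      using B(2,3)[of x] by (cases "x \<in> A") (auto simp: pos_part_outside intro!: power_mono)
    then show "AE x in lebesgue. norm ((norm (pos_part A w x))\<^sup>2) \<le> norm (indicator A x * B\<^sup>2)"
      by (rule AE_I2)
  qed
qed

lemma pos_part_weak_gradient:
  assumes "A \<subseteq> U"
  shows "has_weak_gradient U (pos_part A w) (pos_grad A w)"
proof (rule has_weak_gradient_pos_part[OF open_A assms C1])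
  show "closedin (top_of_set U) {x \<in> A. e \<le> w x}" if "e > 0" for e
    using compact_superlevel[OF that] assms by (intro closed_subset compact_imp_closed) auto
qed (intro locally_integrable_if_square_integrable pos_part_measurable pos_part_square_integrable
      pos_grad_measurable pos_grad_energy)+

lemma energy_integrable: "integrable lebesgue (\<lambda>x. (pos_part A w x)\<^sup>2 + (norm (pos_grad A w x))\<^sup>2)"
  using pos_part_square_integrable pos_grad_energy(1) by simp

lemma scaled_pos_part_weak_gradient:
  "has_weak_gradient A (\<lambda>x. c * pos_part A w x) (\<lambda>x. c *\<^sub>R pos_grad A w x)"
  using has_weak_gradient_lincomb[OF pos_part_weak_gradient[OF subset_refl] pos_part_weak_gradient[OF subset_refl], of c 0]
  by simp

lemma H1_norm_scaled_pos_part: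
  "H1_norm A (\<lambda>x. c * pos_part A w x) =
    \<bar>c\<bar> * sqrt (LINT x:A|lebesgue. (pos_part A w x)\<^sup>2 + (norm (pos_grad A w x))\<^sup>2)"
proof -
  have eq: "(c * pos_part A w x)\<^sup>2 + (norm (c *\<^sub>R pos_grad A w x))\<^sup>2 =
      c\<^sup>2 * ((pos_part A w x)\<^sup>2 + (norm (pos_grad A w x))\<^sup>2)" for x
    by (simp add: power_mult_distrib algebra_simps)
  have "set_integrable lebesgue A (\<lambda>x. (c * pos_part A w x)\<^sup>2 + (norm (c *\<^sub>R pos_grad A w x))\<^sup>2)"
    unfolding eq set_integrable_def
    by (intro integrable_mult_indicator A_lebesgue integrable_mult_right energy_integrable)
  from H1_norm_eq[OF open_A scaled_pos_part_weak_gradient this] show ?thesis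
    unfolding eq by (simp add: real_sqrt_mult)
qed

text \<open>
  The composition \<open>c * trunc e \<circ> w\<close> is of class \<open>C\<^sup>1\<close> with compact support in \<open>A\<close>, hence
  uniformly approximable by test functions together with its gradient.
\<close>

lemma test_function_near_trunc:
  obtains \<phi> where "\<phi> \<in> test_functions A"
    "\<And>x. x \<in> A \<Longrightarrow> \<bar>\<phi> x - c * trunc (eps n) (w x)\<bar> \<le> eps n"
    "\<And>x i. x \<in> A \<Longrightarrow> \<bar>partial i \<phi> x - c * trunc_deriv (eps n) (w x) * partial i w x\<bar> \<le> eps n"
proof -
  let ?K = "{x \<in> A. w x \<ge> eps n}"
  let ?g = "\<lambda>x. c * trunc (eps n) (w x)"
  have K: "compact ?K" "?K \<subseteq> A"
    using compact_superlevel[OF eps_pos] by auto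
  have d: "((\<lambda>s. c * trunc (eps n) s) has_real_derivative c * trunc_deriv (eps n) s) (at s)" for s
    by (rule DERIV_cmult[OF trunc_has_derivative[OF eps_pos]])
  have g: "Ck_on 1 A ?g"
    by (rule Ck_on_1_chain[OF C1 d]) (intro continuous_intros continuous_trunc_deriv eps_pos)
  have g0: "?g x = 0" if "x \<in> A" "x \<notin> ?K" for x
    using that by (simp add: trunc_eq_0)
  have z: "Ck_on 1 UNIV (zero_ext A ?g)" "partial i (zero_ext A ?g) = zero_ext A (partial i ?g)" for i
    by (rule zero_ext_C1[OF open_A K g]; rule g0; assumption)+
  have z0: "zero_ext A ?g x = 0" if "x \<notin> ?K" for x
    using g0 that by (auto simp: zero_ext_def)
  obtain \<phi> where \<phi>: "\<phi> \<in> test_functions A" "\<And>x. \<bar>\<phi> x - zero_ext A ?g x\<bar> \<le> eps n"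
    "\<And>i x. \<bar>partial i \<phi> x - partial i (zero_ext A ?g) x\<bar> \<le> eps n"
    by (rule test_function_C1_approximation[OF K(1) open_A K(2) eps_pos[of n] z(1)]) (rule z0, assumption, rule that)
  show thesis
  proof (rule that[OF \<phi>(1)])
    fix x assume x: "x \<in> A"
    show "\<bar>\<phi> x - c * trunc (eps n) (w x)\<bar> \<le> eps n"
      using \<phi>(2)[of x] x by (simp add: zero_ext_def)
    fix i
    have "w differentiable (at x)" using C1 x by (simp add: Ck_on_1_iff)
    from partial_chain[OF this d, of i]
    show "\<bar>partial i \<phi> x - c * trunc_deriv (eps n) (w x) * partial i w x\<bar> \<le> eps n"
      using \<phi>(3)[of i x] x unfolding z(2) by (simp add: zero_ext_def)
  qed
qed

text \<open>
  The test functions near the truncations converge in \<open>H\<^sup>1\<close>: the pointwise errors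
  \<open>d n\<close> and \<open>dg n\<close> of value and gradient tend to \<open>0\<close>, and they are dominated because \<open>A\<close> is bounded and
  the gradient of the positive part is square integrable.
\<close>

lemma scaled_pos_part_in_H10: "(\<lambda>x. c * pos_part A w x) \<in> H10 A"
proof -
  let ?u = "\<lambda>x. c * pos_part A w x"
  let ?g = "\<lambda>x. c *\<^sub>R pos_grad A w x"
  have "square_integrable_on ?u A"
  proof (rule square_integrable_onI[OF _ _ A_lebesgue])
    show "?u \<in> borel_measurable lebesgue" using pos_part_measurable by measurable
    show "integrable lebesgue (\<lambda>x. (norm (?u x))\<^sup>2)"
      using integrable_mult_right[OF pos_part_square_integrable, of "c\<^sup>2"] by (simp add: power_mult_distrib)
  qed
  moreover have "square_integrable_on ?g A"
  proof (rule square_integrable_onI[OF _ _ A_lebesgue])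
    show "?g \<in> borel_measurable lebesgue" using pos_grad_measurable by measurable
    show "integrable lebesgue (\<lambda>x. (norm (?g x))\<^sup>2)"
      using integrable_mult_right[OF pos_grad_energy(1), of "c\<^sup>2"] by (simp add: power_mult_distrib)
  qed
  ultimately have H1: "?u \<in> H1 A"
    unfolding H1_def using scaled_pos_part_weak_gradient by blast
  have "\<exists>\<phi>. \<phi> \<in> test_functions A \<and> (\<forall>x\<in>A. \<bar>\<phi> x - c * trunc (eps n) (w x)\<bar> \<le> eps n) \<and>
      (\<forall>x\<in>A. \<forall>i. \<bar>partial i \<phi> x - c * trunc_deriv (eps n) (w x) * partial i w x\<bar> \<le> eps n)" for n
    by (rule test_function_near_trunc[where c=c and n=n]) blast
  then obtain \<phi> where \<phi>: "\<And>n. \<phi> n \<in> test_functions A"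
    "\<And>n x. x \<in> A \<Longrightarrow> \<bar>\<phi> n x - c * trunc (eps n) (w x)\<bar> \<le> eps n"
    "\<And>n x i. x \<in> A \<Longrightarrow> \<bar>partial i (\<phi> n) x - c * trunc_deriv (eps n) (w x) * partial i w x\<bar> \<le> eps n"
    by metis
  have \<phi>1: "Ck_on 1 A (\<phi> n)" for n
  proof -
    have "Ck_on 1 UNIV (\<phi> n)"
      using \<phi>(1)[of n] by (simp add: test_functions_def del: Ck_on.simps)
    then show ?thesis by (rule Ck_on_subset) simp
  qed
  define d where "d n x = ?u x - \<phi> n x" for n x
  define dg where "dg n x = ?g x - grad (\<phi> n) x" for n x
  have wd: "has_weak_gradient A (d n) (dg n)" for n
    using has_weak_gradient_lincomb[OF scaled_pos_part_weak_gradient has_weak_gradient_C1[OF open_A \<phi>1], of 1 c "-1" n]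
    by (simp add: d_def[abs_def] dg_def[abs_def])
  let ?t = "\<lambda>n x. eps n + \<bar>c\<bar> * \<bar>pos_part A w x - trunc (eps n) (w x)\<bar>"
  let ?tg = "\<lambda>n x. real CARD('n) * eps n +
      \<bar>c\<bar> * (indicator (pos_set A w) x - trunc_deriv (eps n) (w x)) * norm (pos_grad A w x)"
  have d_le: "\<bar>d n x\<bar> \<le> ?t n x" if "x \<in> A" for n x
  proof -
    have "d n x = - (\<phi> n x - c * trunc (eps n) (w x)) + c * (pos_part A w x - trunc (eps n) (w x))"
      by (simp add: d_def algebra_simps)
    then have "\<bar>d n x\<bar> \<le> \<bar>\<phi> n x - c * trunc (eps n) (w x)\<bar> + \<bar>c * (pos_part A w x - trunc (eps n) (w x))\<bar>"
      by linarith
    then show ?thesis using \<phi>(2)[OF that, of n] by (simp add: abs_mult)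
  qed
  have td: "trunc_deriv (eps n) (w x) *\<^sub>R grad w x = trunc_deriv (eps n) (w x) *\<^sub>R pos_grad A w x"
    if "x \<in> A" for n x
    using that trunc_deriv_eq_0[OF eps_pos, of "w x" n] eps_pos[of n]
    by (cases "w x > 0") (auto simp: pos_grad_def pos_set_def split: split_indicator)
  have dg_le: "norm (dg n x) \<le> ?tg n x" if x: "x \<in> A" for n x
  proof -
    let ?r = "grad (\<phi> n) x - (c * trunc_deriv (eps n) (w x)) *\<^sub>R grad w x"
    have "norm ?r \<le> (\<Sum>i\<in>UNIV. \<bar>?r $ i\<bar>)" by (rule norm_le_l1_cart)
    also have "\<dots> \<le> (\<Sum>i\<in>(UNIV::'n set). eps n)"
      using \<phi>(3)[OF x] by (intro sum_mono) (simp add: grad_def)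
    finally have r: "norm ?r \<le> real CARD('n) * eps n" by simp
    let ?a = "indicator (pos_set A w) x - trunc_deriv (eps n) (w x)"
    let ?t = "c * trunc_deriv (eps n) (w x)"
    have e1: "?t *\<^sub>R grad w x = ?t *\<^sub>R pos_grad A w x"
      using td[OF x, of n] unfolding scaleR_scaleR[symmetric] by (simp only:)
    have e2: "?g x = (c * indicator (pos_set A w) x) *\<^sub>R pos_grad A w x"
      by (simp add: pos_grad_def split: split_indicator)
    have "dg n x = - (grad (\<phi> n) x - ?t *\<^sub>R pos_grad A w x) + (c * ?a) *\<^sub>R pos_grad A w x"
      unfolding dg_def e2 by (simp add: algebra_simps)
    then have "dg n x = - ?r + (c * ?a) *\<^sub>R pos_grad A w x"
      unfolding e1 .
    then have "norm (dg n x) \<le> norm ?r + norm ((c * ?a) *\<^sub>R pos_grad A w x)"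
      by (metis norm_minus_cancel norm_triangle_ineq)
    moreover have "?a \<ge> 0"
      using trunc_deriv_le_pos_indicator[OF eps_pos x, of n w] by simp
    ultimately show ?thesis using r by (simp add: abs_mult)
  qed
  obtain B where B: "B \<ge> 0" "\<And>x. 0 \<le> pos_part A w x" "\<And>x. pos_part A w x \<le> B"
    by (rule bounded_above) (rule that)
  have eps1: "eps n \<le> 1" for n
    by (simp add: eps_def)
  \<comment> \<open>The bounds of \<open>d\<close> and \<open>dg\<close> by \<open>?C\<close> and by \<open>?N + |c| |pos_grad|\<close> come from \<open>eps n \<le> 1\<close>.\<close>
  let ?C = "1 + \<bar>c\<bar> * B"
  let ?N = "real CARD('n)"
  let ?F = "\<lambda>n x. (d n x)\<^sup>2 + (norm (dg n x))\<^sup>2"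
  let ?bd = "\<lambda>x. indicator A x * (?C\<^sup>2 + 2 * ?N\<^sup>2) + 2 * c\<^sup>2 * (norm (pos_grad A w x))\<^sup>2"
  have F_meas: "(\<lambda>x. indicator A x *\<^sub>R ?F n x) \<in> borel_measurable lebesgue" for n
  proof -
    have "(\<lambda>x. indicator A x *\<^sub>R \<phi> n x) \<in> borel_measurable lebesgue"
      "(\<lambda>x. indicator A x *\<^sub>R grad (\<phi> n) x) \<in> borel_measurable lebesgue"
      by (intro measurable_continuous_indicator open_A Ck_on_continuous[OF \<phi>1] grad_continuous \<phi>1)+
    then have "(\<lambda>x. (?u x - indicator A x *\<^sub>R \<phi> n x)\<^sup>2 + (norm (?g x - indicator A x *\<^sub>R grad (\<phi> n) x))\<^sup>2)
        \<in> borel_measurable lebesgue"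
      using pos_part_measurable pos_grad_measurable by measurable
    moreover have "(?u x - indicator A x *\<^sub>R \<phi> n x)\<^sup>2 + (norm (?g x - indicator A x *\<^sub>R grad (\<phi> n) x))\<^sup>2 =
        indicator A x *\<^sub>R ?F n x" for x
      by (cases "x \<in> A") (auto simp: d_def dg_def pos_part_outside pos_grad_def pos_set_def)
    ultimately show ?thesis by (simp only:)
  qed
  have F_le: "norm (indicator A x *\<^sub>R ?F n x) \<le> ?bd x" for n x
  proof (cases "x \<in> A")
    case True
    have "\<bar>pos_part A w x - trunc (eps n) (w x)\<bar> \<le> B"
      using B(2,3)[of x] trunc_bounds[OF eps_pos, of n "w x"] True by (auto simp: pos_part_eq_max)
    then have "\<bar>c\<bar> * \<bar>pos_part A w x - trunc (eps n) (w x)\<bar> \<le> \<bar>c\<bar> * B"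
      by (intro mult_left_mono) auto
    then have "\<bar>d n x\<bar> \<le> ?C"
      using d_le[OF True, of n] eps1[of n] by linarith
    then have 1: "(d n x)\<^sup>2 \<le> ?C\<^sup>2"
      using power_mono[of "\<bar>d n x\<bar>" ?C 2] by simp
    let ?a = "indicator (pos_set A w) x - trunc_deriv (eps n) (w x)"
    have a: "0 \<le> ?a" "?a \<le> 1"
      using trunc_deriv_le_pos_indicator[OF eps_pos True, of n w] trunc_deriv_bounds[OF eps_pos, of n "w x"]
      by (auto split: split_indicator)
    have "\<bar>c\<bar> * ?a * norm (pos_grad A w x) \<le> \<bar>c\<bar> * 1 * norm (pos_grad A w x)"
      using a by (intro mult_right_mono mult_left_mono) auto
    moreover have "?N * eps n \<le> ?N * 1"
      using eps1 by (intro mult_left_mono) auto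
    ultimately have "norm (dg n x) \<le> ?N + \<bar>c\<bar> * norm (pos_grad A w x)"
      using dg_le[OF True, of n] by linarith
    then have "(norm (dg n x))\<^sup>2 \<le> (?N + \<bar>c\<bar> * norm (pos_grad A w x))\<^sup>2"
      by (intro power_mono) auto
    also have "\<dots> \<le> 2 * ?N\<^sup>2 + 2 * (\<bar>c\<bar> * norm (pos_grad A w x))\<^sup>2"
      using zero_le_power2[of "?N - \<bar>c\<bar> * norm (pos_grad A w x)"] by (simp add: power2_sum power2_diff)
    finally show ?thesis
      using 1 True by (simp add: power_mult_distrib)
  qed simp
  have bd_int: "integrable lebesgue ?bd"
    by (intro Bochner_Integration.integrable_add integrable_mult_right pos_grad_energy(1)
        integrable_indicator_bounded_open open_A bounded_A)
  have F_lim: "(\<lambda>n. indicator A x *\<^sub>R ?F n x) \<longlonglongrightarrow> 0" for x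
  proof (cases "x \<in> A")
    case True
    have t: "(\<lambda>n. trunc (eps n) (w x)) \<longlonglongrightarrow> pos_part A w x"
      "(\<lambda>n. trunc_deriv (eps n) (w x)) \<longlonglongrightarrow> indicator (pos_set A w) x"
      using trunc_pos_lim[of A x w] trunc_deriv_pos_lim[of A x w] True by auto
    have "(\<lambda>n. ?t n x) \<longlonglongrightarrow> 0 + \<bar>c\<bar> * \<bar>pos_part A w x - pos_part A w x\<bar>"
      by (intro tendsto_intros eps_lim t)
    then have "(\<lambda>n. ?t n x) \<longlonglongrightarrow> 0" by simp
    then have "(\<lambda>n. d n x) \<longlonglongrightarrow> 0"
      by (rule Lim_null_comparison[rotated])
        (intro always_eventually allI, use d_le[OF True] in \<open>simp only: real_norm_def\<close>)
    moreover have "(\<lambda>n. ?tg n x) \<longlonglongrightarrow> ?N * 0 +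
        \<bar>c\<bar> * (indicator (pos_set A w) x - indicator (pos_set A w) x) * norm (pos_grad A w x)"
      by (intro tendsto_intros eps_lim t)
    then have "(\<lambda>n. ?tg n x) \<longlonglongrightarrow> 0" by simp
    then have "(\<lambda>n. norm (dg n x)) \<longlonglongrightarrow> 0"
      by (rule Lim_null_comparison[rotated])
        (intro always_eventually allI, use dg_le[OF True] in \<open>simp only: real_norm_def abs_norm_cancel\<close>)
    ultimately have "(\<lambda>n. ?F n x) \<longlonglongrightarrow> 0\<^sup>2 + 0\<^sup>2"
      by (intro tendsto_intros)
    then show ?thesis using True by simp
  qed simp
  have F_int: "set_integrable lebesgue A (?F n)" for n
    unfolding set_integrable_def
  proof (rule Bochner_Integration.integrable_bound[OF bd_int F_meas])
    have "norm (indicator A x *\<^sub>R ?F n x) \<le> norm (?bd x)" for x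
      by (rule order_trans[OF F_le]) (simp only: real_norm_def abs_ge_self)
    then show "AE x in lebesgue. norm (indicator A x *\<^sub>R ?F n x) \<le> norm (?bd x)"
      by (rule AE_I2)
  qed
  have "(\<lambda>n. LINT x:A|lebesgue. ?F n x) \<longlonglongrightarrow> integral\<^sup>L lebesgue (\<lambda>x::real^'n. 0::real)"
    unfolding set_lebesgue_integral_def
  proof (rule integral_dominated_convergence[OF _ _ bd_int])
    show "(\<lambda>x. indicator A x *\<^sub>R ?F n x) \<in> borel_measurable lebesgue" for n
      by (rule F_meas)
    show "AE x in lebesgue. (\<lambda>n. indicator A x *\<^sub>R ?F n x) \<longlonglongrightarrow> 0"
      by (rule AE_I2) (rule F_lim)
    show "AE x in lebesgue. norm (indicator A x *\<^sub>R ?F n x) \<le> ?bd x" for n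
      by (rule AE_I2) (rule F_le)
  qed simp
  from tendsto_real_sqrt[OF this]
  have "(\<lambda>n. sqrt (LINT x:A|lebesgue. ?F n x)) \<longlonglongrightarrow> 0" by simp
  then have "(\<lambda>n. H1_norm A (d n)) \<longlonglongrightarrow> 0"
    using H1_norm_eq[OF open_A wd F_int] by simp
  then show ?thesis
    unfolding H10_def using H1 \<phi>(1) by (auto simp: d_def[abs_def])
qed

end

text \<open>
  The energies of the positive parts of \<open>u\<close> and of \<open>- u\<close> are finite. Their gradients add up to the
  gradient of \<open>u\<close> only off the zero set of \<open>u\<close>; uniqueness of the weak gradient shows that \<open>grad u\<close>
  vanishes almost everywhere on that set.
\<close>

lemma vanishing_C2_grad_square_integrable:
  fixes u :: "real^'n::finite \<Rightarrow> real"
  assumes "vanishing_C2 A u M" "vanishing_C2 A (\<lambda>x. - u x) M"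
  shows "set_integrable lebesgue A (\<lambda>x. (norm (grad u x))\<^sup>2)"
proof -
  interpret p: vanishing_C2 A u M by fact
  interpret m: vanishing_C2 A "\<lambda>x. - u x" M by fact
  let ?m = "\<lambda>x. - u x"
  let ?G = "\<lambda>x. 1 *\<^sub>R pos_grad A u x + (-1) *\<^sub>R pos_grad A ?m x"
  let ?u = "\<lambda>x. 1 * pos_part A u x + (-1) * pos_part A ?m x"
  have weak: "has_weak_gradient A ?u ?G"
    by (rule has_weak_gradient_lincomb[OF p.pos_part_weak_gradient m.pos_part_weak_gradient]) auto
  have u_eq: "u x = ?u x" if "x \<in> A" for x
    using that by (simp add: pos_part_eq_max)
  have "Ck_on 1 A ?u"
    by (rule Ck_on_cong_open[OF p.open_A p.C1 u_eq])
  then have "AE x in lebesgue. x \<in> A \<longrightarrow> grad ?u x = ?G x"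
    by (intro has_weak_gradient_unique[OF p.open_A has_weak_gradient_C1[OF p.open_A] weak])
  moreover have "grad ?u x = grad u x" if "x \<in> A" for x
    unfolding grad_def using partial_cong_open[OF p.open_A that u_eq] by simp
  ultimately have ae: "AE x in lebesgue. x \<in> A \<longrightarrow> grad u x = ?G x"
    by simp
  show ?thesis
    unfolding set_integrable_def
  proof (rule Bochner_Integration.integrable_bound)
    show "integrable lebesgue (\<lambda>x. 2 * (norm (pos_grad A u x))\<^sup>2 + 2 * (norm (pos_grad A ?m x))\<^sup>2)"
      by (intro Bochner_Integration.integrable_add integrable_mult_right p.pos_grad_energy m.pos_grad_energy)
    show "(\<lambda>x. indicator A x *\<^sub>R (norm (grad u x))\<^sup>2) \<in> borel_measurable lebesgue"
      by (intro measurable_continuous_indicator p.open_A continuous_intros grad_continuous p.C1)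
    show "AE x in lebesgue. norm (indicator A x *\<^sub>R (norm (grad u x))\<^sup>2)
        \<le> norm (2 * (norm (pos_grad A u x))\<^sup>2 + 2 * (norm (pos_grad A ?m x))\<^sup>2)"
      using ae
    proof eventually_elim
      case (elim x)
      let ?a = "norm (pos_grad A u x)" and ?b = "norm (pos_grad A ?m x)"
      show ?case
      proof (cases "x \<in> A")
        case True
        then have "norm (grad u x) \<le> ?a + ?b"
          using elim norm_triangle_ineq4[of "pos_grad A u x" "pos_grad A ?m x"] by simp
        then have "(norm (grad u x))\<^sup>2 \<le> (?a + ?b)\<^sup>2"
          by (intro power_mono) auto
        also have "\<dots> \<le> 2 * ?a\<^sup>2 + 2 * ?b\<^sup>2"
          using zero_le_power2[of "?a - ?b"] by (simp add: power2_sum power2_diff)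
        finally show ?thesis using True by simp
      qed simp
    qed
  qed
qed

section \<open>Caratheodory functions and their primitives\<close>

text \<open>
  Rounding the second argument down to a multiple of \<open>1 / (n + 1)\<close> leaves countably many values of it,
  for which measurability in the first argument suffices; continuity gives the limit.
\<close>

lemma caratheodory_joint_measurable:
  fixes g :: "'a \<Rightarrow> real \<Rightarrow> real"
  assumes m: "\<And>s. (\<lambda>x. g x s) \<in> borel_measurable M" and c: "\<And>x. continuous_on UNIV (g x)"
  shows "(\<lambda>p. g (fst p) (snd p)) \<in> borel_measurable (M \<Otimes>\<^sub>M borel)"
proof (rule borel_measurable_LIMSEQ_real)
  let ?q = "\<lambda>n s. of_int \<lfloor>s * real (Suc n)\<rfloor> / real (Suc n) :: real"
  have lim: "(\<lambda>n. ?q n s) \<longlonglongrightarrow> s" for s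
  proof (rule LIMSEQ_I)
    fix e :: real assume "e > 0"
    then obtain N where N: "inverse (real (Suc N)) < e"
      using reals_Archimedean by blast
    have "\<bar>?q n s - s\<bar> < e" if "n \<ge> N" for n
    proof -
      have "?q n s - s = (of_int \<lfloor>s * real (Suc n)\<rfloor> - s * real (Suc n)) / real (Suc n)"
        by (simp add: diff_divide_distrib del: of_nat_Suc)
      moreover have "\<bar>of_int \<lfloor>s * real (Suc n)\<rfloor> - s * real (Suc n)\<bar> \<le> 1" by linarith
      ultimately have "\<bar>?q n s - s\<bar> \<le> inverse (real (Suc n))"
        by (simp add: abs_divide divide_right_mono inverse_eq_divide del: of_nat_Suc)
      also have "\<dots> \<le> inverse (real (Suc N))"
        using that by (intro le_imp_inverse_le) auto
      finally show ?thesis using N by linarith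
    qed
    then show "\<exists>N. \<forall>n\<ge>N. norm (?q n s - s) < e" by auto
  qed
  show "(\<lambda>n. g (fst p) (?q n (snd p))) \<longlonglongrightarrow> g (fst p) (snd p)" for p
    using c[of "fst p"] lim[of "snd p"]
    by (intro isCont_tendsto_compose[where g="g (fst p)"]) (auto simp: continuous_on_eq_continuous_at)
  show "(\<lambda>p. g (fst p) (?q n (snd p))) \<in> borel_measurable (M \<Otimes>\<^sub>M borel)" for n
  proof (rule measurable_compose_countable[where f="\<lambda>z p. g (fst p) (of_int z / real (Suc n))"
        and g="\<lambda>p. \<lfloor>snd p * real (Suc n)\<rfloor>"])
    show "(\<lambda>p. g (fst p) (of_int z / real (Suc n))) \<in> borel_measurable (M \<Otimes>\<^sub>M borel)" for z :: int
      by (rule measurable_compose[OF measurable_fst m])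
    show "(\<lambda>p. \<lfloor>snd p * real (Suc n)\<rfloor>) \<in> M \<Otimes>\<^sub>M borel \<rightarrow>\<^sub>M count_space UNIV"
      by measurable
  qed
qed

text \<open>
  The oriented integral is written as an integral over the whole line of a jointly measurable
  function.
\<close>

lemma primitive_measurable:
  fixes g :: "'a \<Rightarrow> real \<Rightarrow> real" and h :: "'a \<Rightarrow> real"
  assumes m: "\<And>s. (\<lambda>x. g x s) \<in> borel_measurable M" and c: "\<And>x. continuous_on UNIV (g x)"
    and h[measurable]: "h \<in> borel_measurable M"
  shows "(\<lambda>x. LBINT s=0..h x. g x s) \<in> borel_measurable M"
proof -
  have [measurable]: "(\<lambda>p. g (fst p) (snd p)) \<in> borel_measurable (M \<Otimes>\<^sub>M lborel)"
    using caratheodory_joint_measurable[OF m c] measurable_cong_sets[OF sets_pair_measure_cong[OF refl sets_lborel] refl] by blast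
  let ?i = "\<lambda>p. if 0 \<le> h (fst p) then (if 0 < snd p \<and> snd p < h (fst p) then g (fst p) (snd p) else 0)
     else (if h (fst p) < snd p \<and> snd p < 0 then - g (fst p) (snd p) else 0)"
  have "?i \<in> borel_measurable (M \<Otimes>\<^sub>M lborel)"
    by measurable
  then have "(\<lambda>x. \<integral>s. ?i (x, s) \<partial>lborel) \<in> borel_measurable M"
    by (intro lborel.borel_measurable_lebesgue_integral) (simp add: case_prod_unfold)
  moreover have "(LBINT s=0..h x. g x s) = (\<integral>s. ?i (x, s) \<partial>lborel)" for x
  proof (cases "0 \<le> h x")
    case True
    then show ?thesis
      unfolding interval_lebesgue_integral_def set_lebesgue_integral_def zero_ereal_def
      by (auto intro!: Bochner_Integration.integral_cong split: split_indicator)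
  next
    case False
    then show ?thesis
      unfolding interval_lebesgue_integral_def set_lebesgue_integral_def zero_ereal_def
      by (auto intro!: Bochner_Integration.integral_cong simp: Bochner_Integration.integral_minus[symmetric]
          simp del: Bochner_Integration.integral_minus split: split_indicator)
  qed
  ultimately show ?thesis by simp
qed

lemma primitive_has_derivative:
  fixes g :: "real \<Rightarrow> real"
  assumes "continuous_on UNIV g"
  shows "((\<lambda>t. LBINT s=0..t. g s) has_real_derivative g t) (at t)"
proof -
  let ?a = "- \<bar>t\<bar> - 1" and ?b = "\<bar>t\<bar> + 1"
  have "((\<lambda>u. LBINT s=ereal 0..u. g s) has_vector_derivative g t) (at t within {?a..?b})"
    by (rule interval_integral_FTC2) (use assms in \<open>auto intro: continuous_on_subset\<close>)
  moreover have "at t within {?a..?b} = at t"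
    by (rule at_within_interior) auto
  ultimately show ?thesis
    by (simp add: has_real_derivative_iff_has_vector_derivative zero_ereal_def)
qed

lemma primitive_bound:
  fixes g :: "real \<Rightarrow> real" and t :: real
  assumes c: "continuous_on UNIV g" and b: "\<And>s. \<bar>s\<bar> \<le> R \<Longrightarrow> \<bar>g s\<bar> \<le> Q" and t: "\<bar>t\<bar> \<le> R"
  shows "\<bar>LBINT s=0..t. g s\<bar> \<le> Q * R"
proof -
  let ?G = "\<lambda>t::real. LBINT s=0..t. g s"
  have "norm (?G t - ?G 0) \<le> Q * norm (t - 0)"
  proof (rule field_differentiable_bound[of "{-R..R}" ?G g])
    show "(?G has_field_derivative g z) (at z within {-R..R})" if "z \<in> {-R..R}" for z
      using primitive_has_derivative[OF c] by (rule has_field_derivative_at_within)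
  qed (use b t in auto)
  then have "\<bar>?G t\<bar> \<le> Q * \<bar>t\<bar>" by (simp add: zero_ereal_def)
  also have "\<dots> \<le> Q * R"
  proof (rule mult_left_mono[OF t])
    show "0 \<le> Q" using b[of t] t by linarith
  qed
  finally show ?thesis .
qed

text \<open>
  The difference of the two sides, as a function \<open>K\<close> of \<open>t\<close>, vanishes at \<open>0\<close>. Its derivative is \<open>d\<close>
  times the amount by which the chord of \<open>g\<close> over \<open>[a - d, a]\<close> exceeds \<open>g\<close> at \<open>a - t d\<close>.
\<close>

lemma primitive_convex_gap:
  fixes g :: "real \<Rightarrow> real"
  assumes c: "continuous_on UNIV g" and d: "d > 0" and t: "0 < t" "t \<le> 1"
  defines "G \<equiv> \<lambda>t::real. LBINT s=0..t. g s"
  shows "convex_on {a - d..a} g \<Longrightarrow>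
      G a - G (a - t * d) \<le> t * g a * d - t\<^sup>2 / 2 * (g a - g (a - d)) * d"
    and "strictly_convex_on {a - d..a} g \<Longrightarrow>
      G a - G (a - t * d) < t * g a * d - t\<^sup>2 / 2 * (g a - g (a - d)) * d"
proof -
  define K where "K s = G (a - s * d) - G a + s * g a * d - s\<^sup>2 / 2 * (g a - g (a - d)) * d" for s
  have dG: "(G has_real_derivative g t) (at t)" for t
    unfolding G_def by (rule primitive_has_derivative[OF c])
  have dK: "(K has_real_derivative d * ((1 - s) * g a + s * g (a - d) - g (a - s * d))) (at s)" for s
    unfolding K_def[abs_def]
    by (auto intro!: derivative_eq_intros DERIV_chain2[OF dG] simp: field_simps power2_eq_square)
  have K0: "K 0 = 0" by (simp add: K_def)
  have mid: "(1 - s) * a + s * (a - d) = a - s * d" for s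
    by (simp add: algebra_simps)
  show "G a - G (a - t * d) \<le> t * g a * d - t\<^sup>2 / 2 * (g a - g (a - d)) * d"
    if cv: "convex_on {a - d..a} g"
  proof -
    have "K 0 \<le> K t"
    proof (rule DERIV_nonneg_imp_nondecreasing[of 0 t K])
      fix s assume s: "0 \<le> s" "s \<le> t"
      have "g ((1 - s) *\<^sub>R a + s *\<^sub>R (a - d)) \<le> (1 - s) * g a + s * g (a - d)"
        using s t d by (intro convex_onD[OF cv]) auto
      then have "0 \<le> d * ((1 - s) * g a + s * g (a - d) - g (a - s * d))"
        using d by (simp add: mid)
      then show "\<exists>y. (K has_real_derivative y) (at s) \<and> 0 \<le> y"
        using dK by blast
    qed (use t in auto)
    then show ?thesis unfolding K0 by (simp add: K_def)
  qed
  show "G a - G (a - t * d) < t * g a * d - t\<^sup>2 / 2 * (g a - g (a - d)) * d"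
    if cv: "strictly_convex_on {a - d..a} g"
  proof -
    have "K 0 < K t"
    proof (rule DERIV_pos_imp_increasing_open[of 0 t K])
      fix s assume s: "0 < s" "s < t"
      have "g ((1 - s) * a + s * (a - d)) < (1 - s) * g a + s * g (a - d)"
        using cv s t d unfolding strictly_convex_on_def by auto
      then have "0 < d * ((1 - s) * g a + s * g (a - d) - g (a - s * d))"
        using d by (simp add: mid)
      then show "\<exists>y. (K has_real_derivative y) (at s) \<and> 0 < y"
        using dK by blast
    next
      show "continuous_on {0..t} K"
        using dK by (intro DERIV_continuous_on) (auto intro: has_field_derivative_at_within)
    qed (use t in auto)
    then show ?thesis unfolding K0 by (simp add: K_def)
  qed
qed

section \<open>Reflection in a coordinate hyperplane\<close>

lemma reflect_reflect [simp]: "reflect k (reflect k x) = x"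
  by (simp add: reflect_def vec_eq_iff)

lemma bounded_linear_reflect: "bounded_linear (reflect k :: real^'n::finite \<Rightarrow> real^'n)"
  by (rule linear_conv_bounded_linear[THEN iffD1], rule linearI)
    (auto simp: reflect_def vec_eq_iff)

lemma continuous_on_reflect: "continuous_on S (reflect k)"
  using bounded_linear_reflect by (rule linear_continuous_on)

lemma partial_reflect:
  assumes "f differentiable (at (reflect k x))"
  shows "partial i (\<lambda>x. f (reflect k x)) x = (if i = k then - 1 else 1) * partial i f (reflect k x)"
proof -
  let ?f' = "frechet_derivative f (at (reflect k x))"
  have f': "(f has_derivative ?f') (at (reflect k x))"
    using assms by (rule frechet_derivative_worksI)
  interpret f': bounded_linear ?f'
    using f' by (rule has_derivative_bounded_linear)
  have "reflect k (axis i 1) = (if i = k then - 1 else 1) *\<^sub>R axis i (1::real)"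
    by (auto simp: reflect_def vec_eq_iff axis_def)
  then show ?thesis
    using partial_eqI[OF has_derivative_compose[OF bounded_linear_imp_has_derivative[OF bounded_linear_reflect] f'], of i]
    by (simp add: partial_def linear_neg[OF f'.linear_axioms])
qed

lemma differentiable_reflect:
  assumes "f differentiable (at (reflect k x))"
  shows "(\<lambda>x. f (reflect k x)) differentiable (at x)"
  using has_derivative_compose[OF bounded_linear_imp_has_derivative[OF bounded_linear_reflect]
      frechet_derivative_worksI[OF assms]]
  unfolding differentiable_def by blast

lemma Ck_on_reflect:
  assumes A: "open A" "reflect k ` A = A"
  shows "Ck_on m A f \<Longrightarrow> Ck_on m A (\<lambda>x. f (reflect k x))"
proof (induction m arbitrary: f)
  case 0
  then show ?case
    using A(2) continuous_on_compose2[where t=A and g=f and f="reflect k" and s=A] continuous_on_reflect by auto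
next
  case (Suc m)
  have R: "reflect k x \<in> A" if "x \<in> A" for x using A(2) that by blast
  have "Ck_on m A (partial i (\<lambda>x. f (reflect k x)))" for i
  proof (rule Ck_on_cong_open[OF A(1)])
    show "Ck_on m A (\<lambda>x. (if i = k then - 1 else 1) * partial i f (reflect k x))"
      using Suc by (intro Ck_on_mult[OF A(1)] Ck_on_const) auto
  qed (use Suc.prems R in \<open>auto simp: partial_reflect\<close>)
  then show ?case
    using Suc.prems R by (auto intro: differentiable_reflect)
qed

text \<open>
  Differentiating twice in the reflected direction produces the factor \<open>(- 1)\<^sup>2\<close>.
\<close>

lemma laplacian_reflect:
  assumes A: "open A" "reflect k ` A = A" "x \<in> A" and f: "Ck_on 2 A f"
  shows "laplacian (\<lambda>x. f (reflect k x)) x = laplacian f (reflect k x)"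
proof -
  have R: "reflect k x \<in> A" if "x \<in> A" for x using A(2) that by blast
  have "partial i (partial i (\<lambda>x. f (reflect k x))) x = partial i (partial i f) (reflect k x)" for i
  proof -
    let ?c = "if i = k then - 1 else 1 :: real"
    have d: "f differentiable (at y)" "partial i f differentiable (at y)" if "y \<in> A" for y
      using f that by (auto simp: numeral_2_eq_2)
    have "partial i (partial i (\<lambda>x. f (reflect k x))) x = partial i (\<lambda>x. ?c * partial i f (reflect k x)) x"
      by (intro partial_cong_open[OF A(1,3)] partial_reflect d R)
    also have "\<dots> = ?c * partial i (\<lambda>x. partial i f (reflect k x)) x"
      by (subst partial_mult) (auto intro!: differentiable_reflect d R A(3) simp: partial_const)
    also have "\<dots> = ?c * (?c * partial i (partial i f) (reflect k x))"
      by (subst partial_reflect) (auto intro!: d R A(3))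
    finally show ?thesis by simp
  qed
  then show ?thesis by (simp add: laplacian_def)
qed

section \<open>The reflected boundary value problem\<close>

lemma AE_lebesgue_on_iff:
  assumes "open \<Omega>"
  shows "(AE x in lebesgue_on \<Omega>. P x) \<longleftrightarrow> (AE x in lebesgue. x \<in> \<Omega> \<longrightarrow> P x)"
  using borel_open[OF assms] by (subst AE_restrict_space_iff) (auto intro: sets_completionI_sets)

lemma compact_superlevel_set:
  fixes g :: "'a::euclidean_space \<Rightarrow> real"
  assumes "compact S" "continuous_on S g"
  shows "compact {x \<in> S. e \<le> g x}"
proof -
  have "closed {x \<in> S. e \<le> g x}"
    using assms by (intro continuous_on_closed_Collect_le continuous_intros) (auto intro: compact_imp_closed)
  moreover have "bounded {x \<in> S. e \<le> g x}"
    using compact_imp_bounded[OF assms(1)] by (rule bounded_subset) auto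
  ultimately show ?thesis by (simp add: compact_eq_bounded_closed)
qed

lemma open_null_set_empty:
  fixes S :: "'a::euclidean_space set"
  assumes "open S" "AE x in lebesgue. x \<notin> S"
  shows "S = {}"
proof -
  have "S \<in> sets lebesgue"
    using borel_open[OF assms(1)] by (intro sets_completionI_sets) simp
  then have "S \<in> null_sets lebesgue"
    using assms(2) AE_iff_null_sets[of S lebesgue] by blast
  then show ?thesis
    using assms(1) open_not_negligible[of S] by (auto simp: negligible_iff_null_sets)
qed

locale symmetric_problem =
  fixes \<Omega> :: "(real^'n::finite) set" and k :: 'n and f :: "real^'n \<Rightarrow> real \<Rightarrow> real"
    and u0 :: "real^'n \<Rightarrow> real" and C r :: real
  assumes open_dom: "open \<Omega>" and bounded_dom: "bounded \<Omega>"
    and symmetric: "reflect k ` \<Omega> = \<Omega>"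
    and carath: "caratheodory \<Omega> f"
    and even_f: "\<And>x t. x \<in> \<Omega> \<Longrightarrow> f (reflect k x) t = f x t"
    and solution: "classical_solution \<Omega> f u0"
    and C: "C > 0" and r: "r > 1"
    and growth: "AE x in lebesgue_on \<Omega>. \<forall>t. \<bar>f x t\<bar> \<le> C * (\<bar>t\<bar> powr (r - 1) + 1)"
begin

abbreviation w :: "real^'n \<Rightarrow> real" where
  "w \<equiv> \<lambda>x. u0 x - u0 (reflect k x)"

lemma u0_C2: "Ck_on 2 \<Omega> u0" and u0_cont: "continuous_on (closure \<Omega>) u0"
  and u0_equation: "x \<in> \<Omega> \<Longrightarrow> laplacian u0 x = - f x (u0 x)"
  and u0_frontier: "x \<in> frontier \<Omega> \<Longrightarrow> u0 x = 0"
  using solution by (auto simp: classical_solution_def simp del: Ck_on.simps)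

lemma compact_closure_dom: "compact (closure \<Omega>)"
  using bounded_dom by (simp add: compact_closure)

lemma dom_lebesgue: "\<Omega> \<in> sets lebesgue"
  using borel_open[OF open_dom] by (intro sets_completionI_sets) simp

lemma reflect_dom: "x \<in> \<Omega> \<Longrightarrow> reflect k x \<in> \<Omega>"
  using symmetric by blast

lemma reflect_closure: "x \<in> closure \<Omega> \<Longrightarrow> reflect k x \<in> closure \<Omega>"
  using image_closure_subset[OF continuous_on_reflect[of "closure \<Omega>" k] closed_closure, of \<Omega>]
    symmetric closure_subset[of \<Omega>] by blast

lemma reflect_frontier:
  assumes "x \<in> closure \<Omega>" "x \<notin> \<Omega>"
  shows "u0 x = 0" "u0 (reflect k x) = 0"
proof -
  have "reflect k x \<notin> \<Omega>"
    using assms(2) reflect_dom[of "reflect k x"] by auto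
  then show "u0 x = 0" "u0 (reflect k x) = 0"
    using assms reflect_closure[OF assms(1)] open_dom
    by (auto intro!: u0_frontier simp: frontier_def interior_open)
qed

lemma u0_bounded:
  obtains R where "R \<ge> 0" "\<And>x. x \<in> \<Omega> \<Longrightarrow> \<bar>u0 x\<bar> \<le> R"
proof -
  have "bounded (u0 ` closure \<Omega>)"
    by (intro compact_imp_bounded compact_continuous_image u0_cont compact_closure_dom)
  then obtain B where "\<And>x. x \<in> closure \<Omega> \<Longrightarrow> \<bar>u0 x\<bar> \<le> B"
    by (auto simp: bounded_iff)
  then show thesis
    using closure_subset[of \<Omega>] by (intro that[of "max B 0"]) (auto intro: max.coboundedI1)
qed

lemma growth_bounded:
  assumes "R \<ge> 0"
  shows "AE x in lebesgue. x \<in> \<Omega> \<longrightarrow> (\<forall>t. \<bar>t\<bar> \<le> R \<longrightarrow> \<bar>f x t\<bar> \<le> C * (R powr (r - 1) + 1))"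
  using growth unfolding AE_lebesgue_on_iff[OF open_dom]
proof eventually_elim
  case (elim x)
  show ?case
  proof (intro impI allI)
    fix t assume t: "x \<in> \<Omega>" "\<bar>t\<bar> \<le> R"
    have "\<bar>f x t\<bar> \<le> C * (\<bar>t\<bar> powr (r - 1) + 1)" using elim t(1) by blast
    also have "\<dots> \<le> C * (R powr (r - 1) + 1)"
      using t(2) C r by (intro mult_left_mono add_right_mono powr_mono2) auto
    finally show "\<bar>f x t\<bar> \<le> C * (R powr (r - 1) + 1)" .
  qed
qed

text \<open>
  By the equation the Laplacian is \<open>f\<close> at bounded arguments. For the reflected point the evenness
  of \<open>f\<close> is used, so that both bounds hold off the same null set.
\<close>

lemma laplacian_u0_bounds:
  obtains Q where "AE x in lebesgue. x \<in> \<Omega> \<longrightarrow> \<bar>laplacian u0 x\<bar> \<le> Q \<and> \<bar>laplacian u0 (reflect k x)\<bar> \<le> Q"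
proof -
  obtain R where R: "R \<ge> 0" "\<And>x. x \<in> \<Omega> \<Longrightarrow> \<bar>u0 x\<bar> \<le> R"
    by (rule u0_bounded) (rule that)
  have "AE x in lebesgue. x \<in> \<Omega> \<longrightarrow> \<bar>laplacian u0 x\<bar> \<le> C * (R powr (r - 1) + 1) \<and>
      \<bar>laplacian u0 (reflect k x)\<bar> \<le> C * (R powr (r - 1) + 1)"
    using growth_bounded[OF R(1)]
  proof eventually_elim
    case (elim x)
    show ?case
    proof
      assume x: "x \<in> \<Omega>"
      then show "\<bar>laplacian u0 x\<bar> \<le> C * (R powr (r - 1) + 1) \<and>
          \<bar>laplacian u0 (reflect k x)\<bar> \<le> C * (R powr (r - 1) + 1)"
        using elim R(2) reflect_dom[OF x] by (simp add: u0_equation even_f)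
    qed
  qed
  then show thesis by (rule that)
qed

lemma vanishing_u0:
  assumes Q: "AE x in lebesgue. x \<in> \<Omega> \<longrightarrow> \<bar>laplacian u0 x\<bar> \<le> Q"
  shows "vanishing_C2 \<Omega> u0 Q" "vanishing_C2 \<Omega> (\<lambda>x. - u0 x) Q"
proof -
  have 1: "compact {x \<in> \<Omega>. e \<le> c * u0 x}" if "e > 0" for e c
  proof -
    have "{x \<in> \<Omega>. e \<le> c * u0 x} = {x \<in> closure \<Omega>. e \<le> c * u0 x}"
    proof (intro equalityI subsetI)
      fix x assume x: "x \<in> {x \<in> closure \<Omega>. e \<le> c * u0 x}"
      then have "x \<in> \<Omega>" using reflect_frontier(1)[of x] \<open>e > 0\<close> by force
      then show "x \<in> {x \<in> \<Omega>. e \<le> c * u0 x}" using x by simp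
    qed (use closure_subset in auto)
    then show ?thesis
      using compact_superlevel_set[OF compact_closure_dom, of "\<lambda>x. c * u0 x" e] u0_cont
      by (simp add: continuous_on_mult)
  qed
  show "vanishing_C2 \<Omega> u0 Q"
    using 1[of _ 1] by (intro vanishing_C2.intro open_dom bounded_dom u0_C2 Q) auto
  have m: "Ck_on 2 \<Omega> (\<lambda>x. 0 - u0 x)"
    by (rule Ck_on_diff[OF open_dom Ck_on_const u0_C2])
  have l: "laplacian (\<lambda>x. - u0 x) x = - laplacian u0 x" if "x \<in> \<Omega>" for x
    using laplacian_diff[OF open_dom that Ck_on_const u0_C2, of 0]
    by (simp add: laplacian_def partial_const[abs_def])
  show "vanishing_C2 \<Omega> (\<lambda>x. - u0 x) Q"
  proof (intro vanishing_C2.intro open_dom bounded_dom)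
    show "AE x in lebesgue. x \<in> \<Omega> \<longrightarrow> \<bar>laplacian (\<lambda>x. - u0 x) x\<bar> \<le> Q"
      using Q by eventually_elim (auto simp: l)
  qed (use m 1[of _ "-1"] in auto)
qed

lemma w_C2: "Ck_on 2 \<Omega> w"
  by (intro Ck_on_diff open_dom u0_C2 Ck_on_reflect symmetric)

lemma laplacian_w: "x \<in> \<Omega> \<Longrightarrow> laplacian w x = f x (u0 (reflect k x)) - f x (u0 x)"
  using laplacian_diff[OF open_dom _ u0_C2 Ck_on_reflect[OF open_dom symmetric u0_C2], of x]
    laplacian_reflect[OF open_dom symmetric _ u0_C2, of x]
  by (simp add: u0_equation reflect_dom even_f)

text \<open>
  The parameter serves to treat \<open>half_pos\<close> and \<open>half_neg\<close> by one argument.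
\<close>

definition half :: "real \<Rightarrow> (real^'n) set" where
  "half \<sigma> = {x \<in> \<Omega>. \<sigma> * x $ k > 0}"

lemma half_open: "open (half \<sigma>)"
proof -
  have "half \<sigma> = \<Omega> \<inter> {x. \<sigma> * x $ k > 0}" by (auto simp: half_def)
  then show ?thesis
    using open_dom by (auto intro!: open_Int open_Collect_less continuous_intros)
qed

lemma half_subset: "half \<sigma> \<subseteq> \<Omega>"
  by (auto simp: half_def)

text \<open>
  The function \<open>w\<close> is continuous on the closed half and vanishes on its boundary: on the frontier of
  the domain both of its terms are \<open>0\<close>, and the points of the hyperplane are fixed by the reflection.
\<close>

lemma vanishing_w:
  assumes "\<sigma> \<noteq> 0"
  obtains Q where "vanishing_C2 (half \<sigma>) w Q"
proof -
  obtain Q where Q: "AE x in lebesgue. x \<in> \<Omega> \<longrightarrow> \<bar>laplacian u0 x\<bar> \<le> Q \<and> \<bar>laplacian u0 (reflect k x)\<bar> \<le> Q"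
    by (rule laplacian_u0_bounds) (rule that)
  have wc: "continuous_on (closure \<Omega>) w"
    using reflect_closure
    by (intro continuous_intros u0_cont continuous_on_compose2[OF u0_cont continuous_on_reflect]) auto
  show thesis
  proof (rule that[of "2 * Q"], intro vanishing_C2.intro half_open)
    show "bounded (half \<sigma>)" by (rule bounded_subset[OF bounded_dom half_subset])
    show "Ck_on 2 (half \<sigma>) w" by (rule Ck_on_subset[OF w_C2 half_subset])
    show "AE x in lebesgue. x \<in> half \<sigma> \<longrightarrow> \<bar>laplacian w x\<bar> \<le> 2 * Q"
      using Q
    proof eventually_elim
      case (elim x)
      show ?case
      proof
        assume "x \<in> half \<sigma>"
        then have x: "x \<in> \<Omega>" using half_subset by blast
        then have "laplacian w x = laplacian u0 x - laplacian u0 (reflect k x)"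
          by (simp add: laplacian_w u0_equation reflect_dom even_f)
        then show "\<bar>laplacian w x\<bar> \<le> 2 * Q" using elim x by linarith
      qed
    qed
    fix e :: real assume e: "e > 0"
    let ?S = "{x \<in> closure \<Omega>. 0 \<le> \<sigma> * x $ k}"
    have "compact ?S"
      by (rule compact_superlevel_set[OF compact_closure_dom]) (intro continuous_intros)
    then have "compact {x \<in> ?S. e \<le> w x}"
      by (rule compact_superlevel_set[OF _ continuous_on_subset[OF wc]]) auto
    moreover have "{x \<in> ?S. e \<le> w x} = {x \<in> half \<sigma>. e \<le> w x}"
    proof (intro equalityI subsetI)
      fix x assume x: "x \<in> {x \<in> ?S. e \<le> w x}"
      then have "x \<in> \<Omega>" using reflect_frontier[of x] e by force
      moreover have "x $ k \<noteq> 0"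
      proof
        assume "x $ k = 0"
        then have "reflect k x = x" by (auto simp: reflect_def vec_eq_iff)
        then show False using x e by simp
      qed
      ultimately show "x \<in> {x \<in> half \<sigma>. e \<le> w x}"
        using x assms by (auto simp: half_def less_le)
    qed (use closure_subset half_subset in \<open>fastforce simp: half_def\<close>)
    ultimately show "compact {x \<in> half \<sigma>. e \<le> w x}" by simp
  qed
qed

lemma carath_AE: "AE x in lebesgue. x \<in> \<Omega> \<longrightarrow> continuous_on UNIV (f x)"
  using carath unfolding caratheodory_def AE_lebesgue_on_iff[OF open_dom] by blast

text \<open>
  The function \<open>f\<close> is modified to \<open>0\<close> on a null set \<open>N\<close>, off which continuity and the bound
  hold, so that \<open>primitive_measurable\<close> applies.
\<close>

lemma primitive_integrable:
  assumes h: "(\<lambda>x. indicator \<Omega> x *\<^sub>R h x) \<in> borel_measurable lebesgue"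
    and R: "\<And>x. x \<in> \<Omega> \<Longrightarrow> \<bar>h x\<bar> \<le> R"
  shows "set_integrable lebesgue \<Omega> (\<lambda>x. primitive f x (h x))"
proof (cases "\<Omega> = {}")
  case False
  then have "R \<ge> 0" using R by force
  let ?Q = "C * (R powr (r - 1) + 1)"
  have "AE x in lebesgue. x \<in> \<Omega> \<longrightarrow> continuous_on UNIV (f x) \<and> (\<forall>t. \<bar>t\<bar> \<le> R \<longrightarrow> \<bar>f x t\<bar> \<le> ?Q)"
    using carath_AE growth_bounded[OF \<open>R \<ge> 0\<close>] by eventually_elim auto
  then obtain N where N: "N \<in> null_sets lebesgue"
    "{x. \<not> (x \<in> \<Omega> \<longrightarrow> continuous_on UNIV (f x) \<and> (\<forall>t. \<bar>t\<bar> \<le> R \<longrightarrow> \<bar>f x t\<bar> \<le> ?Q))} \<subseteq> N"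
    by (auto simp: eventually_ae_filter)
  have good: "continuous_on UNIV (f x)" "\<And>t. \<bar>t\<bar> \<le> R \<Longrightarrow> \<bar>f x t\<bar> \<le> ?Q" if "x \<in> \<Omega>" "x \<notin> N" for x
    using N(2) that by auto
  define g where "g x s = indicator (- N) x *\<^sub>R (indicator \<Omega> x *\<^sub>R f x s)" for x s
  have "(\<lambda>x. indicator \<Omega> x *\<^sub>R f x s) \<in> borel_measurable lebesgue" for s
    using carath dom_lebesgue borel_measurable_restrict_space_iff[of \<Omega> lebesgue "\<lambda>x. f x s"]
    by (simp add: caratheodory_def)
  moreover have N': "- N \<in> sets lebesgue"
    using null_setsD2[OF N(1)] by (metis Compl_in_sets_lebesgue)
  ultimately have gm: "(\<lambda>x. g x s) \<in> borel_measurable lebesgue" for s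
    unfolding g_def by (intro borel_measurable_scaleR[OF borel_measurable_indicator[OF N']])
  have gc: "continuous_on UNIV (g x)" for x
  proof (cases "x \<in> \<Omega> \<and> x \<notin> N")
    case True
    then have "g x = f x" by (auto simp: g_def fun_eq_iff)
    then show ?thesis using good(1) True by simp
  next
    case False
    then have "g x = (\<lambda>s. 0)" by (auto simp: g_def fun_eq_iff)
    then show ?thesis by simp
  qed
  let ?h = "\<lambda>x. indicator \<Omega> x *\<^sub>R h x"
  have m: "(\<lambda>x. LBINT s=0..?h x. g x s) \<in> borel_measurable lebesgue"
    by (rule primitive_measurable[OF gm gc h])
  have eq: "(LBINT s=0..?h x. g x s) = indicator \<Omega> x *\<^sub>R primitive f x (h x)" if "x \<notin> N" for x
    using that by (cases "x \<in> \<Omega>") (auto simp: primitive_def g_def zero_ereal_def[symmetric])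
  have "AE x in lebesgue. x \<notin> N" using N(1) by (rule AE_not_in)
  then have ae: "AE x in lebesgue. (LBINT s=0..?h x. g x s) = indicator \<Omega> x *\<^sub>R primitive f x (h x)"
    by eventually_elim (rule eq)
  have m': "(\<lambda>x. indicator \<Omega> x *\<^sub>R primitive f x (h x)) \<in> borel_measurable lebesgue"
    by (rule borel_measurable_lebesgue_cong_AE[OF m ae])
  show ?thesis
    unfolding set_integrable_def
  proof (rule Bochner_Integration.integrable_bound[OF integrable_indicator_bounded_open[OF open_dom bounded_dom, of "?Q * R"] m'])
    show "AE x in lebesgue. norm (indicator \<Omega> x *\<^sub>R primitive f x (h x)) \<le> norm (indicator \<Omega> x * (?Q * R))"
      using \<open>AE x in lebesgue. x \<notin> N\<close>
    proof eventually_elim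
      case (elim x)
      show ?case
      proof (cases "x \<in> \<Omega>")
        case True
        have "\<bar>primitive f x (h x)\<bar> \<le> ?Q * R"
          unfolding primitive_def by (rule primitive_bound[OF good(1)[OF True elim] good(2)[OF True elim] R[OF True]])
        then show ?thesis using True by simp
      qed simp
    qed
  qed
qed (simp add: set_integrable_def)

text \<open>
  The gradient terms of the functional are converted by testing the equations for \<open>u0\<close> and for \<open>w\<close>
  with \<open>v\<close> (facts \<open>E1\<close> and \<open>E2\<close>). What remains is an integrand without derivatives of \<open>v\<close>, whose sign can be
  discussed pointwise.
\<close>

lemma Psi_along_pos_part:
  assumes v: "vanishing_C2 (half \<sigma>) w Q"
  defines "v \<equiv> pos_part (half \<sigma>) w"
  defines "J \<equiv> \<lambda>t x. t * (v x * laplacian u0 x) - t\<^sup>2 / 2 * (v x * laplacian w x) +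
     (primitive f x (u0 x) - primitive f x (- t * v x + u0 x))"
  shows "set_integrable lebesgue \<Omega> (J t)"
    and "Psi \<Omega> f u0 (\<lambda>x. - t * v x) = (LINT x:\<Omega>|lebesgue. J t x)"
proof -
  interpret v: vanishing_C2 "half \<sigma>" w Q by fact
  let ?A = "half \<sigma>"
  let ?g = "pos_grad ?A w"
  obtain Q0 where Q0: "AE x in lebesgue. x \<in> \<Omega> \<longrightarrow> \<bar>laplacian u0 x\<bar> \<le> Q0 \<and> \<bar>laplacian u0 (reflect k x)\<bar> \<le> Q0"
    by (rule laplacian_u0_bounds) (rule that)
  have Q0': "AE x in lebesgue. x \<in> \<Omega> \<longrightarrow> \<bar>laplacian u0 x\<bar> \<le> Q0"
    using Q0 by eventually_elim auto
  have Q0A: "AE x in lebesgue. x \<in> ?A \<longrightarrow> \<bar>laplacian u0 x\<bar> \<le> Q0"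
    using Q0 by eventually_elim (use half_subset in blast)
  have u0_1: "Ck_on 1 \<Omega> u0" by (rule Ck_on_2_imp_1[OF u0_C2])
  have u0_A: "Ck_on 2 ?A u0" by (rule Ck_on_subset[OF u0_C2 half_subset])
  have v0: "v x = 0" "?g x = 0" if "x \<notin> \<Omega>" for x
    using that half_subset[of \<sigma>] by (auto simp: v_def pos_grad_def pos_set_def pos_part_def split: split_indicator)
  have gu: "integrable lebesgue (\<lambda>x. indicator \<Omega> x *\<^sub>R (norm (grad u0 x))\<^sup>2)"
    using vanishing_C2_grad_square_integrable[OF vanishing_u0[OF Q0']] unfolding set_integrable_def .
  have mgu: "(\<lambda>x. indicator \<Omega> x *\<^sub>R grad u0 x) \<in> borel_measurable lebesgue"
    by (intro measurable_continuous_indicator open_dom grad_continuous u0_1)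
  have inner_eq: "?g x \<bullet> grad u0 x = ?g x \<bullet> (indicator \<Omega> x *\<^sub>R grad u0 x)" for x
    by (cases "x \<in> \<Omega>") (auto simp: v0)
  have gg: "integrable lebesgue (\<lambda>x. ?g x \<bullet> grad u0 x)"
  proof (rule Bochner_Integration.integrable_bound)
    show "integrable lebesgue (\<lambda>x. (norm (?g x))\<^sup>2 + indicator \<Omega> x *\<^sub>R (norm (grad u0 x))\<^sup>2)"
      by (intro Bochner_Integration.integrable_add v.pos_grad_energy gu)
    show "(\<lambda>x. ?g x \<bullet> grad u0 x) \<in> borel_measurable lebesgue"
      unfolding inner_eq using v.pos_grad_measurable mgu by measurable
    show "AE x in lebesgue. norm (?g x \<bullet> grad u0 x) \<le> norm ((norm (?g x))\<^sup>2 + indicator \<Omega> x *\<^sub>R (norm (grad u0 x))\<^sup>2)"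
    proof (rule AE_I2)
      fix x
      show "norm (?g x \<bullet> grad u0 x) \<le> norm ((norm (?g x))\<^sup>2 + indicator \<Omega> x *\<^sub>R (norm (grad u0 x))\<^sup>2)"
      proof (cases "x \<in> \<Omega>")
        case True
        let ?a = "norm (?g x)" and ?b = "norm (grad u0 x)"
        have "\<bar>?g x \<bullet> grad u0 x\<bar> \<le> ?a * ?b" by (rule Cauchy_Schwarz_ineq2)
        also have "\<dots> \<le> ?a\<^sup>2 + ?b\<^sup>2"
          using zero_le_power2[of "?a - ?b"] mult_nonneg_nonneg[OF norm_ge_zero[of "?g x"] norm_ge_zero[of "grad u0 x"]]
          unfolding power2_diff by linarith
        finally show ?thesis using True by simp
      qed (simp add: v0)
    qed
  qed
  have E1: "(LINT x|lebesgue. ?g x \<bullet> grad u0 x) = - (LINT x|lebesgue. v x * laplacian u0 x)"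
    unfolding v_def by (rule v.pos_grad_inner_grad[OF u0_A Q0A gg])
  have E2: "(LINT x|lebesgue. (norm (?g x))\<^sup>2) = - (LINT x|lebesgue. v x * laplacian w x)"
    unfolding v_def by (rule v.pos_grad_energy(2))
  have i1: "integrable lebesgue (\<lambda>x. v x * laplacian u0 x)"
    unfolding v_def
    by (rule v.pos_part_mult_integrable(1)[OF laplacian_continuous[OF u0_A] Q0A])
  have i2: "integrable lebesgue (\<lambda>x. v x * laplacian w x)"
    unfolding v_def
    by (rule v.pos_part_mult_integrable(1)[OF laplacian_continuous[OF v.C2] v.laplacian_bound])
  obtain R where R: "R \<ge> 0" "\<And>x. x \<in> \<Omega> \<Longrightarrow> \<bar>u0 x\<bar> \<le> R"
    by (rule u0_bounded) (rule that)
  obtain B where B: "B \<ge> 0" "\<And>x. 0 \<le> v x" "\<And>x. v x \<le> B"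
    by (rule v.bounded_above[folded v_def]) (rule that)
  have mu: "(\<lambda>x. indicator \<Omega> x *\<^sub>R u0 x) \<in> borel_measurable lebesgue"
    by (intro measurable_continuous_indicator open_dom Ck_on_continuous[OF u0_1])
  have p1: "set_integrable lebesgue \<Omega> (\<lambda>x. primitive f x (u0 x))"
    by (rule primitive_integrable[OF mu R(2)])
  have p2: "set_integrable lebesgue \<Omega> (\<lambda>x. primitive f x (- t * v x + u0 x))"
  proof (rule primitive_integrable[of _ "\<bar>t\<bar> * B + R"])
    have "(\<lambda>x. - t * v x + indicator \<Omega> x *\<^sub>R u0 x) \<in> borel_measurable lebesgue"
      using v.pos_part_measurable mu unfolding v_def by measurable
    moreover have "- t * v x + indicator \<Omega> x *\<^sub>R u0 x = indicator \<Omega> x *\<^sub>R (- t * v x + u0 x)" for x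
      by (cases "x \<in> \<Omega>") (auto simp: v0)
    ultimately show "(\<lambda>x. indicator \<Omega> x *\<^sub>R (- t * v x + u0 x)) \<in> borel_measurable lebesgue"
      by (simp only:)
    fix x assume "x \<in> \<Omega>"
    have "\<bar>- t * v x\<bar> \<le> \<bar>t\<bar> * B"
      using B(2,3)[of x] by (auto simp: abs_mult intro!: mult_left_mono)
    then show "\<bar>- t * v x + u0 x\<bar> \<le> \<bar>t\<bar> * B + R"
      using R(2)[OF \<open>x \<in> \<Omega>\<close>] by linarith
  qed
  have iP: "set_integrable lebesgue \<Omega> (\<lambda>x. primitive f x (u0 x) - primitive f x (- t * v x + u0 x))"
    by (rule set_integral_diff(1)[OF p1 p2])
  note on_dom = set_integral_eq_if_zero_outside[of \<Omega>]
  have j1: "set_integrable lebesgue \<Omega> (\<lambda>x. t * (v x * laplacian u0 x) - t\<^sup>2 / 2 * (v x * laplacian w x))"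
    using i1 i2 by (subst on_dom(1)) (auto simp: v0)
  show J_int: "set_integrable lebesgue \<Omega> (J t)"
    unfolding J_def by (rule set_integral_add(1)[OF j1 iP])

  let ?U = "\<lambda>x. - t * v x + u0 x"
  let ?G = "\<lambda>x. - t *\<^sub>R ?g x + grad u0 x"
  have wg0: "has_weak_gradient \<Omega> u0 (grad u0)"
    by (rule has_weak_gradient_C1[OF open_dom u0_1])
  have wg: "has_weak_gradient \<Omega> ?U ?G"
    using has_weak_gradient_lincomb[OF v.pos_part_weak_gradient[OF half_subset] wg0, of "- t" 1]
    by (simp add: v_def)
  have sq: "(norm (?G x))\<^sup>2 / 2 = (norm (grad u0 x))\<^sup>2 / 2 + (- t * (?g x \<bullet> grad u0 x) + t\<^sup>2 / 2 * (norm (?g x))\<^sup>2)" for x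
    unfolding power2_norm_eq_inner
    by (simp add: inner_add_left inner_add_right inner_diff_left inner_diff_right inner_commute field_simps power2_eq_square)
  have s1: "set_integrable lebesgue \<Omega> (\<lambda>x. (norm (grad u0 x))\<^sup>2 / 2)"
    using gu by (simp add: set_integrable_def)
  have s2: "set_integrable lebesgue \<Omega> (\<lambda>x. - t * (?g x \<bullet> grad u0 x) + t\<^sup>2 / 2 * (norm (?g x))\<^sup>2)"
    using gg v.pos_grad_energy(1) by (subst on_dom(1)) (auto simp: v0)
  have s3: "set_integrable lebesgue \<Omega> (\<lambda>x. (norm (grad u0 x))\<^sup>2 / 2 - primitive f x (u0 x))"
    by (rule set_integral_diff(1)[OF s1 p1])
  have s4: "set_integrable lebesgue \<Omega> (\<lambda>x. (norm (?G x))\<^sup>2 / 2)"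
    unfolding sq by (rule set_integral_add(1)[OF s1 s2])
  have s5: "set_integrable lebesgue \<Omega> (\<lambda>x. (norm (?G x))\<^sup>2 / 2 - primitive f x (?U x))"
    by (rule set_integral_diff(1)[OF s4 p2])
  have Phi0: "Phi \<Omega> f u0 = (LINT x:\<Omega>|lebesgue. (norm (grad u0 x))\<^sup>2 / 2 - primitive f x (u0 x))"
    unfolding Phi_def
    by (rule set_integral_lebesgue_cong_AE(1)[OF s3])
      (use weak_gradient_AE_eq[OF open_dom wg0] in \<open>eventually_elim, auto\<close>)
  have Phi1: "Phi \<Omega> f ?U = (LINT x:\<Omega>|lebesgue. (norm (?G x))\<^sup>2 / 2 - primitive f x (?U x))"
    unfolding Phi_def
    by (rule set_integral_lebesgue_cong_AE(1)[OF s5])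
      (use weak_gradient_AE_eq[OF open_dom wg] in \<open>eventually_elim, auto\<close>)
  have "Psi \<Omega> f u0 (\<lambda>x. - t * v x) =
      (LINT x:\<Omega>|lebesgue. ((norm (?G x))\<^sup>2 / 2 - primitive f x (?U x)) - ((norm (grad u0 x))\<^sup>2 / 2 - primitive f x (u0 x)))"
    unfolding Psi_def Phi0 Phi1 by (rule set_integral_diff(2)[OF s5 s3, symmetric])
  also have "\<dots> = (LINT x:\<Omega>|lebesgue. (- t * (?g x \<bullet> grad u0 x) + t\<^sup>2 / 2 * (norm (?g x))\<^sup>2) +
      (primitive f x (u0 x) - primitive f x (?U x)))"
    unfolding sq by (simp add: algebra_simps)
  also have "\<dots> = (LINT x:\<Omega>|lebesgue. - t * (?g x \<bullet> grad u0 x) + t\<^sup>2 / 2 * (norm (?g x))\<^sup>2) +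
      (LINT x:\<Omega>|lebesgue. primitive f x (u0 x) - primitive f x (?U x))"
    by (rule set_integral_add(2)[OF s2 iP])
  also have "(LINT x:\<Omega>|lebesgue. - t * (?g x \<bullet> grad u0 x) + t\<^sup>2 / 2 * (norm (?g x))\<^sup>2) =
      - t * (LINT x|lebesgue. ?g x \<bullet> grad u0 x) + t\<^sup>2 / 2 * (LINT x|lebesgue. (norm (?g x))\<^sup>2)"
    using gg v.pos_grad_energy(1) by (subst on_dom(2)) (auto simp: v0)
  also have "\<dots> = t * (LINT x|lebesgue. v x * laplacian u0 x) - t\<^sup>2 / 2 * (LINT x|lebesgue. v x * laplacian w x)"
    unfolding E1 E2 by simp
  also have "\<dots> = (LINT x:\<Omega>|lebesgue. t * (v x * laplacian u0 x) - t\<^sup>2 / 2 * (v x * laplacian w x))"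
    using i1 i2 by (subst on_dom(2)) (auto simp: v0)
  also have "\<dots> + (LINT x:\<Omega>|lebesgue. primitive f x (u0 x) - primitive f x (?U x)) = (LINT x:\<Omega>|lebesgue. J t x)"
    unfolding J_def by (rule set_integral_add(2)[OF j1 iP, symmetric])
  finally show "Psi \<Omega> f u0 (\<lambda>x. - t * v x) = (LINT x:\<Omega>|lebesgue. J t x)" .
qed

text \<open>
  Along \<open>- t v\<close> the functional is nonpositive by \<open>primitive_convex_gap\<close>. In the strict minimizer case this
  forces \<open>v = 0\<close> almost everywhere. In the strictly convex case the integrand is negative wherever
  \<open>v > 0\<close>, so minimality leaves only a null set. An open null set is empty.
\<close>

lemma pos_set_empty:
  assumes \<sigma>: "\<sigma> \<noteq> 0"
    and min: "convexity_condition convex_on k f u0 (half \<sigma>) \<and>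
        strict_local_minimizer_H10 (half \<sigma>) (Psi_restr \<Omega> f u0 (half \<sigma>)) (\<lambda>_. 0) \<or>
      convexity_condition strictly_convex_on k f u0 (half \<sigma>) \<and>
        local_minimizer_H10 (half \<sigma>) (Psi_restr \<Omega> f u0 (half \<sigma>)) (\<lambda>_. 0)"
  shows "pos_set (half \<sigma>) w = {}"
proof -
  obtain Q where vQ: "vanishing_C2 (half \<sigma>) w Q"
    by (rule vanishing_w[OF \<sigma>]) (rule that)
  interpret v: vanishing_C2 "half \<sigma>" w Q by fact
  let ?A = "half \<sigma>"
  let ?D = "pos_set ?A w"
  define v where "v = pos_part ?A w"
  have v_pos: "v x = w x" "w x > 0" "x \<in> \<Omega>" if "x \<in> ?D" for x
    using that half_subset by (auto simp: v_def pos_part_def pos_set_def)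
  have v_zero: "v x = 0" if "x \<notin> ?D" for x
    using that by (auto simp: v_def pos_part_def)
  define J where "J t x = t * (v x * laplacian u0 x) - t\<^sup>2 / 2 * (v x * laplacian w x) +
     (primitive f x (u0 x) - primitive f x (- t * v x + u0 x))" for t x
  note J = Psi_along_pos_part[OF vQ, folded v_def, folded J_def]
  have J_zero: "J t x = 0" if "x \<notin> ?D" for t x
    using v_zero[OF that] by (simp add: J_def)
  have J_pos: "J t x = primitive f x (u0 x) - primitive f x (u0 x - t * w x) -
      (t * f x (u0 x) * w x - t\<^sup>2 / 2 * (f x (u0 x) - f x (u0 x - w x)) * w x)" if "x \<in> ?D" for t x
  proof -
    have alg: "t * (d * - a) - t\<^sup>2 / 2 * (d * (b - a)) + (p - q) =
        p - q - (t * a * d - t\<^sup>2 / 2 * (a - b) * d)" for a b d p q :: real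
      by (simp add: field_simps)
    have "u0 x - w x = u0 (reflect k x)" "- t * w x + u0 x = u0 x - t * w x" by simp_all
    then show ?thesis
      unfolding J_def v_pos(1)[OF that] u0_equation[OF v_pos(3)[OF that]] laplacian_w[OF v_pos(3)[OF that]]
      by (simp only: alg)
  qed
  define N where "N = sqrt (LINT x:?A|lebesgue. (v x)\<^sup>2 + (norm (pos_grad ?A w x))\<^sup>2)"
  have norm: "H1_norm ?A (\<lambda>x. - t * v x - 0) = t * N" if "t > 0" for t
    using v.H1_norm_scaled_pos_part[of "- t"] that by (simp add: v_def N_def)
  have in_H10: "(\<lambda>x. - t * v x) \<in> H10 ?A" for t
    unfolding v_def by (rule v.scaled_pos_part_in_H10)
  have ext: "zero_ext ?A (\<lambda>x. - t * v x) = (\<lambda>x. - t * v x)" for t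
    by (auto simp: zero_ext_def fun_eq_iff v_def pos_part_outside)
  have Psi0: "Psi_restr \<Omega> f u0 ?A (\<lambda>_. 0) = 0"
    by (simp add: Psi_restr_def zero_ext_def Psi_def)
  have Psit: "Psi_restr \<Omega> f u0 ?A (\<lambda>x. - t * v x) = (LINT x:\<Omega>|lebesgue. J t x)" for t
    unfolding Psi_restr_def ext by (rule J(2))
  have small: "\<exists>t>0. t \<le> 1 \<and> t * N < \<epsilon>" if "\<epsilon> > 0" for \<epsilon>
  proof -
    \<comment> \<open>The summand \<open>1\<close> covers the case \<open>N = 0\<close>.\<close>
    let ?t = "min 1 (\<epsilon> / (\<bar>N\<bar> + 1))"
    have "?t * N \<le> ?t * \<bar>N\<bar>" using that by (intro mult_left_mono) auto
    also have "\<dots> \<le> \<epsilon> / (\<bar>N\<bar> + 1) * \<bar>N\<bar>" by (intro mult_right_mono) auto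
    also have "\<dots> < \<epsilon>" using that by (simp add: field_simps)
    finally show ?thesis using that by (intro exI[of _ ?t]) auto
  qed
  have cvx: "AE x in lebesgue. x \<in> ?D \<longrightarrow> cv {u0 x - w x..u0 x} (f x)"
    if "convexity_condition cv k f u0 ?A" for cv
    using that unfolding convexity_condition_def AE_lebesgue_on_iff[OF half_open]
    by eventually_elim (auto simp: pos_set_def neg_part_def refl_diff_def)
  have D_null: "AE x in lebesgue. x \<notin> ?D"
    using min
  proof (elim disjE conjE)
    assume cc: "convexity_condition convex_on k f u0 ?A"
      and "strict_local_minimizer_H10 ?A (Psi_restr \<Omega> f u0 ?A) (\<lambda>_. 0)"
    then obtain \<epsilon> where \<epsilon>: "\<epsilon> > 0" "\<And>z. z \<in> H10 ?A \<Longrightarrow> H1_norm ?A (\<lambda>x. z x - 0) < \<epsilon> \<Longrightarrow>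
        \<not> (AE x in lebesgue_on ?A. z x = 0) \<Longrightarrow> Psi_restr \<Omega> f u0 ?A (\<lambda>_. 0) < Psi_restr \<Omega> f u0 ?A z"
      unfolding strict_local_minimizer_H10_def by blast
    obtain t where t: "0 < t" "t \<le> 1" "t * N < \<epsilon>" using small[OF \<epsilon>(1)] by blast
    have "AE x in lebesgue. J t x \<le> 0"
      using carath_AE cvx[OF cc]
    proof eventually_elim
      case (elim x)
      show ?case
      proof (cases "x \<in> ?D")
        case True
        then show ?thesis
          using primitive_convex_gap(1)[of "f x" "w x" t "u0 x"] elim t v_pos[OF True]
          by (simp add: J_pos primitive_def)
      qed (simp add: J_zero)
    qed
    then have "AE x in lebesgue. 0 \<le> - (indicator \<Omega> x *\<^sub>R J t x)"
      by eventually_elim (auto split: split_indicator)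
    from integral_nonneg_AE[OF this] have "(LINT x:\<Omega>|lebesgue. J t x) \<le> 0"
      by (simp add: set_lebesgue_integral_def)
    then have "AE x in lebesgue_on ?A. - t * v x = 0"
      using \<epsilon>(2)[OF in_H10[of t]] t norm[OF t(1)] unfolding Psi0 Psit by (metis not_less)
    then show ?thesis
      unfolding AE_lebesgue_on_iff[OF half_open]
      by eventually_elim (use t v_pos in \<open>force simp: pos_set_def\<close>)
  next
    assume cc: "convexity_condition strictly_convex_on k f u0 ?A"
      and "local_minimizer_H10 ?A (Psi_restr \<Omega> f u0 ?A) (\<lambda>_. 0)"
    then obtain \<epsilon> where \<epsilon>: "\<epsilon> > 0" "\<And>z. z \<in> H10 ?A \<Longrightarrow> H1_norm ?A (\<lambda>x. z x - 0) < \<epsilon> \<Longrightarrow>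
        Psi_restr \<Omega> f u0 ?A (\<lambda>_. 0) \<le> Psi_restr \<Omega> f u0 ?A z"
      unfolding local_minimizer_H10_def by blast
    obtain t where t: "0 < t" "t \<le> 1" "t * N < \<epsilon>" using small[OF \<epsilon>(1)] by blast
    have neg: "AE x in lebesgue. x \<in> ?D \<longrightarrow> J t x < 0"
      using carath_AE cvx[OF cc]
    proof eventually_elim
      case (elim x)
      show ?case
      proof
        assume D: "x \<in> ?D"
        then show "J t x < 0"
          using primitive_convex_gap(2)[of "f x" "w x" t "u0 x"] elim t v_pos[OF D]
          by (simp add: J_pos primitive_def)
      qed
    qed
    let ?I = "\<lambda>x. - (indicator \<Omega> x *\<^sub>R J t x)"
    have I: "integrable lebesgue ?I"
      using J(1)[of t] unfolding set_integrable_def by (rule Bochner_Integration.integrable_minus)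
    have I0: "AE x in lebesgue. 0 \<le> ?I x"
      using neg by eventually_elim (use J_zero in \<open>force split: split_indicator\<close>)
    have "0 \<le> (LINT x:\<Omega>|lebesgue. J t x)"
      using \<epsilon>(2)[OF in_H10[of t]] t norm[OF t(1)] unfolding Psi0 Psit by simp
    moreover have "(LINT x|lebesgue. ?I x) = - (LINT x:\<Omega>|lebesgue. J t x)"
      by (simp add: set_lebesgue_integral_def)
    moreover have "0 \<le> (LINT x|lebesgue. ?I x)"
      by (rule integral_nonneg_AE[OF I0])
    ultimately have "(LINT x|lebesgue. ?I x) = 0" by linarith
    then have "AE x in lebesgue. ?I x = 0"
      using integral_nonneg_eq_0_iff_AE[OF I I0] by blast
    with neg show ?thesis
      by eventually_elim (use v_pos(3) in fastforce)
  qed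
  then show ?thesis
    using open_null_set_empty[OF pos_set_open[OF half_open v.cont]] by blast
qed

text \<open>
  The hypotheses give \<open>u0 \<le> u0 \<circ> reflect k\<close> on both halves, and the reflection exchanges them.
\<close>

lemma symmetric_if_pos_sets_empty:
  assumes "pos_set (half 1) w = {}" "pos_set (half (-1)) w = {}" and x: "x \<in> \<Omega>"
  shows "u0 (reflect k x) = u0 x"
proof -
  have le: "u0 y \<le> u0 (reflect k y)" if "y \<in> \<Omega>" for y
  proof (cases "y $ k" "0::real" rule: linorder_cases)
    case equal
    then have "reflect k y = y" by (auto simp: reflect_def vec_eq_iff)
    then show ?thesis by simp
  next
    case greater
    then have "y \<in> half 1" using that by (simp add: half_def)
    then show ?thesis using assms(1) by (force simp: pos_set_def)
  next
    case less
    then have "y \<in> half (-1)" using that by (simp add: half_def)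
    then show ?thesis using assms(2) by (force simp: pos_set_def)
  qed
  show ?thesis using le[OF x] le[OF reflect_dom[OF x]] by simp
qed

lemma half_pos_eq: "half_pos k \<Omega> = half 1" and half_neg_eq: "half_neg k \<Omega> = half (-1)"
  by (auto simp: half_pos_def half_neg_def half_def)

end

theorem proposition2p1:
  fixes \<Omega> :: "(real^'n::finite) set"
    and k :: 'n
    and f :: "real^'n \<Rightarrow> real \<Rightarrow> real"
    and u0 :: "real^'n \<Rightarrow> real"
    and C r :: real
  assumes dim: "CARD('n) \<ge> 2"
    and domain: "open \<Omega>" "connected \<Omega>" "bounded \<Omega>" "0 \<in> \<Omega>"
    and symmetric: "reflect k ` \<Omega> = \<Omega>"
    and caratheodory: "caratheodory \<Omega> f"
    and even_f: "\<forall>x\<in>\<Omega>. \<forall>t. f (reflect k x) t = f x t"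
    and solution: "classical_solution \<Omega> f u0"
    and C: "C > 0"
    and r: "r > 1" "CARD('n) \<ge> 3 \<longrightarrow> r < 2 * real CARD('n) / (real CARD('n) - 2)"
    and growth: "AE x in lebesgue_on \<Omega>. \<forall>t. \<bar>f x t\<bar> \<le> C * (\<bar>t\<bar> powr (r - 1) + 1)"
  shows
    "(convexity_condition convex_on k f u0 (half_pos k \<Omega>) \<and>
      convexity_condition convex_on k f u0 (half_neg k \<Omega>) \<and>
      strict_local_minimizer_H10 (half_pos k \<Omega>) (Psi_restr \<Omega> f u0 (half_pos k \<Omega>)) (\<lambda>_. 0) \<and>
      strict_local_minimizer_H10 (half_neg k \<Omega>) (Psi_restr \<Omega> f u0 (half_neg k \<Omega>)) (\<lambda>_. 0)
      \<longrightarrow> (\<forall>x\<in>\<Omega>. u0 (reflect k x) = u0 x)) \<and>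
     (convexity_condition strictly_convex_on k f u0 (half_pos k \<Omega>) \<and>
      convexity_condition strictly_convex_on k f u0 (half_neg k \<Omega>) \<and>
      local_minimizer_H10 (half_pos k \<Omega>) (Psi_restr \<Omega> f u0 (half_pos k \<Omega>)) (\<lambda>_. 0) \<and>
      local_minimizer_H10 (half_neg k \<Omega>) (Psi_restr \<Omega> f u0 (half_neg k \<Omega>)) (\<lambda>_. 0)
      \<longrightarrow> (\<forall>x\<in>\<Omega>. u0 (reflect k x) = u0 x))"
proof -
  interpret symmetric_problem \<Omega> k f u0 C r
    by (intro symmetric_problem.intro domain symmetric caratheodory solution C r growth)
      (use even_f in blast)
  have even: "\<forall>x\<in>\<Omega>. u0 (reflect k x) = u0 x"
    if "pos_set (half 1) w = {}" "pos_set (half (-1)) w = {}"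
    using symmetric_if_pos_sets_empty[OF that] by blast
  show ?thesis
    unfolding half_pos_eq half_neg_eq
  proof (intro conjI impI; elim conjE)
    assume *: "convexity_condition convex_on k f u0 (half 1)" "convexity_condition convex_on k f u0 (half (-1))"
      "strict_local_minimizer_H10 (half 1) (Psi_restr \<Omega> f u0 (half 1)) (\<lambda>_. 0)"
      "strict_local_minimizer_H10 (half (-1)) (Psi_restr \<Omega> f u0 (half (-1))) (\<lambda>_. 0)"
    show "\<forall>x\<in>\<Omega>. u0 (reflect k x) = u0 x"
      by (intro even pos_set_empty disjI1 conjI *) simp_all
  next
    assume *: "convexity_condition strictly_convex_on k f u0 (half 1)"
      "convexity_condition strictly_convex_on k f u0 (half (-1))"
      "local_minimizer_H10 (half 1) (Psi_restr \<Omega> f u0 (half 1)) (\<lambda>_. 0)"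
      "local_minimizer_H10 (half (-1)) (Psi_restr \<Omega> f u0 (half (-1))) (\<lambda>_. 0)"
    show "\<forall>x\<in>\<Omega>. u0 (reflect k x) = u0 x"
      by (intro even pos_set_empty disjI2 conjI *) simp_all
  qed
qed

end
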